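(* Let $R$ be a Cohen–Macaulay ring with $\dim R_M=1$ for every maximal ideal $M$ of $R$. If $R$ is an anti-stable ring, then $R$ is a stable ring.
   Context: Rings are commutative; Cohen–Macaulay rings are Noetherian. Let $\mathrm Q(R)$ be the total ring of fractions of $R$; for $R$-submodules $X,Y$ of $\mathrm Q(R)$, $X:Y=\{a\in\mathrm Q(R)\mid aY\subseteq X\}$. An ideal is regular if it contains a non-zerodivisor of $R$. For a regular ideal $I$, $R:I$ is naturally a module over the ring $I:I$, and $R:I=\operatorname{Hom}_R(I,R)$, $I:I=\operatorname{End}_R(I)$ via natural identifications. $R$ is anti-stable if for every regular ideal $I$ of $R$, $R:I$ is an invertible $(I:I)$-module. $R$ is stable if every ideal $I$ of $R$ (regular or not) is projective as a module over its endomorphism ring $\operatorname{End}_R(I)$. *)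

theory Defs
  imports "HOL-Algebra.Module" "HOL-Algebra.Ring_Divisibility" "HOL-Library.Extended_Nat"
begin

section \<open>Left modules, free and projective modules\<close>

text \<open>
  The library locale \<^locale>\<open>module\<close> requires a commutative ring of scalars. Endomorphism rings
  need not be commutative, so left modules over arbitrary rings are introduced here. As in the
  library, the fields \<^const>\<open>monoid.mult\<close> and \<^const>\<open>monoid.one\<close> of a module record are irrelevant.
\<close>

locale left_module = A?: ring A + M?: abelian_group M
  for A :: "('a, 'm) ring_scheme" (structure) and M :: "('a, 'b) module" (structure) +
  assumes smult_closed: "\<lbrakk>a \<in> carrier A; x \<in> carrier M\<rbrakk> \<Longrightarrow> a \<odot>\<^bsub>M\<^esub> x \<in> carrier M"
    and smult_l_distr: "\<lbrakk>a \<in> carrier A; b \<in> carrier A; x \<in> carrier M\<rbrakk>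
      \<Longrightarrow> (a \<oplus>\<^bsub>A\<^esub> b) \<odot>\<^bsub>M\<^esub> x = a \<odot>\<^bsub>M\<^esub> x \<oplus>\<^bsub>M\<^esub> b \<odot>\<^bsub>M\<^esub> x"
    and smult_r_distr: "\<lbrakk>a \<in> carrier A; x \<in> carrier M; y \<in> carrier M\<rbrakk>
      \<Longrightarrow> a \<odot>\<^bsub>M\<^esub> (x \<oplus>\<^bsub>M\<^esub> y) = a \<odot>\<^bsub>M\<^esub> x \<oplus>\<^bsub>M\<^esub> a \<odot>\<^bsub>M\<^esub> y"
    and smult_assoc: "\<lbrakk>a \<in> carrier A; b \<in> carrier A; x \<in> carrier M\<rbrakk>
      \<Longrightarrow> (a \<otimes>\<^bsub>A\<^esub> b) \<odot>\<^bsub>M\<^esub> x = a \<odot>\<^bsub>M\<^esub> (b \<odot>\<^bsub>M\<^esub> x)"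
    and smult_one: "x \<in> carrier M \<Longrightarrow> \<one>\<^bsub>A\<^esub> \<odot>\<^bsub>M\<^esub> x = x"

text \<open>Linear maps are extensional, so that equality of maps is equality on the carrier.\<close>

definition lin_maps ::
  "('a, 'm) ring_scheme \<Rightarrow> ('a, 'b) module \<Rightarrow> ('a, 'c) module \<Rightarrow> ('b \<Rightarrow> 'c) set" where
  "lin_maps A M N = {f \<in> carrier M \<rightarrow>\<^sub>E carrier N.
     (\<forall>x\<in>carrier M. \<forall>y\<in>carrier M. f (x \<oplus>\<^bsub>M\<^esub> y) = f x \<oplus>\<^bsub>N\<^esub> f y) \<and>
     (\<forall>a\<in>carrier A. \<forall>x\<in>carrier M. f (a \<odot>\<^bsub>M\<^esub> x) = a \<odot>\<^bsub>N\<^esub> f x)}"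

definition module_iso ::
  "('a, 'm) ring_scheme \<Rightarrow> ('a, 'b) module \<Rightarrow> ('a, 'c) module \<Rightarrow> bool" where
  "module_iso A M N \<longleftrightarrow> (\<exists>f \<in> lin_maps A M N. bij_betw f (carrier M) (carrier N))"

text \<open>The free left module of finitely supported families indexed by \<open>B\<close>.\<close>

definition free_module :: "('a, 'm) ring_scheme \<Rightarrow> 'b set \<Rightarrow> ('a, 'b \<Rightarrow> 'a) module" where
  "free_module A B =
     \<lparr>carrier = {v \<in> B \<rightarrow>\<^sub>E carrier A. finite {b \<in> B. v b \<noteq> \<zero>\<^bsub>A\<^esub>}},
      mult = undefined, one = undefined,
      zero = (\<lambda>b\<in>B. \<zero>\<^bsub>A\<^esub>),
      add = (\<lambda>v w. \<lambda>b\<in>B. v b \<oplus>\<^bsub>A\<^esub> w b),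
      smult = (\<lambda>a v. \<lambda>b\<in>B. a \<otimes>\<^bsub>A\<^esub> v b)\<rparr>"

text \<open>
  A module is projective if it is a direct summand of a free module, i.e. the inclusion
  \<open>i\<close> into the free module is split by a projection \<open>p\<close>. Taking the basis among subsets of
  the carrier of \<open>M\<close> is no restriction: the free module on all of \<^term>\<open>carrier M\<close> maps onto \<open>M\<close>,
  and this surjection splits as soon as \<open>M\<close> is a summand of some free module.
\<close>

definition projective_module :: "('a, 'm) ring_scheme \<Rightarrow> ('a, 'b) module \<Rightarrow> bool" where
  "projective_module A M \<longleftrightarrow> left_module A M \<and>
     (\<exists>B \<subseteq> carrier M. \<exists>i \<in> lin_maps A M (free_module A B). \<exists>p \<in> lin_maps A (free_module A B) M.
        \<forall>x\<in>carrier M. p (i x) = x)"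

definition fin_gen_module :: "('a, 'm) ring_scheme \<Rightarrow> ('a, 'b) module \<Rightarrow> bool" where
  "fin_gen_module A M \<longleftrightarrow>
     (\<exists>B \<subseteq> carrier M. finite B \<and>
        (\<forall>x\<in>carrier M. \<exists>c \<in> B \<rightarrow> carrier A. x = (\<Oplus>\<^bsub>M\<^esub>b\<in>B. c b \<odot>\<^bsub>M\<^esub> b)))"

text \<open>
  A subset \<open>X\<close> of a ring \<open>R\<close> with the addition of \<open>R\<close> and scalars acting by multiplication in \<open>R\<close>.
  This serves for ideals of \<open>R\<close> as \<open>R\<close>-modules, but also for subgroups of \<open>R\<close> as modules over a
  subring of \<open>R\<close>.
\<close>

definition mult_module :: "('a, 'm) ring_scheme \<Rightarrow> 'a set \<Rightarrow> ('a, 'a) module" where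
  "mult_module R X =
     \<lparr>carrier = X, mult = mult R, one = one R, zero = zero R, add = add R, smult = mult R\<rparr>"

section \<open>Endomorphism rings\<close>

definition End_ring :: "('a, 'm) ring_scheme \<Rightarrow> ('a, 'b) module \<Rightarrow> ('b \<Rightarrow> 'b) ring" where
  "End_ring R M =
     \<lparr>carrier = lin_maps R M M,
      mult = (\<lambda>f g. compose (carrier M) f g), one = (\<lambda>x\<in>carrier M. x),
      zero = (\<lambda>x\<in>carrier M. \<zero>\<^bsub>M\<^esub>), add = (\<lambda>f g. \<lambda>x\<in>carrier M. f x \<oplus>\<^bsub>M\<^esub> g x)\<rparr>"

definition End_module :: "('a, 'b) module \<Rightarrow> ('b \<Rightarrow> 'b, 'b) module" where
  "End_module M =
     \<lparr>carrier = carrier M, mult = mult M, one = one M, zero = zero M, add = add M,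
      smult = (\<lambda>f x. f x)\<rparr>"

section \<open>Localization\<close>

text \<open>The fraction \<open>m / s\<close>, for a multiplicative set \<open>S\<close> of scalars, as an equivalence class.\<close>

definition loc_frac :: "('a, 'b) module \<Rightarrow> 'a set \<Rightarrow> 'b \<Rightarrow> 'a \<Rightarrow> ('b \<times> 'a) set" where
  "loc_frac M S m s = {(n, t). n \<in> carrier M \<and> t \<in> S \<and>
     (\<exists>u\<in>S. u \<odot>\<^bsub>M\<^esub> (t \<odot>\<^bsub>M\<^esub> m) = u \<odot>\<^bsub>M\<^esub> (s \<odot>\<^bsub>M\<^esub> n))}"

text \<open>
  The unions below range over all representatives; the sets united coincide, since the operations
  are well defined.
\<close>

definition loc_module ::
  "('a, 'm) ring_scheme \<Rightarrow> 'a set \<Rightarrow> ('a, 'b) module \<Rightarrow> (('a \<times> 'a) set, ('b \<times> 'a) set) module" where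
  "loc_module R S M =
     \<lparr>carrier = {loc_frac M S m s | m s. m \<in> carrier M \<and> s \<in> S},
      mult = undefined, one = undefined,
      zero = loc_frac M S \<zero>\<^bsub>M\<^esub> \<one>\<^bsub>R\<^esub>,
      add = (\<lambda>X Y. \<Union>(m, s)\<in>X. \<Union>(n, t)\<in>Y. loc_frac M S (t \<odot>\<^bsub>M\<^esub> m \<oplus>\<^bsub>M\<^esub> s \<odot>\<^bsub>M\<^esub> n) (s \<otimes>\<^bsub>R\<^esub> t)),
      smult = (\<lambda>X Y. \<Union>(a, s)\<in>X. \<Union>(m, t)\<in>Y. loc_frac M S (a \<odot>\<^bsub>M\<^esub> m) (s \<otimes>\<^bsub>R\<^esub> t))\<rparr>"

definition loc_ring :: "('a, 'm) ring_scheme \<Rightarrow> 'a set \<Rightarrow> ('a \<times> 'a) set ring" where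
  "loc_ring R S = (let L = loc_module R S (mult_module R (carrier R)) in
     \<lparr>carrier = carrier L, mult = smult L, one = loc_frac (mult_module R (carrier R)) S \<one>\<^bsub>R\<^esub> \<one>\<^bsub>R\<^esub>,
      zero = zero L, add = add L\<rparr>)"

abbreviation loc_ring_at :: "('a, 'm) ring_scheme \<Rightarrow> 'a set \<Rightarrow> ('a \<times> 'a) set ring" where
  "loc_ring_at R P \<equiv> loc_ring R (carrier R - P)"

abbreviation loc_module_at ::
  "('a, 'm) ring_scheme \<Rightarrow> 'a set \<Rightarrow> ('a, 'b) module \<Rightarrow> (('a \<times> 'a) set, ('b \<times> 'a) set) module" where
  "loc_module_at R P M \<equiv> loc_module R (carrier R - P) M"

section \<open>Invertible modules\<close>

text \<open>Finitely generated projective modules of constant rank one over a commutative ring.\<close>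

definition invertible_module :: "('a, 'm) ring_scheme \<Rightarrow> ('a, 'b) module \<Rightarrow> bool" where
  "invertible_module A M \<longleftrightarrow> cring A \<and> fin_gen_module A M \<and> projective_module A M \<and>
     (\<forall>P. primeideal P A \<longrightarrow>
        module_iso (loc_ring_at A P) (loc_module_at A P M)
          (mult_module (loc_ring_at A P) (carrier (loc_ring_at A P))))"

section \<open>Dimension, depth and Cohen--Macaulay rings\<close>

definition krull_dim :: "('a, 'm) ring_scheme \<Rightarrow> enat" where
  "krull_dim R = Sup {enat n | n. \<exists>P :: nat \<Rightarrow> 'a set.
     (\<forall>i\<le>n. primeideal (P i) R) \<and> (\<forall>i<n. P i \<subset> P (Suc i))}"

text \<open>
  Multiplication by \<open>x\<^sub>i\<close> is injective on the quotient of \<open>R\<close> by the ideal generated by the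
  preceding elements, and the ideal generated by all elements is proper.
\<close>

definition regular_sequence :: "('a, 'm) ring_scheme \<Rightarrow> 'a list \<Rightarrow> bool" where
  "regular_sequence R xs \<longleftrightarrow> set xs \<subseteq> carrier R \<and>
     (\<forall>i<length xs. \<forall>a\<in>carrier R.
        xs ! i \<otimes>\<^bsub>R\<^esub> a \<in> Idl\<^bsub>R\<^esub> (set (take i xs)) \<longrightarrow> a \<in> Idl\<^bsub>R\<^esub> (set (take i xs))) \<and>
     Idl\<^bsub>R\<^esub> (set xs) \<noteq> carrier R"

definition ideal_depth :: "('a, 'm) ring_scheme \<Rightarrow> 'a set \<Rightarrow> enat" where
  "ideal_depth R I = Sup {enat (length xs) | xs. regular_sequence R xs \<and> set xs \<subseteq> I}"

definition cohen_macaulay_local :: "('a, 'm) ring_scheme \<Rightarrow> bool" where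
  "cohen_macaulay_local R \<longleftrightarrow> cring R \<and> noetherian_ring R \<and>
     (\<exists>M. {M'. maximalideal M' R} = {M} \<and> ideal_depth R M = krull_dim R)"

definition cohen_macaulay :: "('a, 'm) ring_scheme \<Rightarrow> bool" where
  "cohen_macaulay R \<longleftrightarrow> cring R \<and> noetherian_ring R \<and>
     (\<forall>M. maximalideal M R \<longrightarrow> cohen_macaulay_local (loc_ring_at R M))"

section \<open>Stable and anti-stable rings\<close>

definition nonzerodivisors :: "('a, 'm) ring_scheme \<Rightarrow> 'a set" where
  "nonzerodivisors R = {s \<in> carrier R. \<forall>a\<in>carrier R. s \<otimes>\<^bsub>R\<^esub> a = \<zero>\<^bsub>R\<^esub> \<longrightarrow> a = \<zero>\<^bsub>R\<^esub>}"

definition regular_ideal :: "('a, 'm) ring_scheme \<Rightarrow> 'a set \<Rightarrow> bool" where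
  "regular_ideal R I \<longleftrightarrow> ideal I R \<and> I \<inter> nonzerodivisors R \<noteq> {}"

definition total_frac :: "('a, 'm) ring_scheme \<Rightarrow> ('a \<times> 'a) set ring" where
  "total_frac R = loc_ring R (nonzerodivisors R)"

text \<open>The canonical image in the total ring of fractions of a subset of \<open>R\<close>.\<close>

definition in_total_frac :: "('a, 'm) ring_scheme \<Rightarrow> 'a set \<Rightarrow> ('a \<times> 'a) set set" where
  "in_total_frac R I =
     (\<lambda>a. loc_frac (mult_module R (carrier R)) (nonzerodivisors R) a \<one>\<^bsub>R\<^esub>) ` I"

text \<open>\<open>X : Y\<close> for subsets \<open>X\<close>, \<open>Y\<close> of \<open>Q\<close>.\<close>

definition colon :: "('a, 'm) ring_scheme \<Rightarrow> 'a set \<Rightarrow> 'a set \<Rightarrow> 'a set" where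
  "colon Q X Y = {a \<in> carrier Q. \<forall>y\<in>Y. a \<otimes>\<^bsub>Q\<^esub> y \<in> X}"

text \<open>The ring \<open>I : I\<close> and the module \<open>R : I\<close> over it.\<close>

definition colon_ring :: "('a, 'm) ring_scheme \<Rightarrow> 'a set \<Rightarrow> ('a \<times> 'a) set ring" where
  "colon_ring R I = total_frac R
     \<lparr>carrier := colon (total_frac R) (in_total_frac R I) (in_total_frac R I)\<rparr>"

definition colon_module ::
  "('a, 'm) ring_scheme \<Rightarrow> 'a set \<Rightarrow> (('a \<times> 'a) set, ('a \<times> 'a) set) module" where
  "colon_module R I = mult_module (total_frac R)
     (colon (total_frac R) (in_total_frac R (carrier R)) (in_total_frac R I))"

definition anti_stable_ring :: "('a, 'm) ring_scheme \<Rightarrow> bool" where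
  "anti_stable_ring R \<longleftrightarrow> cring R \<and>
     (\<forall>I. regular_ideal R I \<longrightarrow> invertible_module (colon_ring R I) (colon_module R I))"

definition stable_ring :: "('a, 'm) ring_scheme \<Rightarrow> bool" where
  "stable_ring R \<longleftrightarrow> cring R \<and>
     (\<forall>I. ideal I R \<longrightarrow>
        projective_module (End_ring R (mult_module R I)) (End_module (mult_module R I)))"

end

theory Submission
  imports Defs "HOL-Algebra.Subrings" "HOL-Algebra.Ideal_Product"
begin

text \<open>
  Let \<open>Q\<close> be the total ring of fractions of \<open>R\<close> and \<open>K\<close> the copy of \<open>R\<close> inside \<open>Q\<close>; all colons are
  taken in \<open>Q\<close>. Projectivity of \<open>K : F\<close> over \<open>A = F : F\<close> is the same as \<open>1 \<in> (K : F) (A : (K : F))\<close>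
  (\<open>one_in_prod_of_projective\<close>), so anti-stability says that the dual \<open>X = K : F\<close> of every regular
  fractional ideal \<open>F\<close> is invertible over \<open>A\<close>.

  \<^bold>\<open>Regular ideals.\<close> The ring \<open>A\<close> is itself a regular fractional ideal with \<open>A : A = A\<close>, hence its dual,
  the conductor \<open>c = K : A\<close>, is invertible over \<open>A\<close> as well. The product \<open>J = F X (A : c)\<close> is a regular
  ideal of \<open>A\<close>, and invertibility of \<open>X\<close> and \<open>c\<close> gives \<open>A : J = A\<close>. As \<open>A\<close> is a finite overring of a
  one-dimensional Cohen--Macaulay ring, \<open>A : J\<close> is strictly larger than \<open>A\<close> for every proper regular
  ideal \<open>J\<close>; hence \<open>J = A\<close> (\<open>one_in_of_trivial_dual\<close>). The equation \<open>1 \<in> F X (A : c)\<close> says two things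
  at once: \<open>F\<close> is invertible over \<open>A\<close>, and \<open>F = K : (K : F)\<close>
  (\<open>regular_fractional_stable_reflexive\<close>).

  \<^bold>\<open>Arbitrary ideals.\<close> An ideal \<open>I\<close> that may consist of zero divisors is reduced to the regular case by
  writing \<open>I = u G\<close> with \<open>u \<in> I\<close> and \<open>G\<close> a regular fractional ideal, which is possible as soon as
  \<open>I Q = u Q\<close>. So the point is that ideals of \<open>Q\<close> are principal. This is extracted from the regular
  fractional ideals \<open>K + K s/z + K a/z\<close>, where \<open>z\<close> runs through all regular elements: by a Krull
  intersection argument (\<open>ideal_closed_of_regular_approximation\<close>), relations that hold up to
  multiples of \<open>z\<close> for all \<open>z\<close> hold exactly. Stability of these modules shows that square-zero elements
  of \<open>Q\<close> multiply to zero (\<open>product_zero\<close>), and reflexivity shows that \<open>v \<in> u Q\<close> whenever the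
  annihilator of \<open>u\<close> kills \<open>v\<close> (\<open>double_annihilator\<close>). In other words, the local factors of the Artinian
  ring \<open>Q\<close> have length at most two. Then an element \<open>w \<in> I\<close> for which \<open>w Q\<close> is maximal generates
  \<open>I Q\<close> (\<open>generator_over_fractions\<close>).

  \<^bold>\<open>Projectivity.\<close> If \<open>I = u G\<close> and \<open>1 = \<Sum> g\<^sub>j y\<^sub>j\<close> with \<open>g\<^sub>j \<in> G\<close> and \<open>y\<^sub>j \<in> (G : G) : G\<close>, then the maps
  \<open>u g \<mapsto> (u h \<mapsto> u y\<^sub>j g h)\<close> from \<open>I\<close> to its endomorphism ring and the elements \<open>u g\<^sub>j\<close> form a dual basis of
  \<open>I\<close> (\<open>projective_of_fractional_factor\<close>).
\<close>

section \<open>Submodules, colons and products inside a commutative ring\<close>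

context cring
begin

text \<open>
  Submodules of the ambient ring over a subset \<open>A\<close> of scalars. Ideals of a subring \<open>A\<close>, fractional
  ideals and their duals are all of this kind, with \<open>A\<close> varying within one argument.
\<close>

definition submod :: "'a set \<Rightarrow> 'a set \<Rightarrow> bool" where
  "submod A X \<longleftrightarrow> X \<subseteq> carrier R \<and> \<zero> \<in> X \<and> (\<forall>x\<in>X. \<forall>y\<in>X. x \<oplus> y \<in> X) \<and> (\<forall>a\<in>A. \<forall>x\<in>X. a \<otimes> x \<in> X)"

lemma submodI:
  assumes "X \<subseteq> carrier R" "\<zero> \<in> X" "\<And>x y. \<lbrakk>x \<in> X; y \<in> X\<rbrakk> \<Longrightarrow> x \<oplus> y \<in> X"
    "\<And>a x. \<lbrakk>a \<in> A; x \<in> X\<rbrakk> \<Longrightarrow> a \<otimes> x \<in> X"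
  shows "submod A X"
  using assms by (auto simp: submod_def)

lemma submodD:
  assumes "submod A X"
  shows "X \<subseteq> carrier R" "x \<in> X \<Longrightarrow> x \<in> carrier R" "\<zero> \<in> X"
    "\<lbrakk>x \<in> X; y \<in> X\<rbrakk> \<Longrightarrow> x \<oplus> y \<in> X" "\<lbrakk>a \<in> A; x \<in> X\<rbrakk> \<Longrightarrow> a \<otimes> x \<in> X"
  using assms by (auto simp: submod_def)

lemma submod_minus:
  assumes A: "subring A R" and X: "submod A X" and x: "x \<in> X" and y: "y \<in> X"
  shows "\<ominus> x \<in> X" "x \<ominus> y \<in> X"
proof -
  have neg: "\<ominus> x \<in> X" if "x \<in> X" for x
  proof -
    have "\<ominus> \<one> \<otimes> x \<in> X"
      using subringE(3,5)[OF A] submodD(5)[OF X] that by blast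
    moreover have "\<ominus> \<one> \<otimes> x = \<ominus> x"
      using submodD(2)[OF X that] l_minus[of \<one> x] by simp
    ultimately show ?thesis by simp
  qed
  from x neg show "\<ominus> x \<in> X" by blast
  from x y neg submodD(4)[OF X] show "x \<ominus> y \<in> X" by (simp add: a_minus_def)
qed

lemma submod_mono: "\<lbrakk>submod A X; B \<subseteq> A\<rbrakk> \<Longrightarrow> submod B X"
  by (auto simp: submod_def)

lemma submod_self: "subring A R \<Longrightarrow> submod A A"
  using subringE(1,2,6,7) by (metis submodI)

lemma submod_inter: "\<lbrakk>submod A X; submod A Y\<rbrakk> \<Longrightarrow> submod A (X \<inter> Y)"
  by (auto simp: submod_def)

lemma submod_sum:
  assumes X: "submod A X" and Y: "submod A Y" and A: "A \<subseteq> carrier R"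
  shows "submod A {x \<oplus> y | x y. x \<in> X \<and> y \<in> Y}" (is "submod A ?S")
proof (rule submodI)
  show "?S \<subseteq> carrier R" using submodD(2)[OF X] submodD(2)[OF Y] by auto
  have "\<zero> = \<zero> \<oplus> \<zero>" by simp
  then show "\<zero> \<in> ?S" using submodD(3)[OF X] submodD(3)[OF Y] by blast
next
  fix u v assume "u \<in> ?S" "v \<in> ?S"
  then obtain x y x' y' where h: "x \<in> X" "y \<in> Y" "x' \<in> X" "y' \<in> Y" "u = x \<oplus> y" "v = x' \<oplus> y'" by auto
  then have "u \<oplus> v = (x \<oplus> x') \<oplus> (y \<oplus> y')"
    using submodD(2)[OF X] submodD(2)[OF Y] by (simp add: a_ac)
  then show "u \<oplus> v \<in> ?S" using h submodD(4)[OF X] submodD(4)[OF Y] by blast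
next
  fix a u assume a: "a \<in> A" and "u \<in> ?S"
  then obtain x y where h: "x \<in> X" "y \<in> Y" "u = x \<oplus> y" by auto
  then have "a \<otimes> u = (a \<otimes> x) \<oplus> (a \<otimes> y)"
    using a A submodD(2)[OF X] submodD(2)[OF Y] by (simp add: r_distr subset_iff)
  then show "a \<otimes> u \<in> ?S" using h a submodD(5)[OF X] submodD(5)[OF Y] by blast
qed

lemma submod_multiples:
  assumes X: "submod A X" and A: "A \<subseteq> carrier R" and q: "q \<in> carrier R"
  shows "submod A ((\<lambda>x. q \<otimes> x) ` X)"
proof (rule submodI)
  show "(\<lambda>x. q \<otimes> x) ` X \<subseteq> carrier R" using submodD(2)[OF X] q by auto
  show "\<zero> \<in> (\<lambda>x. q \<otimes> x) ` X" using submodD(3)[OF X] q by (metis image_eqI r_null)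
next
  fix u v assume "u \<in> (\<lambda>x. q \<otimes> x) ` X" "v \<in> (\<lambda>x. q \<otimes> x) ` X"
  then obtain x y where h: "x \<in> X" "y \<in> X" "u = q \<otimes> x" "v = q \<otimes> y" by auto
  then have "u \<oplus> v = q \<otimes> (x \<oplus> y)" using q submodD(2)[OF X] by (simp add: r_distr)
  then show "u \<oplus> v \<in> (\<lambda>x. q \<otimes> x) ` X" using h submodD(4)[OF X] by blast
next
  fix a u assume a: "a \<in> A" and "u \<in> (\<lambda>x. q \<otimes> x) ` X"
  then obtain x where h: "x \<in> X" "u = q \<otimes> x" by auto
  then have "a \<otimes> u = q \<otimes> (a \<otimes> x)" using q a A submodD(2)[OF X] by (simp add: m_lcomm subset_iff)
  then show "a \<otimes> u \<in> (\<lambda>x. q \<otimes> x) ` X" using h a submodD(5)[OF X] by blast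
qed

lemma submod_vimage:
  assumes X: "submod A X" and A: "A \<subseteq> carrier R" and q: "q \<in> carrier R"
  shows "submod A {x \<in> carrier R. q \<otimes> x \<in> X}"
proof (rule submodI)
  show "\<zero> \<in> {x \<in> carrier R. q \<otimes> x \<in> X}" using submodD(3)[OF X] q by simp
next
  fix a u assume a: "a \<in> A" and u: "u \<in> {x \<in> carrier R. q \<otimes> x \<in> X}"
  then have "q \<otimes> (a \<otimes> u) = a \<otimes> (q \<otimes> u)" using q A by (auto simp: m_lcomm subset_iff)
  then show "a \<otimes> u \<in> {x \<in> carrier R. q \<otimes> x \<in> X}" using u a A submodD(5)[OF X a, of "q \<otimes> u"] by auto
qed (use q submodD(4)[OF X] in \<open>auto simp: r_distr\<close>)

lemma submod_colon:
  assumes X: "submod A X" and A: "A \<subseteq> carrier R" and Y: "Y \<subseteq> carrier R"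
  shows "submod A (colon R X Y)"
proof (rule submodI)
  show "colon R X Y \<subseteq> carrier R" by (auto simp: colon_def)
  show "\<zero> \<in> colon R X Y" using submodD(3)[OF X] Y by (auto simp: colon_def subset_iff)
next
  fix u v assume "u \<in> colon R X Y" "v \<in> colon R X Y"
  then show "u \<oplus> v \<in> colon R X Y" using submodD(4)[OF X] Y by (auto simp: colon_def l_distr subset_iff)
next
  fix a u assume "a \<in> A" "u \<in> colon R X Y"
  then show "a \<otimes> u \<in> colon R X Y" using submodD(5)[OF X] Y A by (auto simp: colon_def m_assoc subset_iff)
qed

lemma submod_prod:
  assumes X: "submod A X" and A: "A \<subseteq> carrier R" and Y: "Y \<subseteq> carrier R" "\<zero> \<in> Y"
  shows "submod A (X \<cdot> Y)"
proof (rule submodI)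
  show carr: "X \<cdot> Y \<subseteq> carrier R"
  proof
    fix p assume "p \<in> X \<cdot> Y" then show "p \<in> carrier R"
      by induct (use submodD(2)[OF X] Y in auto)
  qed
  show "\<zero> \<in> X \<cdot> Y" using ideal_prod.prod[of \<zero> X \<zero> Y R] submodD(3)[OF X] Y by simp
  show "x \<oplus> y \<in> X \<cdot> Y" if "x \<in> X \<cdot> Y" "y \<in> X \<cdot> Y" for x y using that by (rule ideal_prod.sum)
  fix a p assume a: "a \<in> A" "p \<in> X \<cdot> Y"
  from a(2) show "a \<otimes> p \<in> X \<cdot> Y"
  proof induct
    case (prod i j)
    then have "a \<otimes> (i \<otimes> j) = (a \<otimes> i) \<otimes> j" using a A Y submodD(2)[OF X] by (auto simp: m_assoc subset_iff)
    then show ?case using ideal_prod.prod[OF submodD(5)[OF X a(1) prod(1)] prod(2), of R] by simp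
  next
    case (sum s1 s2)
    then have "a \<otimes> (s1 \<oplus> s2) = a \<otimes> s1 \<oplus> a \<otimes> s2" using a A carr by (auto simp: r_distr subset_iff)
    then show ?case using ideal_prod.sum sum by metis
  qed
qed

text \<open>
  The only way in which invertibility is used: a statement about \<open>z\<close> may be checked after
  multiplication with the products \<open>x y\<close> whose sum is \<open>1\<close>.
\<close>

lemma one_prod_elim:
  assumes one: "\<one> \<in> X \<cdot> Y" and X: "X \<subseteq> carrier R" and Y: "Y \<subseteq> carrier R" and z: "z \<in> carrier R"
    and add: "\<And>a b. \<lbrakk>a \<in> Z; b \<in> Z\<rbrakk> \<Longrightarrow> a \<oplus> b \<in> Z"
    and prods: "\<And>x y. \<lbrakk>x \<in> X; y \<in> Y\<rbrakk> \<Longrightarrow> z \<otimes> (x \<otimes> y) \<in> Z"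
  shows "z \<in> Z"
proof -
  have "p \<in> carrier R \<and> z \<otimes> p \<in> Z" if "p \<in> X \<cdot> Y" for p
    using that
  proof induct
    case (prod i j) then show ?case using X Y prods by auto
  next
    case (sum s1 s2) then show ?case using z add by (simp add: r_distr)
  qed
  from this[OF one] z show ?thesis by simp
qed

lemma colonI: "\<lbrakk>q \<in> carrier R; \<And>y. y \<in> Y \<Longrightarrow> q \<otimes> y \<in> X\<rbrakk> \<Longrightarrow> q \<in> colon R X Y"
  by (simp add: colon_def)

lemma colonD: "q \<in> colon R X Y \<Longrightarrow> q \<in> carrier R" "\<lbrakk>q \<in> colon R X Y; y \<in> Y\<rbrakk> \<Longrightarrow> q \<otimes> y \<in> X"
  by (auto simp: colon_def)

lemma subring_colon_self:
  assumes X: "submod A X" and A: "subring A R"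
  shows "subring (colon R X X) R" "A \<subseteq> colon R X X"
proof -
  have Ac: "A \<subseteq> carrier R" using subringE(1)[OF A] .
  have sm: "submod A (colon R X X)" using submod_colon[OF X Ac submodD(1)[OF X]] .
  show "subring (colon R X X) R"
  proof (rule subringI)
    show "colon R X X \<subseteq> carrier R" by (auto simp: colon_def)
    show "\<one> \<in> colon R X X" using submodD(2)[OF X] by (auto simp: colon_def)
    show "\<ominus> h \<in> colon R X X" if "h \<in> colon R X X" for h using submod_minus(1)[OF A sm that that] .
    show "h1 \<oplus> h2 \<in> colon R X X" if "h1 \<in> colon R X X" "h2 \<in> colon R X X" for h1 h2
      using submodD(4)[OF sm that] .
    show "h1 \<otimes> h2 \<in> colon R X X" if "h1 \<in> colon R X X" "h2 \<in> colon R X X" for h1 h2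
      using that submodD(2)[OF X] by (auto simp: colon_def m_assoc)
  qed
  show "A \<subseteq> colon R X X" using submodD(5)[OF X] Ac by (auto simp: colon_def)
qed

lemma submod_colon_over_multipliers:
  assumes X: "submod B X" and Y: "Y \<subseteq> carrier R"
  shows "submod (colon R Y Y) (colon R X Y)"
proof (rule submodI)
  have Yc: "y \<in> Y \<Longrightarrow> y \<in> carrier R" for y using Y by auto
  show "colon R X Y \<subseteq> carrier R" by (auto simp: colon_def)
  show "\<zero> \<in> colon R X Y" using submodD(3)[OF X] Yc by (auto simp: colon_def)
  show "u \<oplus> v \<in> colon R X Y" if "u \<in> colon R X Y" "v \<in> colon R X Y" for u v
    using that submodD(4)[OF X] Yc by (auto simp: colon_def l_distr)
  fix a q assume h: "a \<in> colon R Y Y" "q \<in> colon R X Y"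
  show "a \<otimes> q \<in> colon R X Y"
  proof (rule colonI)
    fix y assume y: "y \<in> Y"
    have "q \<otimes> (a \<otimes> y) \<in> X" using colonD(2)[OF h(2) colonD(2)[OF h(1) y]] .
    then show "(a \<otimes> q) \<otimes> y \<in> X" using colonD(1)[OF h(1)] colonD(1)[OF h(2)] Yc[OF y] by (simp add: m_ac)
  qed (use h colonD(1) in blast)
qed

definition is_prime :: "'a set \<Rightarrow> 'a set \<Rightarrow> bool" where
  "is_prime A P \<longleftrightarrow> submod A P \<and> P \<subseteq> A \<and> \<one> \<notin> P \<and> (\<forall>a\<in>A. \<forall>b\<in>A. a \<otimes> b \<in> P \<longrightarrow> a \<in> P \<or> b \<in> P)"

text \<open>
  With \<open>T = {1}\<close> this also says that maximal ideals are prime.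
\<close>

lemma prime_of_maximal_disjoint:
  assumes A: "subring A R" and T: "T \<subseteq> A" "\<one> \<in> T" "\<And>s t. \<lbrakk>s \<in> T; t \<in> T\<rbrakk> \<Longrightarrow> s \<otimes> t \<in> T"
    and P: "submod A P" "P \<subseteq> A" "P \<inter> T = {}"
    and max: "\<And>J. \<lbrakk>submod A J; J \<subseteq> A; J \<inter> T = {}; P \<subseteq> J\<rbrakk> \<Longrightarrow> J = P"
  shows "is_prime A P"
proof -
  have Ac: "A \<subseteq> carrier R" using subringE(1)[OF A] .
  have hit: "\<exists>p\<in>P. \<exists>r\<in>A. p \<oplus> a \<otimes> r \<in> T" if a: "a \<in> A" "a \<notin> P" for a
  proof (rule ccontr)
    let ?J = "{x \<oplus> y | x y. x \<in> P \<and> y \<in> (\<lambda>r. a \<otimes> r) ` A}"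
    assume no: "\<not> (\<exists>p\<in>P. \<exists>r\<in>A. p \<oplus> a \<otimes> r \<in> T)"
    have ac: "a \<in> carrier R" using a Ac by auto
    have "submod A ?J" by (intro submod_sum P submod_multiples submod_self A Ac ac)
    moreover have "?J \<subseteq> A" using P(2) subringE(6,7)[OF A] a by auto
    moreover have "?J \<inter> T = {}" using no by auto
    moreover have "P \<subseteq> ?J"
    proof
      fix p assume p: "p \<in> P"
      then have "p = p \<oplus> a \<otimes> \<zero>" using ac submodD(2)[OF P(1)] by simp
      then show "p \<in> ?J" using p subringE(2)[OF A] by blast
    qed
    ultimately have "?J = P" by (rule max)
    moreover have "a \<in> ?J"
    proof -
      have "a = \<zero> \<oplus> a \<otimes> \<one>" using ac by simp
      then show ?thesis using submodD(3)[OF P(1)] subringE(3)[OF A] by blast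
    qed
    ultimately show False using a by simp
  qed
  show ?thesis unfolding is_prime_def
  proof (intro conjI ballI impI)
    show "\<one> \<notin> P" using T P by auto
    fix a b assume ab: "a \<in> A" "b \<in> A" "a \<otimes> b \<in> P"
    show "a \<in> P \<or> b \<in> P"
    proof (rule ccontr)
      assume "\<not> ?thesis"
      then obtain p r q s where h: "p \<in> P" "r \<in> A" "q \<in> P" "s \<in> A" "p \<oplus> a \<otimes> r \<in> T" "q \<oplus> b \<otimes> s \<in> T"
        using hit ab by meson
      have c: "p \<in> carrier R" "r \<in> carrier R" "q \<in> carrier R" "s \<in> carrier R" "a \<in> carrier R" "b \<in> carrier R"
        using h ab Ac P(2) by auto
      have "(p \<oplus> a \<otimes> r) \<otimes> (q \<oplus> b \<otimes> s) = ((q \<oplus> b \<otimes> s) \<otimes> p \<oplus> (a \<otimes> r) \<otimes> q) \<oplus> (r \<otimes> s) \<otimes> (a \<otimes> b)"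
        using c by algebra
      moreover have "\<dots> \<in> P"
      proof (intro submodD(4)[OF P(1)])
        show "(q \<oplus> b \<otimes> s) \<otimes> p \<in> P"
          using h ab P(2) by (intro submodD(5)[OF P(1)] subringE(6,7)[OF A]) auto
        show "(a \<otimes> r) \<otimes> q \<in> P"
          using h ab by (intro submodD(5)[OF P(1)] subringE(6)[OF A]) auto
        show "(r \<otimes> s) \<otimes> (a \<otimes> b) \<in> P"
          using h by (intro submodD(5)[OF P(1) _ ab(3)] subringE(6)[OF A]) auto
      qed
      ultimately show False using T(3)[OF h(5,6)] P(3) by auto
    qed
  qed (use P in auto)
qed

end

section \<open>One-dimensional rings inside their ring of fractions\<close>

text \<open>
  The situation of a one-dimensional Cohen--Macaulay ring \<open>K\<close> in its total ring of fractions \<open>Q\<close>, where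
  the regular elements of \<open>K\<close> are those that are units of \<open>Q\<close>. The last two assumptions are phrased without maximal
  ideals: \<open>regular_avoidance\<close> expresses that every maximal ideal contains a regular element (otherwise it
  would serve as \<open>D\<close>), and \<open>prime_chain\<close> that a prime ideal strictly above another one is maximal.
\<close>

locale one_dim_fractions = cring Q for Q :: "('q, 'n) ring_scheme" (structure) +
  fixes K :: "'q set"
  assumes subring_K: "subring K Q"
    and denominator: "q \<in> carrier Q \<Longrightarrow> \<exists>s \<in> K \<inter> Units Q. s \<otimes> q \<in> K"
    and noetherian: "\<lbrakk>\<F> \<noteq> {}; \<And>I. I \<in> \<F> \<Longrightarrow> submod K I \<and> I \<subseteq> K\<rbrakk> \<Longrightarrow> \<exists>I\<in>\<F>. \<forall>J\<in>\<F>. I \<subseteq> J \<longrightarrow> J = I"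
    and regular_avoidance:
      "\<lbrakk>submod K D; D \<subseteq> K; \<And>x. x \<in> K \<inter> Units Q \<Longrightarrow> \<exists>r\<in>K. \<one> \<ominus> x \<otimes> r \<in> D\<rbrakk> \<Longrightarrow> \<one> \<in> D"
    and prime_chain:
      "\<lbrakk>is_prime K p; is_prime K p'; p \<subset> p'; r \<in> K; r \<notin> p'\<rbrakk> \<Longrightarrow> \<exists>s\<in>K. \<one> \<ominus> r \<otimes> s \<in> p'"
begin

abbreviation (input) reg :: "'q set" where "reg \<equiv> K \<inter> Units Q"

lemma K_carrier: "K \<subseteq> carrier Q" and K_closed: "x \<in> K \<Longrightarrow> x \<in> carrier Q"
  using subringE(1)[OF subring_K] by auto

lemmas K_simps = subringE(2,3)[OF subring_K] subringE(5-7)[OF subring_K]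

lemma K_minus: "\<lbrakk>x \<in> K; y \<in> K\<rbrakk> \<Longrightarrow> x \<ominus> y \<in> K"
  by (simp add: a_minus_def K_simps)

lemma reg_closed: "x \<in> reg \<Longrightarrow> x \<in> carrier Q" using K_closed by auto

lemma reg_mult: "\<lbrakk>x \<in> reg; y \<in> reg\<rbrakk> \<Longrightarrow> x \<otimes> y \<in> reg" using K_simps by auto

lemma one_reg: "\<one> \<in> reg" using K_simps by auto

lemma submod_K: "submod K K" using submod_self[OF subring_K] .

text \<open>
  The Noetherian property carries over from ideals to all fractional ideals with a common denominator,
  in particular to the ideals of a finite overring of \<open>K\<close>.
\<close>

lemma maximal_bounded:
  assumes ne: "\<F> \<noteq> {}" and d: "d \<in> Units Q"
    and F: "\<And>X. X \<in> \<F> \<Longrightarrow> submod K X \<and> (\<forall>x\<in>X. d \<otimes> x \<in> K)"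
  shows "\<exists>X\<in>\<F>. \<forall>Y\<in>\<F>. X \<subseteq> Y \<longrightarrow> Y = X"
proof -
  let ?s = "\<lambda>X. (\<lambda>x. d \<otimes> x) ` X"
  have dc: "d \<in> carrier Q" using d by auto
  have "\<exists>I\<in>?s ` \<F>. \<forall>J\<in>?s ` \<F>. I \<subseteq> J \<longrightarrow> J = I"
  proof (rule noetherian)
    show "?s ` \<F> \<noteq> {}" using ne by auto
    fix I assume "I \<in> ?s ` \<F>"
    then obtain X where X: "X \<in> \<F>" "I = ?s X" by auto
    show "submod K I \<and> I \<subseteq> K"
      unfolding X(2) using F[OF X(1)] by (auto intro!: submod_multiples K_carrier dc)
  qed
  then obtain X where X: "X \<in> \<F>" and max: "\<And>Y. Y \<in> \<F> \<Longrightarrow> ?s X \<subseteq> ?s Y \<Longrightarrow> ?s Y = ?s X" by auto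
  have "Y = X" if Y: "Y \<in> \<F>" "X \<subseteq> Y" for Y
  proof -
    have eq: "?s Y = ?s X" using max[OF Y(1)] Y(2) by auto
    have "y \<in> X" if y: "y \<in> Y" for y
    proof -
      obtain x where x: "x \<in> X" "d \<otimes> y = d \<otimes> x" using eq y by (metis image_iff)
      moreover have "x \<in> carrier Q" "y \<in> carrier Q"
        using F[OF X] F[OF Y(1)] x y submodD(2) by blast+
      ultimately show ?thesis using d by (simp add: Units_l_cancel)
    qed
    then show ?thesis using Y(2) by auto
  qed
  then show ?thesis using X by auto
qed

lemma prime_avoiding:
  assumes T: "T \<subseteq> K" "\<one> \<in> T" "\<And>s t. \<lbrakk>s \<in> T; t \<in> T\<rbrakk> \<Longrightarrow> s \<otimes> t \<in> T"
    and I: "submod K I" "I \<subseteq> K" "I \<inter> T = {}"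
  shows "\<exists>P. is_prime K P \<and> I \<subseteq> P \<and> P \<inter> T = {}"
proof -
  let ?F = "{J. submod K J \<and> J \<subseteq> K \<and> J \<inter> T = {} \<and> I \<subseteq> J}"
  have "\<exists>P\<in>?F. \<forall>J\<in>?F. P \<subseteq> J \<longrightarrow> J = P"
    by (rule noetherian) (use I in auto)
  then obtain P where P: "P \<in> ?F" and max: "\<And>J. J \<in> ?F \<Longrightarrow> P \<subseteq> J \<Longrightarrow> J = P" by auto
  have "is_prime K P"
  proof (rule prime_of_maximal_disjoint[OF subring_K T])
    show "J = P" if "submod K J" "J \<subseteq> K" "J \<inter> T = {}" "P \<subseteq> J" for J
      using that P by (intro max) auto
  qed (use P in auto)
  then show ?thesis using P by auto
qed

text \<open>
  A prime ideal \<open>P\<close> that contains a regular element \<open>x\<close> cannot be minimal: as \<open>x\<^sup>n s \<noteq> 0\<close> for \<open>s \<notin> P\<close>, some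
  prime ideal avoids all these products, that is, lies in \<open>P\<close> and misses \<open>x\<close>.
\<close>

lemma prime_with_unit_maximal:
  assumes P: "is_prime K P" and x: "x \<in> P" "x \<in> Units Q" and r: "r \<in> K" "r \<notin> P"
  shows "\<exists>s\<in>K. \<one> \<ominus> r \<otimes> s \<in> P"
proof -
  have PK: "submod K P" "P \<subseteq> K" "\<one> \<notin> P" using P by (auto simp: is_prime_def)
  have xK: "x \<in> K" and xc: "x \<in> carrier Q" using x PK K_closed by auto
  let ?T = "{x [^] (n::nat) \<otimes> s | n s. s \<in> K \<and> s \<notin> P}"
  have powK: "x [^] (n::nat) \<in> K" for n by (induct n) (auto simp: K_simps xK)
  have zero: "\<zero> \<notin> ?T"
  proof
    assume "\<zero> \<in> ?T"
    then obtain n :: nat and s where s: "s \<in> K" "s \<notin> P" "\<zero> = x [^] n \<otimes> s" by auto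
    have "x [^] n \<in> Units Q" using x by (simp add: Units_pow_closed)
    then have "s = \<zero>" using s(3) K_closed[OF s(1)] by (metis Units_closed Units_l_cancel r_null zero_closed)
    then show False using s submodD(3)[OF PK(1)] by simp
  qed
  have "\<exists>p. is_prime K p \<and> {\<zero>} \<subseteq> p \<and> p \<inter> ?T = {}"
  proof (rule prime_avoiding)
    show "?T \<subseteq> K" using powK K_simps by auto
    have "\<one> = x [^] (0::nat) \<otimes> \<one>" by simp
    then show "\<one> \<in> ?T" using K_simps(2) PK(3) by blast
    show "s \<otimes> t \<in> ?T" if st: "s \<in> ?T" "t \<in> ?T" for s t
    proof -
      obtain n m :: nat and a b where h: "a \<in> K" "a \<notin> P" "b \<in> K" "b \<notin> P" "s = x [^] n \<otimes> a" "t = x [^] m \<otimes> b"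
        using st by auto
      have "s \<otimes> t = x [^] (n + m) \<otimes> (a \<otimes> b)"
        using h K_closed xc by (simp add: nat_pow_mult[symmetric] m_ac)
      moreover have "a \<otimes> b \<notin> P" "a \<otimes> b \<in> K" using h P K_simps by (auto simp: is_prime_def)
      ultimately show ?thesis by blast
    qed
    show "submod K {\<zero>}" using K_closed by (intro submodI) auto
    show "{\<zero>} \<inter> ?T = {}" using zero by auto
  qed (use K_simps in auto)
  then obtain p where p: "is_prime K p" "p \<inter> ?T = {}" by auto
  have "x \<in> ?T"
  proof -
    have "x = x [^] (1::nat) \<otimes> \<one>" using xc by simp
    then show ?thesis using K_simps(2) PK(3) by blast
  qed
  then have "x \<notin> p" using p by auto
  moreover have "p \<subseteq> P"
  proof
    fix y assume y: "y \<in> p"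
    then have "y \<in> K" using p by (auto simp: is_prime_def)
    moreover have "y = x [^] (0::nat) \<otimes> y" using K_closed calculation by simp
    ultimately show "y \<in> P" using y p(2) by blast
  qed
  ultimately have "p \<subset> P" using x by auto
  from prime_chain[OF p(1) P this r] show ?thesis .
qed

text \<open>
  A form of Krull's intersection theorem, for all regular \<open>z\<close> simultaneously in place of the powers of one
  element. Among all \<open>a\<close> with \<open>w \<equiv> z a\<close> modulo \<open>T\<close>, for some regular \<open>z\<close>, take one for which the ideal
  \<open>a K + T \<inter> K\<close> is maximal. Given a regular \<open>x\<close>, write \<open>w \<equiv> x z b\<close>; then \<open>a \<equiv> x b\<close>, so maximality
  gives \<open>b \<equiv> a r\<close> and therefore \<open>(1 - x r) w \<in> T\<close>. Hence the ideal of all \<open>r\<close> with \<open>r w \<in> T\<close> lies in no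
  maximal ideal.
\<close>

lemma ideal_closed_of_regular_approximation:
  assumes T: "submod (carrier Q) T" and w: "w \<in> carrier Q"
    and approx: "\<And>z. z \<in> reg \<Longrightarrow> \<exists>a\<in>K. w \<ominus> z \<otimes> a \<in> T"
  shows "w \<in> T"
proof -
  have TK: "submod K (T \<inter> K)" using submod_inter[OF submod_mono[OF T K_carrier] submod_K] .
  let ?L = "\<lambda>a. {u \<oplus> t | u t. u \<in> (\<lambda>r. a \<otimes> r) ` K \<and> t \<in> T \<inter> K}"
  let ?F = "{?L a | a z. a \<in> K \<and> z \<in> reg \<and> w \<ominus> z \<otimes> a \<in> T}"
  have mem: "a \<in> ?L a" if "a \<in> K" for a
  proof -
    have "a = a \<otimes> \<one> \<oplus> \<zero>" using that K_closed by simp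
    then show ?thesis using K_simps(2) submodD(3)[OF TK] by blast
  qed
  have "\<exists>I\<in>?F. \<forall>J\<in>?F. I \<subseteq> J \<longrightarrow> J = I"
  proof (rule noetherian)
    obtain a where "a \<in> K" "w \<ominus> \<one> \<otimes> a \<in> T" using approx[OF one_reg] by auto
    then show "?F \<noteq> {}" using one_reg by blast
    fix I assume "I \<in> ?F"
    then obtain a where a: "a \<in> K" "I = ?L a" by blast
    show "submod K I \<and> I \<subseteq> K"
    proof
      show "submod K I" unfolding a(2)
        by (intro submod_sum submod_multiples submod_K TK K_carrier K_closed a)
      show "I \<subseteq> K" unfolding a(2) using a K_simps by auto
    qed
  qed
  then obtain I where I: "I \<in> ?F" and maxI: "\<forall>J\<in>?F. I \<subseteq> J \<longrightarrow> J = I" by (rule bexE)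
  have max: "J = I" if "J \<in> ?F" "I \<subseteq> J" for J
    using bspec[OF maxI that(1)] that(2) by (rule mp)
  from I obtain a z where a: "a \<in> K" "z \<in> reg" "w \<ominus> z \<otimes> a \<in> T" "I = ?L a" by blast
  have "\<one> \<in> {r \<in> K. r \<otimes> w \<in> T}"
  proof (rule regular_avoidance)
    have "{r \<in> K. r \<otimes> w \<in> T} = K \<inter> {r \<in> carrier Q. w \<otimes> r \<in> T}"
      using K_closed w by (auto simp: m_comm)
    then show "submod K {r \<in> K. r \<otimes> w \<in> T}"
      using submod_inter[OF submod_K submod_vimage[OF submod_mono[OF T K_carrier] K_carrier w]] by simp
    fix x assume x: "x \<in> reg"
    obtain b where b: "b \<in> K" "w \<ominus> (x \<otimes> z) \<otimes> b \<in> T" using approx[OF reg_mult[OF x a(2)]] by auto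
    have c: "x \<in> carrier Q" "z \<in> carrier Q" "a \<in> carrier Q" "b \<in> carrier Q"
      using x a b K_closed by auto
    have diff: "a \<ominus> x \<otimes> b \<in> T \<inter> K"
    proof
      show "a \<ominus> x \<otimes> b \<in> K" using a b x by (intro K_minus K_simps) auto
      have "z \<otimes> (a \<ominus> x \<otimes> b) = (w \<ominus> (x \<otimes> z) \<otimes> b) \<ominus> (w \<ominus> z \<otimes> a)"
        using c w by algebra
      also have "\<dots> \<in> T" using submod_minus(2)[OF carrier_is_subring T b(2) a(3)] .
      finally have "inv z \<otimes> (z \<otimes> (a \<ominus> x \<otimes> b)) \<in> T" using a(2) by (rule_tac submodD(5)[OF T]) simp_all
      moreover have "inv z \<otimes> (z \<otimes> (a \<ominus> x \<otimes> b)) = a \<ominus> x \<otimes> b"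
        using a(2) c by (simp add: m_assoc[symmetric])
      ultimately show "a \<ominus> x \<otimes> b \<in> T" by simp
    qed
    have "I \<subseteq> ?L b"
    proof
      fix v assume "v \<in> I"
      then obtain r t where v: "r \<in> K" "t \<in> T \<inter> K" "v = a \<otimes> r \<oplus> t" using a(4) by auto
      have vc: "r \<in> carrier Q" "t \<in> carrier Q" using v K_closed by auto
      have "v = b \<otimes> (x \<otimes> r) \<oplus> (r \<otimes> (a \<ominus> x \<otimes> b) \<oplus> t)"
        unfolding v(3) using vc c by algebra
      moreover have "x \<otimes> r \<in> K" using x v K_simps by auto
      moreover have "r \<otimes> (a \<ominus> x \<otimes> b) \<oplus> t \<in> T \<inter> K"
        using submodD(4,5)[OF TK] v diff by blast
      ultimately show "v \<in> ?L b" by blast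
    qed
    moreover have "?L b \<in> ?F" using b reg_mult[OF x a(2)] by blast
    ultimately have "b \<in> ?L a" using max mem[OF b(1)] a(4) by blast
    then obtain r t where v: "r \<in> K" "t \<in> T \<inter> K" "b = a \<otimes> r \<oplus> t" by auto
    have vc: "r \<in> carrier Q" "t \<in> carrier Q" using v K_closed by auto
    have "(\<one> \<ominus> x \<otimes> r) \<otimes> w = ((w \<ominus> (x \<otimes> z) \<otimes> b) \<ominus> (x \<otimes> r) \<otimes> (w \<ominus> z \<otimes> a)) \<oplus> (x \<otimes> z) \<otimes> t"
      unfolding v(3) using vc c w by algebra
    also have "\<dots> \<in> T"
    proof (rule submodD(4)[OF T])
      show "(w \<ominus> (x \<otimes> z) \<otimes> b) \<ominus> (x \<otimes> r) \<otimes> (w \<ominus> z \<otimes> a) \<in> T"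
        by (rule submod_minus(2)[OF carrier_is_subring T b(2) submodD(5)[OF T _ a(3)]]) (use c vc in simp)
      show "(x \<otimes> z) \<otimes> t \<in> T"
        by (rule submodD(5)[OF T]) (use c v in simp_all)
    qed
    finally have "\<one> \<ominus> x \<otimes> r \<in> {r \<in> K. r \<otimes> w \<in> T}" using x v by (auto intro!: K_minus K_simps)
    then show "\<exists>r\<in>K. \<one> \<ominus> x \<otimes> r \<in> {r \<in> K. r \<otimes> w \<in> T}" using v(1) by blast
  qed auto
  then show ?thesis using w by simp
qed

text \<open>
  The ring \<open>Q\<close> has dimension zero: otherwise there are prime ideals \<open>p \<subset> p'\<close> of \<open>K\<close> without regular
  elements, and \<open>p'\<close> is maximal by \<open>prime_chain\<close>, which contradicts \<open>regular_avoidance\<close>. The first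
  prime is found by avoiding the elements \<open>u\<^sup>n (s - u r)\<close> with \<open>s\<close> regular; the second one contains it
  together with \<open>u\<close>.
\<close>

lemma pi_regular_K:
  assumes u: "u \<in> K"
  shows "\<exists>n::nat. \<exists>q\<in>carrier Q. u [^] n = u [^] n \<otimes> (u \<otimes> q)"
proof -
  let ?T = "{u [^] (n::nat) \<otimes> (s \<ominus> u \<otimes> r) | n s r. s \<in> reg \<and> r \<in> K}"
  have uc: "u \<in> carrier Q" using u K_closed by auto
  have powK: "u [^] (n::nat) \<in> K" for n by (induct n) (auto simp: K_simps u)
  have TK: "?T \<subseteq> K" using powK u by (auto intro!: K_simps K_minus)
  have TI: "u [^] (n::nat) \<otimes> (s \<ominus> u \<otimes> r) \<in> ?T" if "s \<in> reg" "r \<in> K" for n s r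
    using that by blast
  have T1: "\<one> \<in> ?T"
  proof -
    have "\<one> = u [^] (0::nat) \<otimes> (\<one> \<ominus> u \<otimes> \<zero>)" using uc by (simp add: a_minus_def)
    then show ?thesis using TI[OF one_reg K_simps(1), of 0] by simp
  qed
  have Tu: "u \<in> ?T"
  proof -
    have "u = u [^] (1::nat) \<otimes> (\<one> \<ominus> u \<otimes> \<zero>)" using uc by (simp add: a_minus_def)
    then show ?thesis using TI[OF one_reg K_simps(1), of 1] by simp
  qed
  have Tm: "x \<otimes> y \<in> ?T" if xy: "x \<in> ?T" "y \<in> ?T" for x y
  proof -
    obtain n m :: nat and s t r q where h: "s \<in> reg" "t \<in> reg" "r \<in> K" "q \<in> K"
      "x = u [^] n \<otimes> (s \<ominus> u \<otimes> r)" "y = u [^] m \<otimes> (t \<ominus> u \<otimes> q)" using xy by blast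
    let ?r = "(s \<otimes> q \<oplus> r \<otimes> t) \<ominus> u \<otimes> (r \<otimes> q)"
    have c: "s \<in> carrier Q" "t \<in> carrier Q" "r \<in> carrier Q" "q \<in> carrier Q"
      using h K_closed by auto
    have pc: "u [^] n \<in> carrier Q" "u [^] m \<in> carrier Q" using uc by auto
    have "x \<otimes> y = (u [^] n \<otimes> u [^] m) \<otimes> (s \<otimes> t \<ominus> u \<otimes> ?r)"
      unfolding h using c uc pc by algebra
    then have "x \<otimes> y = u [^] (n + m) \<otimes> (s \<otimes> t \<ominus> u \<otimes> ?r)" using uc by (simp add: nat_pow_mult)
    moreover have "?r \<in> K" using h u by (auto intro!: K_minus K_simps)
    ultimately show ?thesis using TI[OF reg_mult[OF h(1,2)]] by simp
  qed
  show ?thesis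
  proof (cases "\<zero> \<in> ?T")
    case True
    then obtain n :: nat and s r where h: "s \<in> reg" "r \<in> K" "\<zero> = u [^] n \<otimes> (s \<ominus> u \<otimes> r)" by blast
    have c: "s \<in> carrier Q" "r \<in> carrier Q" "inv s \<in> carrier Q" using h K_closed by auto
    have pc: "u [^] n \<in> carrier Q" using uc by auto
    have "u [^] n = u [^] n \<otimes> (s \<otimes> inv s)" using h pc by simp
    also have "\<dots> = u [^] n \<otimes> (u \<otimes> (r \<otimes> inv s)) \<oplus> (u [^] n \<otimes> (s \<ominus> u \<otimes> r)) \<otimes> inv s"
      using c pc uc by algebra
    also have "\<dots> = u [^] n \<otimes> (u \<otimes> (r \<otimes> inv s))" unfolding h(3)[symmetric] using c pc uc by simp
    finally show ?thesis using c by blast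
  next
    case False
    have "\<exists>p. is_prime K p \<and> {\<zero>} \<subseteq> p \<and> p \<inter> ?T = {}"
    proof (rule prime_avoiding[OF TK T1 Tm])
      show "submod K {\<zero>}" using K_closed by (intro submodI) auto
      show "{\<zero>} \<inter> ?T = {}" using False by auto
    qed (use K_simps in auto)
    then obtain p where p: "is_prime K p" "p \<inter> ?T = {}" by blast
    have pK: "submod K p" "p \<subseteq> K" using p by (auto simp: is_prime_def)
    let ?J = "{x \<oplus> y | x y. x \<in> p \<and> y \<in> (\<lambda>r. u \<otimes> r) ` K}"
    have "\<exists>p'. is_prime K p' \<and> ?J \<subseteq> p' \<and> p' \<inter> reg = {}"
    proof (rule prime_avoiding)
      show "submod K ?J" by (intro submod_sum submod_multiples submod_K pK K_carrier uc)
      show "?J \<subseteq> K" using pK u K_simps by auto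
      show "?J \<inter> reg = {}"
      proof (rule ccontr)
        assume "?J \<inter> reg \<noteq> {}"
        then obtain x r where h: "x \<in> p" "r \<in> K" "x \<oplus> u \<otimes> r \<in> reg" by blast
        have c: "x \<in> carrier Q" "r \<in> carrier Q" using h pK K_closed by auto
        have "u [^] (0::nat) \<otimes> ((x \<oplus> u \<otimes> r) \<ominus> u \<otimes> r) = x" using c uc by (simp, algebra)
        then show False using TI[OF h(3,2), of 0] p(2) h(1) by auto
      qed
    qed (use one_reg reg_mult in auto)
    then obtain p' where p': "is_prime K p'" "?J \<subseteq> p'" "p' \<inter> reg = {}" by blast
    have p'K: "submod K p'" "p' \<subseteq> K" "\<one> \<notin> p'" using p' by (auto simp: is_prime_def)
    have "x \<in> ?J" if "x \<in> p" for x
    proof -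
      have "x = x \<oplus> u \<otimes> \<zero>" using that pK K_closed uc by auto
      then show ?thesis using that K_simps(1) by blast
    qed
    moreover have "u \<in> ?J"
    proof -
      have "u = \<zero> \<oplus> u \<otimes> \<one>" using uc by simp
      then show ?thesis using submodD(3)[OF pK(1)] K_simps(2) by blast
    qed
    moreover have "u \<notin> p" using Tu p(2) by blast
    ultimately have "p \<subset> p'" using p'(2) by blast
    then have "\<one> \<in> p'"
      using p'(3) by (intro regular_avoidance[OF p'K(1,2)] prime_chain[OF p(1) p'(1)]) auto
    then show ?thesis using p'K by simp
  qed
qed

end

section \<open>Regular ideals with trivial dual\<close>

context one_dim_fractions
begin

text \<open>
  The ring \<open>A / P\<close> is a domain that is finite over the field \<open>K / (P \<inter> K)\<close>, hence a field. Instead of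
  passing to quotients, integrality is used directly: the \<open>K\<close>-modules \<open>W n\<close> of values at \<open>t\<close> of polynomials
  of degree at most \<open>n\<close> become stationary, so \<open>t\<close> satisfies a monic equation over \<open>K\<close>. Its lowest term
  whose coefficient lies outside \<open>P\<close> shows that \<open>t\<close> is a unit modulo \<open>P\<close>.
\<close>

lemma prime_of_overring_maximal:
  assumes A: "subring A Q" "K \<subseteq> A" and d: "d \<in> Units Q" "\<And>a. a \<in> A \<Longrightarrow> d \<otimes> a \<in> K"
    and P: "is_prime A P" and x: "x \<in> P" "x \<in> reg" and t: "t \<in> A" "t \<notin> P"
  shows "\<exists>p\<in>P. \<exists>a\<in>A. \<one> = p \<oplus> t \<otimes> a"
proof -
  have Ac: "A \<subseteq> carrier Q" and Acl: "a \<in> A \<Longrightarrow> a \<in> carrier Q" for a using subringE(1)[OF A(1)] by auto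
  have As: "\<zero> \<in> A" "\<one> \<in> A" "\<And>a b. \<lbrakk>a \<in> A; b \<in> A\<rbrakk> \<Longrightarrow> a \<otimes> b \<in> A" "\<And>a b. \<lbrakk>a \<in> A; b \<in> A\<rbrakk> \<Longrightarrow> a \<oplus> b \<in> A"
    using subringE(2,3,6,7)[OF A(1)] by auto
  have PA: "submod A P" "P \<subseteq> A" "\<one> \<notin> P" and Pprime: "\<And>a b. \<lbrakk>a \<in> A; b \<in> A; a \<otimes> b \<in> P\<rbrakk> \<Longrightarrow> a \<in> P \<or> b \<in> P"
    using P by (auto simp: is_prime_def)
  have tc: "t \<in> carrier Q" using t Acl by auto
  \<comment> \<open>values at \<open>t\<close> of polynomials over \<open>K\<close> of degree at most \<open>n\<close>, built by the Horner scheme\<close>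
  define W where "W n = ((\<lambda>X. {r \<oplus> t \<otimes> w | r w. r \<in> K \<and> w \<in> X}) ^^ n) K" for n :: nat
  have W0: "W 0 = K" and WS: "W (Suc n) = {r \<oplus> t \<otimes> w | r w. r \<in> K \<and> w \<in> W n}" for n
    by (simp_all add: W_def)
  have WS': "W (Suc n) = {u \<oplus> v | u v. u \<in> K \<and> v \<in> (\<lambda>w. t \<otimes> w) ` W n}" for n
    unfolding WS by blast
  have Wsub: "submod K (W n)" for n
  proof (induct n)
    case 0 show ?case unfolding W0 by (rule submod_K)
  next
    case (Suc n) show ?case unfolding WS'
      by (intro submod_sum submod_multiples submod_K Suc K_carrier tc)
  qed
  have WA: "W n \<subseteq> A" for n
  proof (induct n)
    case 0 show ?case unfolding W0 by (rule A(2))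
  next
    case (Suc n) then show ?case unfolding WS using A(2) As t by blast
  qed
  have Wmono: "W n \<subseteq> W (Suc n)" for n
  proof (induct n)
    case 0
    have "r \<in> W (Suc 0)" if r: "r \<in> K" for r
    proof -
      have "r = r \<oplus> t \<otimes> \<zero>" using tc K_closed[OF r] by simp
      then show ?thesis using r K_simps(1) unfolding WS W0 by blast
    qed
    then show ?case unfolding W0 by auto
  next
    case (Suc n) then show ?case unfolding WS[of n] WS[of "Suc n"] by blast
  qed
  have powW: "t [^] n \<in> W n" for n
  proof (induct n)
    case 0 show ?case unfolding W0 using K_simps by simp
  next
    case (Suc n)
    have "t [^] Suc n = \<zero> \<oplus> t \<otimes> t [^] n" using tc by (simp add: m_comm)
    then show ?case using Suc K_simps(1) unfolding WS by blast
  qed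
  have powA: "t [^] (n::nat) \<in> A" for n using powW WA by blast
  have "\<exists>X\<in>range W. \<forall>Y\<in>range W. X \<subseteq> Y \<longrightarrow> Y = X"
    by (rule maximal_bounded[OF _ d(1)]) (use Wsub WA d(2) in blast)+
  then obtain n where "\<forall>Y\<in>range W. W n \<subseteq> Y \<longrightarrow> Y = W n" by auto
  then have n: "W (Suc n) = W n" using Wmono[of n] by auto
  \<comment> \<open>the part below the lowest coefficient \<open>r\<close> outside \<open>P\<close> vanishes modulo \<open>P\<close>; the leading coefficient is \<open>1\<close>, so \<open>r\<close> exists\<close>
  have lead: "\<exists>j::nat. \<exists>r\<in>K. \<exists>a\<in>A. r \<notin> P \<and> (t [^] Suc n \<oplus> w) \<ominus> t [^] j \<otimes> (r \<oplus> t \<otimes> a) \<in> P"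
    if "w \<in> W n" for w n
    using that
  proof (induct n arbitrary: w)
    case 0
    then have w: "w \<in> K" "w \<in> carrier Q" using W0 K_closed by auto
    show ?case
    proof (cases "w \<in> P")
      case True
      have "(t [^] Suc 0 \<oplus> w) \<ominus> t [^] (1::nat) \<otimes> (\<one> \<oplus> t \<otimes> \<zero>) = w" using tc w by (simp, algebra)
      then show ?thesis using True PA(3) As K_simps(2) by metis
    next
      case False
      have "(t [^] Suc 0 \<oplus> w) \<ominus> t [^] (0::nat) \<otimes> (w \<oplus> t \<otimes> \<one>) = \<zero>" using tc w by (simp, algebra)
      then show ?thesis using False w submodD(3)[OF PA(1)] As by metis
    qed
  next
    case (Suc n)
    then obtain r w' where w: "r \<in> K" "w' \<in> W n" "w = r \<oplus> t \<otimes> w'" unfolding WS by blast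
    have wA: "w' \<in> A" using w WA by blast
    have c: "r \<in> carrier Q" "w' \<in> carrier Q" using w wA K_closed Acl by auto
    let ?v = "t [^] Suc n \<oplus> w'"
    have vA: "?v \<in> A" using powA wA As by blast
    have v: "t [^] Suc (Suc n) \<oplus> w = r \<oplus> t \<otimes> ?v"
      unfolding w(3) nat_pow_Suc[of _ "Suc n"] using c tc nat_pow_closed[OF tc, of "Suc n"] by algebra
    show ?case
    proof (cases "r \<in> P")
      case False
      have "(r \<oplus> t \<otimes> ?v) \<ominus> t [^] (0::nat) \<otimes> (r \<oplus> t \<otimes> ?v) = \<zero>" using c tc vA Acl by (simp add: a_minus_def r_neg)
      then show ?thesis using False w submodD(3)[OF PA(1)] vA unfolding v by metis
    next
      case True
      obtain j :: nat and r' a where h: "r' \<in> K" "a \<in> A" "r' \<notin> P" "?v \<ominus> t [^] j \<otimes> (r' \<oplus> t \<otimes> a) \<in> P"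
        using Suc(1)[OF w(2)] by blast
      have hc: "r' \<in> carrier Q" "a \<in> carrier Q" "t [^] j \<in> carrier Q" "?v \<in> carrier Q"
        using h K_closed Acl tc vA by auto
      have "(r \<oplus> t \<otimes> ?v) \<ominus> t [^] (Suc j) \<otimes> (r' \<oplus> t \<otimes> a) = r \<oplus> t \<otimes> (?v \<ominus> t [^] j \<otimes> (r' \<oplus> t \<otimes> a))"
        unfolding nat_pow_Suc[of _ j] using c tc hc by algebra
      also have "\<dots> \<in> P" using submodD(4)[OF PA(1) True submodD(5)[OF PA(1) t(1) h(4)]] .
      finally show ?thesis unfolding v using h by blast
    qed
  qed
  have "t [^] Suc n \<in> W n" using powW[of "Suc n"] n by simp
  then have neg: "\<ominus> (t [^] Suc n) \<in> W n" by (rule submod_minus(1)[OF subring_K Wsub, of _ _ "\<zero>"]) (use submodD(3)[OF Wsub] in auto)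
  obtain j :: nat and r a where h: "r \<in> K" "a \<in> A" "r \<notin> P"
    "(t [^] Suc n \<oplus> \<ominus> (t [^] Suc n)) \<ominus> t [^] j \<otimes> (r \<oplus> t \<otimes> a) \<in> P" using lead[OF neg] by blast
  let ?g = "r \<oplus> t \<otimes> a"
  have gA: "?g \<in> A" using h t A(2) As by blast
  have hc: "r \<in> carrier Q" "a \<in> carrier Q" "?g \<in> carrier Q" using h K_closed Acl gA by auto
  have "\<ominus> (t [^] j \<otimes> ?g) \<in> P" using h(4) hc tc by (simp add: r_neg a_minus_def)
  then have "\<ominus> (\<ominus> (t [^] j \<otimes> ?g)) \<in> P" by (rule submod_minus(1)[OF A(1) PA(1)]) (rule submodD(3)[OF PA(1)])
  then have "t [^] j \<otimes> ?g \<in> P" using hc tc by simp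
  then have g: "?g \<in> P"
  proof (induct j)
    case 0 then show ?case using hc by simp
  next
    case (Suc j)
    then have "t \<otimes> (t [^] j \<otimes> ?g) \<in> P" using hc tc by (simp add: m_ac)
    then show ?case using Suc(1) Pprime[OF t(1) As(3)[OF powA gA]] t(2) by blast
  qed
  have "is_prime K (P \<inter> K)"
    unfolding is_prime_def
  proof (intro conjI ballI impI)
    show "submod K (P \<inter> K)" by (intro submod_inter submod_mono[OF PA(1)] A submod_K)
  qed (use PA Pprime A(2) in auto)
  then obtain s where s: "s \<in> K" "\<one> \<ominus> r \<otimes> s \<in> P"
    using prime_with_unit_maximal[of "P \<inter> K" x r] x h by auto
  have sc: "s \<in> carrier Q" using s K_closed by auto
  have "(\<one> \<ominus> r \<otimes> s) \<oplus> s \<otimes> ?g \<in> P"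
    using submodD(4)[OF PA(1) s(2) submodD(5)[OF PA(1) _ g]] s(1) A(2) by blast
  moreover have "\<one> = ((\<one> \<ominus> r \<otimes> s) \<oplus> s \<otimes> ?g) \<oplus> t \<otimes> (\<ominus> (s \<otimes> a))"
    using hc sc tc by algebra
  moreover have "\<ominus> (s \<otimes> a) \<in> A" by (intro subringE(5)[OF A(1)] As(3)) (use s h A(2) in auto)
  ultimately show ?thesis by blast
qed

text \<open>
  Let \<open>N\<close> be a maximal ideal of \<open>A\<close> that contains \<open>J\<close>, and \<open>x \<in> J\<close> regular. Among the ideals
  \<open>S b = (x A : b)\<close> inside \<open>N\<close> a maximal one is prime; it contains \<open>x\<close>, so it is a maximal ideal and equals
  \<open>N\<close>. Thus \<open>b N \<subseteq> x A\<close> although \<open>b \<notin> x A\<close>, and \<open>b / x\<close> is an element of \<open>A : J\<close> outside \<open>A\<close>.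
\<close>

lemma one_in_of_trivial_dual:
  assumes A: "subring A Q" "K \<subseteq> A" and d: "d \<in> Units Q" "\<And>a. a \<in> A \<Longrightarrow> d \<otimes> a \<in> K"
    and J: "submod A J" "J \<subseteq> A" "J \<inter> Units Q \<noteq> {}" and dual: "colon Q A J \<subseteq> A"
  shows "\<one> \<in> J"
proof (rule ccontr)
  assume one: "\<one> \<notin> J"
  have Ac: "A \<subseteq> carrier Q" and Acl: "a \<in> A \<Longrightarrow> a \<in> carrier Q" for a using subringE(1)[OF A(1)] by auto
  have As: "\<zero> \<in> A" "\<one> \<in> A" "\<And>a b. \<lbrakk>a \<in> A; b \<in> A\<rbrakk> \<Longrightarrow> a \<otimes> b \<in> A" "\<And>a b. \<lbrakk>a \<in> A; b \<in> A\<rbrakk> \<Longrightarrow> a \<oplus> b \<in> A"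
    using subringE(2,3,6,7)[OF A(1)] by auto
  obtain u where u: "u \<in> J" "u \<in> Units Q" using J by auto
  obtain s where s: "s \<in> reg" "s \<otimes> u \<in> K" using denominator[of u] u by auto
  define x where "x = s \<otimes> u"
  have xJ: "x \<in> J" unfolding x_def using submodD(5)[OF J(1) _ u(1)] s A(2) by blast
  have x: "x \<in> reg" unfolding x_def using s u by auto
  have xA: "x \<in> A" and xc: "x \<in> carrier Q" using x A(2) K_closed by auto
  define \<N> where "\<N> = {N. submod A N \<and> J \<subseteq> N \<and> N \<subseteq> A \<and> \<one> \<notin> N}"
  have "\<exists>N\<in>\<N>. \<forall>Y\<in>\<N>. N \<subseteq> Y \<longrightarrow> Y = N"
  proof (rule maximal_bounded[OF _ d(1)])
    show "\<N> \<noteq> {}" using J one by (auto simp: \<N>_def)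
    show "submod K X \<and> (\<forall>x\<in>X. d \<otimes> x \<in> K)" if "X \<in> \<N>" for X
      using that submod_mono[OF _ A(2)] d(2) by (auto simp: \<N>_def)
  qed
  then obtain N where "N \<in> \<N>" and maxN: "\<forall>Y\<in>\<N>. N \<subseteq> Y \<longrightarrow> Y = N" by (rule bexE)
  then have N: "submod A N" "J \<subseteq> N" "N \<subseteq> A" "\<one> \<notin> N" by (auto simp: \<N>_def)
  have "is_prime A N"
  proof (rule prime_of_maximal_disjoint[OF A(1), of "{\<one>}"])
    show "M = N" if "submod A M" "M \<subseteq> A" "M \<inter> {\<one>} = {}" "N \<subseteq> M" for M
    proof -
      have "M \<in> \<N>" using that N(2) by (auto simp: \<N>_def)
      then show ?thesis using maxN that(4) by blast
    qed
  qed (use N As in auto)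
  then have Nprime: "\<And>a b. \<lbrakk>a \<in> A; b \<in> A; a \<otimes> b \<in> N\<rbrakk> \<Longrightarrow> a \<in> N \<or> b \<in> N" by (auto simp: is_prime_def)
  define E where "E = (\<lambda>a. x \<otimes> a) ` A"
  have E: "submod A E" unfolding E_def by (intro submod_multiples submod_self A Ac xc)
  define S where "S b = {r \<in> A. b \<otimes> r \<in> E}" for b
  have SA: "S b \<subseteq> A" for b by (auto simp: S_def)
  have Ssub: "submod A (S b)" if "b \<in> A" for b
  proof -
    have "S b = A \<inter> {r \<in> carrier Q. b \<otimes> r \<in> E}" using Acl by (auto simp: S_def)
    then show ?thesis using submod_inter[OF submod_self[OF A(1)] submod_vimage[OF E Ac Acl[OF that]]] by simp
  qed
  define \<G> where "\<G> = {S b | b. b \<in> A \<and> S b \<subseteq> N}"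
  have "\<exists>X\<in>\<G>. \<forall>Y\<in>\<G>. X \<subseteq> Y \<longrightarrow> Y = X"
  proof (rule maximal_bounded[OF _ d(1)])
    have "r \<in> N" if r: "r \<in> S \<one>" for r
    proof -
      have "r \<in> E" using r Acl by (auto simp: S_def)
      then obtain a where "a \<in> A" "r = x \<otimes> a" by (auto simp: E_def)
      moreover have "a \<otimes> x \<in> N" using submodD(5)[OF N(1) calculation(1)] xJ N(2) by blast
      ultimately show ?thesis using xc Acl by (simp add: m_comm)
    qed
    then show "\<G> \<noteq> {}" using As(2) by (auto simp: \<G>_def)
    show "submod K X \<and> (\<forall>x\<in>X. d \<otimes> x \<in> K)" if "X \<in> \<G>" for X
      using that submod_mono[OF Ssub A(2)] SA d(2) by (auto simp: \<G>_def)
  qed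
  then obtain X where "X \<in> \<G>" and maxX: "\<forall>Y\<in>\<G>. X \<subseteq> Y \<longrightarrow> Y = X" by (rule bexE)
  then obtain b where b: "b \<in> A" "S b \<subseteq> N" and X: "X = S b" by (auto simp: \<G>_def)
  have maxb: "S b' = S b" if "b' \<in> A" "S b' \<subseteq> N" "S b \<subseteq> S b'" for b'
  proof -
    have "S b' \<in> \<G>" using that by (auto simp: \<G>_def)
    then show ?thesis using maxX that(3) X by blast
  qed
  have bc: "b \<in> carrier Q" using b Acl by auto
  \<comment> \<open>maximality of \<open>S b\<close> among the ideals of this form inside \<open>N\<close>\<close>
  have step: "\<exists>t\<in>A. t \<notin> N \<and> t \<otimes> r \<in> S b" if r: "r \<in> A" and s: "s \<in> A" "s \<notin> S b" "r \<otimes> s \<in> S b" for r s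
  proof -
    have c: "r \<in> carrier Q" "s \<in> carrier Q" using r s Acl by auto
    have inc: "S b \<subseteq> S (r \<otimes> b)"
    proof
      fix y assume y: "y \<in> S b"
      then have yA: "y \<in> A" "b \<otimes> y \<in> E" by (auto simp: S_def)
      have "(r \<otimes> b) \<otimes> y = r \<otimes> (b \<otimes> y)" using c bc Acl yA by (simp add: m_assoc)
      then show "y \<in> S (r \<otimes> b)" using yA submodD(5)[OF E r yA(2)] by (simp add: S_def)
    qed
    have "(r \<otimes> b) \<otimes> s = b \<otimes> (r \<otimes> s)" using c bc by (simp add: m_ac)
    then have "s \<in> S (r \<otimes> b)" using s by (auto simp: S_def)
    then have "\<not> S (r \<otimes> b) \<subseteq> N" using maxb[OF As(3)[OF r b(1)] _ inc] s(2) by blast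
    then obtain t where t: "t \<in> A" "(r \<otimes> b) \<otimes> t \<in> E" "t \<notin> N" by (auto simp: S_def)
    have "(r \<otimes> b) \<otimes> t = b \<otimes> (t \<otimes> r)" using c bc t Acl by (simp add: m_ac)
    then have "t \<otimes> r \<in> S b" using t r As by (auto simp: S_def)
    then show ?thesis using t by blast
  qed
  have "is_prime A (S b)"
    unfolding is_prime_def
  proof (intro conjI ballI impI)
    show "\<one> \<notin> S b" using b N by auto
    fix r s assume rs: "r \<in> A" "s \<in> A" "r \<otimes> s \<in> S b"
    show "r \<in> S b \<or> s \<in> S b"
    proof (rule ccontr)
      assume no: "\<not> ?thesis"
      obtain t where t: "t \<in> A" "t \<notin> N" "t \<otimes> r \<in> S b" using step[OF rs(1,2) _ rs(3)] no by auto
      obtain t' where "t' \<in> A" "t' \<notin> N" "t' \<otimes> t \<in> S b" using step[OF t(1) rs(1) _ t(3)] no by auto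
      then show False using Nprime[OF _ t(1)] t(2) b(2) by blast
    qed
  qed (use Ssub SA b in auto)
  moreover have "x \<in> S b" using xA b(1) m_comm[OF bc xc] by (simp add: S_def E_def)
  ultimately have max: "\<exists>p\<in>S b. \<exists>a\<in>A. \<one> = p \<oplus> t \<otimes> a" if "t \<in> A" "t \<notin> S b" for t
    using prime_of_overring_maximal[OF A d _ _ x that] by blast
  have NS: "N \<subseteq> S b"
  proof (rule ccontr)
    assume "\<not> ?thesis"
    then obtain t where t: "t \<in> N" "t \<notin> S b" by auto
    then obtain p a where h: "p \<in> S b" "a \<in> A" "\<one> = p \<oplus> t \<otimes> a" using max N(3) by blast
    have "p \<oplus> a \<otimes> t \<in> N" using submodD(4,5)[OF N(1)] h t b(2) by blast
    then show False using h t N Acl by (simp add: m_comm subset_iff)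
  qed
  have ix: "inv x \<in> carrier Q" "x \<otimes> inv x = \<one>" "inv x \<otimes> x = \<one>" using x by auto
  have "b \<otimes> inv x \<in> colon Q A J"
  proof (rule colonI)
    show "b \<otimes> inv x \<in> carrier Q" using bc ix by simp
    fix y assume "y \<in> J"
    then have y: "y \<in> S b" "y \<in> A" using N NS by auto
    then obtain a where a: "a \<in> A" "b \<otimes> y = x \<otimes> a" by (auto simp: S_def E_def)
    have "(b \<otimes> inv x) \<otimes> y = inv x \<otimes> (b \<otimes> y)" using bc ix Acl y by (simp add: m_ac)
    also have "\<dots> = a" unfolding a(2) using ix xc Acl[OF a(1)] by (simp add: m_assoc[symmetric])
    finally show "(b \<otimes> inv x) \<otimes> y \<in> A" using a by simp
  qed
  then have "b \<otimes> inv x \<in> A" using dual by auto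
  moreover have "b \<otimes> \<one> = x \<otimes> (b \<otimes> inv x)" using bc ix xc by (simp add: m_lcomm)
  ultimately have "\<one> \<in> S b" using As(2) by (auto simp: S_def E_def)
  then show False using b N by auto
qed

text \<open>
  Regular elements of \<open>K\<close> are units of \<open>Q\<close>, and every submodule with a unit contains a regular element of \<open>K\<close>.
\<close>

definition regular_fractional :: "'q set \<Rightarrow> bool" where
  "regular_fractional F \<longleftrightarrow> submod K F \<and> F \<inter> Units Q \<noteq> {} \<and> (\<exists>d\<in>reg. \<forall>x\<in>F. d \<otimes> x \<in> K)"

end

section \<open>Stability and reflexivity of regular fractional ideals\<close>

locale anti_stable_fractions = one_dim_fractions +
  assumes invertible_dual: "\<lbrakk>submod K I; I \<subseteq> K; I \<inter> Units Q \<noteq> {}\<rbrakk>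
    \<Longrightarrow> \<one> \<in> colon Q K I \<cdot> colon Q (colon Q I I) (colon Q K I)"
begin

text \<open>
  Multiplication with a common denominator \<open>d\<close> moves \<open>F\<close> into \<open>K\<close>, does not change \<open>F : F\<close>, and multiplies
  the dual by \<open>1 / d\<close>.
\<close>

lemma regular_fractional_invertible_dual:
  assumes F: "regular_fractional F"
  shows "\<one> \<in> colon Q K F \<cdot> colon Q (colon Q F F) (colon Q K F)"
proof -
  obtain d u where h: "submod K F" "u \<in> F" "u \<in> Units Q" "d \<in> reg" "\<And>x. x \<in> F \<Longrightarrow> d \<otimes> x \<in> K"
    using F by (auto simp: regular_fractional_def)
  have dc: "d \<in> carrier Q" and id: "inv d \<in> carrier Q" "d \<otimes> inv d = \<one>" "inv d \<otimes> d = \<one>" using h by auto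
  have Fc: "x \<in> F \<Longrightarrow> x \<in> carrier Q" for x using submodD(2)[OF h(1)] .
  let ?I = "(\<lambda>x. d \<otimes> x) ` F"
  have cancel: "inv d \<otimes> (d \<otimes> x) = x" "d \<otimes> (inv d \<otimes> x) = x" if "x \<in> carrier Q" for x
    using that dc id by (simp_all add: m_assoc[symmetric])
  have "\<one> \<in> colon Q K ?I \<cdot> colon Q (colon Q ?I ?I) (colon Q K ?I)"
  proof (rule invertible_dual)
    show "submod K ?I" by (intro submod_multiples h K_carrier dc)
    show "?I \<subseteq> K" using h(5) by auto
    have "d \<otimes> u \<in> ?I" "d \<otimes> u \<in> Units Q" using h by auto
    then show "?I \<inter> Units Q \<noteq> {}" by blast
  qed
  moreover have "p \<in> colon Q K F \<cdot> colon Q (colon Q F F) (colon Q K F)"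
    if "p \<in> colon Q K ?I \<cdot> colon Q (colon Q ?I ?I) (colon Q K ?I)" for p
    using that
  proof induct
    case (prod x y)
    have c: "x \<in> carrier Q" "y \<in> carrier Q" using prod colonD(1) by blast+
    have "x \<otimes> d \<in> colon Q K F"
    proof (rule colonI)
      fix f assume f: "f \<in> F"
      have "x \<otimes> (d \<otimes> f) \<in> K" using colonD(2)[OF prod(1)] f by blast
      then show "(x \<otimes> d) \<otimes> f \<in> K" using c dc Fc[OF f] by (simp add: m_assoc)
    qed (use c dc in simp)
    moreover have "y \<otimes> inv d \<in> colon Q (colon Q F F) (colon Q K F)"
    proof (rule colonI)
      fix z assume z: "z \<in> colon Q K F"
      have zc: "z \<in> carrier Q" using z colonD(1) by blast
      have "z \<otimes> inv d \<in> colon Q K ?I"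
      proof (rule colonI)
        fix i assume "i \<in> ?I"
        then obtain f where f: "f \<in> F" "i = d \<otimes> f" by auto
        then have "(z \<otimes> inv d) \<otimes> i = z \<otimes> f" using zc id dc Fc[OF f(1)] cancel by (simp add: m_assoc)
        then show "(z \<otimes> inv d) \<otimes> i \<in> K" using colonD(2)[OF z f(1)] by simp
      qed (use zc id in simp)
      then have yz: "y \<otimes> (z \<otimes> inv d) \<in> colon Q ?I ?I" using colonD(2)[OF prod(2)] by blast
      show "(y \<otimes> inv d) \<otimes> z \<in> colon Q F F"
      proof (rule colonI)
        fix f assume f: "f \<in> F"
        have "(y \<otimes> (z \<otimes> inv d)) \<otimes> (d \<otimes> f) \<in> ?I" using colonD(2)[OF yz] f by blast
        then obtain g where g: "g \<in> F" "(y \<otimes> (z \<otimes> inv d)) \<otimes> (d \<otimes> f) = d \<otimes> g" by auto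
        have "d \<otimes> (((y \<otimes> inv d) \<otimes> z) \<otimes> f) = d \<otimes> g"
          unfolding g(2)[symmetric] using c zc dc id(1) Fc[OF f] by (simp add: m_ac)
        moreover have "((y \<otimes> inv d) \<otimes> z) \<otimes> f \<in> carrier Q" using c zc id Fc[OF f] by simp
        ultimately have "((y \<otimes> inv d) \<otimes> z) \<otimes> f = g"
          using cancel(1) Fc[OF g(1)] by metis
        then show "((y \<otimes> inv d) \<otimes> z) \<otimes> f \<in> F" using g by simp
      qed (use c id zc in simp)
    qed (use c id in simp)
    moreover have "x \<otimes> y = (x \<otimes> d) \<otimes> (y \<otimes> inv d)"
      using c dc id cancel(2)[OF c(2)] by (metis m_assoc m_comm m_closed)
    ultimately show ?case using ideal_prod.prod by metis
  next
    case (sum s1 s2) then show ?case by (rule_tac ideal_prod.sum)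
  qed
  ultimately show ?thesis by blast
qed

text \<open>
  Here \<open>X\<close> and \<open>c\<close> are the duals of \<open>F\<close> and of \<open>A = F : F\<close>, and \<open>Y\<close> is the inverse of \<open>c\<close> over \<open>A\<close>. If
  \<open>q J \<subseteq> A\<close> for \<open>J = F X Y\<close>, then \<open>q X F = q X F Y c \<subseteq> A c \<subseteq> K\<close>, so that \<open>q X \<subseteq> X\<close>, and \<open>q \<in> A\<close> because
  \<open>X\<close> is invertible over \<open>A\<close>. Hence \<open>J = A\<close>. Both claims are read off from \<open>1 \<in> F X Y\<close>: on the one hand
  \<open>X Y \<subseteq> A : F\<close>, on the other hand \<open>q X \<subseteq> K\<close> implies \<open>q X \<subseteq> c\<close> and \<open>q \<in> q X Y F \<subseteq> A F = F\<close>.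
\<close>

lemma regular_fractional_stable_reflexive:
  assumes F: "regular_fractional F"
  shows "\<one> \<in> F \<cdot> colon Q (colon Q F F) F"
    and "\<lbrakk>q \<in> carrier Q; \<And>x. x \<in> colon Q K F \<Longrightarrow> q \<otimes> x \<in> K\<rbrakk> \<Longrightarrow> q \<in> F"
proof -
  obtain d u where h: "submod K F" "u \<in> F" "u \<in> Units Q" "d \<in> reg" "\<And>x. x \<in> F \<Longrightarrow> d \<otimes> x \<in> K"
    using F by (auto simp: regular_fractional_def)
  have dc: "d \<in> carrier Q" using h by auto
  have Fc: "F \<subseteq> carrier Q" and Fcl: "x \<in> F \<Longrightarrow> x \<in> carrier Q" for x using submodD(1,2)[OF h(1)] by auto
  define A where "A = colon Q F F"
  define X where "X = colon Q K F"
  define c where "c = colon Q K A"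
  define Y where "Y = colon Q A c"
  have A: "subring A Q" "K \<subseteq> A" unfolding A_def using subring_colon_self[OF h(1) subring_K] by auto
  have Acl: "a \<in> A \<Longrightarrow> a \<in> carrier Q" for a unfolding A_def using colonD(1) by blast
  then have Ac: "A \<subseteq> carrier Q" by auto
  have Xcl: "x \<in> X \<Longrightarrow> x \<in> carrier Q" for x unfolding X_def using colonD(1) by blast
  have ccl: "x \<in> c \<Longrightarrow> x \<in> carrier Q" for x unfolding c_def using colonD(1) by blast
  have Ycl: "x \<in> Y \<Longrightarrow> x \<in> carrier Q" for x unfolding Y_def using colonD(1) by blast
  have As: "\<zero> \<in> A" "\<one> \<in> A" "\<And>a b. \<lbrakk>a \<in> A; b \<in> A\<rbrakk> \<Longrightarrow> a \<otimes> b \<in> A" "\<And>a b. \<lbrakk>a \<in> A; b \<in> A\<rbrakk> \<Longrightarrow> a \<oplus> b \<in> A"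
    using subringE(2,3,6,7)[OF A(1)] by auto
  have AF: "a \<otimes> f \<in> F" if "a \<in> A" "f \<in> F" for a f using that unfolding A_def by (rule colonD(2))
  have FA: "submod A F" using submodD(3,4)[OF h(1)] Fc AF by (intro submodI) auto
  have XF: "x \<otimes> f \<in> K" if "x \<in> X" "f \<in> F" for x f using that unfolding X_def by (rule colonD(2))
  have XA: "x \<otimes> a \<in> X" if "x \<in> X" "a \<in> A" for x a
    using submodD(5)[OF submod_colon_over_multipliers[OF submod_K Fc], of a x] that m_comm[OF Xcl Acl]
    unfolding X_def A_def by simp
  have cA: "x \<otimes> a \<in> K" if "x \<in> c" "a \<in> A" for x a using that unfolding c_def by (rule colonD(2))
  have cK: "x \<in> K" if "x \<in> c" for x using cA[OF that As(2)] ccl[OF that] by simp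
  have Yc: "y \<otimes> x \<in> A" if "y \<in> Y" "x \<in> c" for x y using that unfolding Y_def by (rule colonD(2))
  have oneX: "\<one> \<in> X \<cdot> colon Q A X" using regular_fractional_invertible_dual[OF F] unfolding X_def A_def .
  have bound: "d \<otimes> u \<in> reg" "\<And>a. a \<in> A \<Longrightarrow> (d \<otimes> u) \<otimes> a \<in> K"
  proof -
    show "d \<otimes> u \<in> reg" using h by auto
    fix a assume a: "a \<in> A"
    have "d \<otimes> (a \<otimes> u) \<in> K" using h(5)[OF AF[OF a h(2)]] .
    then show "(d \<otimes> u) \<otimes> a \<in> K" using dc Acl[OF a] Fcl[OF h(2)] by (simp add: m_ac)
  qed
  have fracA: "regular_fractional A" unfolding regular_fractional_def
    using submod_mono[OF submod_self[OF A(1)] A(2)] As(2) bound by blast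
  have AA: "colon Q A A = A"
  proof
    show "A \<subseteq> colon Q A A" using As(3) Acl by (auto intro!: colonI)
    show "colon Q A A \<subseteq> A"
    proof
      fix q assume q: "q \<in> colon Q A A"
      show "q \<in> A" using colonD(2)[OF q As(2)] colonD(1)[OF q] by simp
    qed
  qed
  have onec: "\<one> \<in> c \<cdot> Y" using regular_fractional_invertible_dual[OF fracA] unfolding AA c_def Y_def .
  define J where "J = (F \<cdot> X) \<cdot> Y"
  have fxc: "f \<otimes> x \<in> c" if "f \<in> F" "x \<in> X" for f x
    unfolding c_def
  proof (rule colonI)
    fix a assume a: "a \<in> A"
    have "x \<otimes> (a \<otimes> f) \<in> K" using XF[OF that(2) AF[OF a that(1)]] .
    then show "(f \<otimes> x) \<otimes> a \<in> K" using that a Xcl Acl Fcl by (simp add: m_ac)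
  qed (use that Xcl Fcl in simp)
  have X0: "\<zero> \<in> X" and Y0: "\<zero> \<in> Y"
    unfolding X_def Y_def using As(1) K_simps(1) Fcl ccl by (auto intro!: colonI)
  have Jsub: "submod A J" unfolding J_def
    using Xcl Ycl X0 Y0 by (intro submod_prod FA Ac) auto
  have FXc: "submod A c" using submod_colon_over_multipliers[OF submod_K Ac] unfolding AA c_def .
  have pc: "p \<in> c" if "p \<in> F \<cdot> X" for p
    using that by induct (use fxc submodD(4)[OF FXc] in auto)
  have JA: "J \<subseteq> A"
  proof
    fix p assume "p \<in> J" then show "p \<in> A" unfolding J_def
    proof induct
      case (prod i j) then show ?case using Yc[OF prod(2) pc[OF prod(1)]] ccl[OF pc[OF prod(1)]] Ycl[OF prod(2)] by (simp add: m_comm)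
    qed (rule As(4))
  qed
  have JI: "(f \<otimes> x) \<otimes> y \<in> J" if "f \<in> F" "x \<in> X" "y \<in> Y" for f x y
    unfolding J_def using that by (intro ideal_prod.prod)
  have oneY: "\<one> \<in> Y" unfolding Y_def using cK A(2) ccl by (auto intro!: colonI)
  have dX: "d \<in> X" unfolding X_def using h(5) dc by (auto intro!: colonI)
  have Ju: "J \<inter> Units Q \<noteq> {}"
  proof -
    have "(u \<otimes> d) \<otimes> \<one> \<in> Units Q" using h by auto
    then show ?thesis using JI[OF h(2) dX oneY] by blast
  qed
  have dual: "colon Q A J \<subseteq> A"
  proof
    fix q assume q: "q \<in> colon Q A J"
    have qc: "q \<in> carrier Q" using colonD(1)[OF q] .
    have qX: "q \<otimes> x \<in> X" if x: "x \<in> X" for x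
      unfolding X_def
    proof (rule colonI)
      fix f assume f: "f \<in> F"
      show "(q \<otimes> x) \<otimes> f \<in> K"
      proof (rule one_prod_elim[OF onec])
        fix z y assume zy: "z \<in> c" "y \<in> Y"
        have "q \<otimes> ((f \<otimes> x) \<otimes> y) \<in> A" using colonD(2)[OF q JI[OF f x zy(2)]] .
        then have "z \<otimes> (q \<otimes> ((f \<otimes> x) \<otimes> y)) \<in> K" by (rule cA[OF zy(1)])
        moreover have "z \<otimes> (q \<otimes> ((f \<otimes> x) \<otimes> y)) = ((q \<otimes> x) \<otimes> f) \<otimes> (z \<otimes> y)"
          using qc x f zy Xcl Fcl ccl Ycl by (simp add: m_ac)
        ultimately show "((q \<otimes> x) \<otimes> f) \<otimes> (z \<otimes> y) \<in> K" by simp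
      qed (use ccl Ycl qc Xcl[OF x] Fcl[OF f] K_simps in auto)
    qed (use qc Xcl[OF x] in simp)
    show "q \<in> A"
    proof (rule one_prod_elim[OF oneX])
      fix x y assume xy: "x \<in> X" "y \<in> colon Q A X"
      have "y \<otimes> (q \<otimes> x) \<in> A" using colonD(2)[OF xy(2) qX[OF xy(1)]] .
      then show "q \<otimes> (x \<otimes> y) \<in> A" using qc Xcl[OF xy(1)] colonD(1)[OF xy(2)] by (simp add: m_ac)
    qed (use Xcl colonD(1) qc As in auto)
  qed
  have oneJ: "\<one> \<in> J"
    using one_in_of_trivial_dual[OF A _ bound(2) Jsub JA Ju dual] bound(1) by blast
  show "\<one> \<in> F \<cdot> colon Q (colon Q F F) F"
  proof -
    have xy: "x \<otimes> y \<in> colon Q A F" if "x \<in> X" "y \<in> Y" for x y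
    proof (rule colonI)
      fix f assume f: "f \<in> F"
      show "(x \<otimes> y) \<otimes> f \<in> A"
        using Yc[OF that(2) fxc[OF f that(1)]] Xcl[OF that(1)] Ycl[OF that(2)] Fcl[OF f] by (simp add: m_ac)
    qed (use that Xcl Ycl in simp)
    have fx: "p \<in> carrier Q \<and> p \<otimes> y \<in> F \<cdot> colon Q A F" if "p \<in> F \<cdot> X" "y \<in> Y" for p y
      using that(1)
    proof induct
      case (prod f x)
      then have "(f \<otimes> x) \<otimes> y = f \<otimes> (x \<otimes> y)" using Fcl Xcl Ycl that(2) by (simp add: m_assoc)
      then show ?case using ideal_prod.prod[OF prod(1) xy[OF prod(2) that(2)], of Q] prod Fcl Xcl by simp
    next
      case (sum s t)
      then show ?case using Ycl[OF that(2)] by (simp add: l_distr ideal_prod.sum)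
    qed
    have "p \<in> F \<cdot> colon Q A F" if "p \<in> J" for p
      using that unfolding J_def by induct (use fx ideal_prod.sum in auto)
    then show ?thesis using oneJ unfolding A_def by blast
  qed
  assume qc: "q \<in> carrier Q" and qX: "\<And>x. x \<in> colon Q K F \<Longrightarrow> q \<otimes> x \<in> K"
  have qxc: "q \<otimes> x \<in> c" if x: "x \<in> X" for x
    unfolding c_def
  proof (rule colonI)
    fix a assume a: "a \<in> A"
    have "q \<otimes> (x \<otimes> a) \<in> K" using qX XA[OF x a] unfolding X_def by blast
    then show "(q \<otimes> x) \<otimes> a \<in> K" using qc Xcl[OF x] Acl[OF a] by (simp add: m_assoc)
  qed (use qc Xcl[OF x] in simp)
  show "q \<in> F"
  proof (rule one_prod_elim[OF oneJ[unfolded J_def]])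
    show "F \<cdot> X \<subseteq> carrier Q" using pc ccl by blast
    show "Y \<subseteq> carrier Q" using Ycl by blast
    fix p y assume py: "p \<in> F \<cdot> X" "y \<in> Y"
    from py(1) have "p \<in> carrier Q \<and> q \<otimes> (p \<otimes> y) \<in> F"
    proof induct
      case (prod f x)
      have "(y \<otimes> (q \<otimes> x)) \<otimes> f \<in> F" using AF[OF Yc[OF py(2) qxc[OF prod(2)]] prod(1)] .
      then show ?case using qc Fcl[OF prod(1)] Xcl[OF prod(2)] Ycl[OF py(2)] by (simp add: m_ac)
    next
      case (sum s t)
      then show ?case using Ycl[OF py(2)] qc submodD(4)[OF h(1)] by (simp add: l_distr r_distr)
    qed
    then show "q \<otimes> (p \<otimes> y) \<in> F" by blast
  qed (use qc submodD(4)[OF h(1)] in auto)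
qed

end

section \<open>Nilpotent elements and annihilators in the ring of fractions\<close>

context one_dim_fractions
begin

lemma common_denominator:
  assumes "s \<in> carrier Q" "a \<in> carrier Q"
  shows "\<exists>d\<in>reg. d \<otimes> s \<in> K \<and> d \<otimes> a \<in> K"
proof -
  obtain x y where x: "x \<in> reg" "x \<otimes> s \<in> K" and y: "y \<in> reg" "y \<otimes> a \<in> K"
    using denominator assms by meson
  have "(x \<otimes> y) \<otimes> s = y \<otimes> (x \<otimes> s)" "(x \<otimes> y) \<otimes> a = x \<otimes> (y \<otimes> a)"
    using reg_closed[OF x(1)] reg_closed[OF y(1)] assms by (simp_all add: m_ac)
  then have "(x \<otimes> y) \<otimes> s \<in> K \<and> (x \<otimes> y) \<otimes> a \<in> K" using x y K_simps by auto
  then show ?thesis using reg_mult[OF x(1) y(1)] by blast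
qed

lemma reg_cancel: "\<lbrakk>d \<in> reg; x \<in> carrier Q; d \<otimes> x = \<zero>\<rbrakk> \<Longrightarrow> x = \<zero>"
  using Units_l_cancel[of d x \<zero>] by auto

text \<open>
  The module \<open>K + K s + K a\<close>, as an iterated sum so that the closure properties of sums and multiples
  apply; \<open>span2_iff\<close> is the readable form.
\<close>

definition span2 :: "'q \<Rightarrow> 'q \<Rightarrow> 'q set" where
  "span2 s a = {u \<oplus> v | u v. u \<in> {x \<oplus> y | x y. x \<in> K \<and> y \<in> (\<lambda>r. s \<otimes> r) ` K} \<and> v \<in> (\<lambda>r. a \<otimes> r) ` K}"

lemma span2_iff: "f \<in> span2 s a \<longleftrightarrow> (\<exists>x\<in>K. \<exists>y\<in>K. \<exists>z\<in>K. f = x \<oplus> s \<otimes> y \<oplus> a \<otimes> z)"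
  by (auto simp: span2_def) blast

lemma regular_fractional_span2:
  assumes s: "s \<in> carrier Q" "a \<in> carrier Q"
  shows "regular_fractional (span2 s a)" and "\<one> \<in> span2 s a" "s \<in> span2 s a" "a \<in> span2 s a"
proof -
  have "\<one> = \<one> \<oplus> s \<otimes> \<zero> \<oplus> a \<otimes> \<zero>" using s by simp
  then show one: "\<one> \<in> span2 s a" unfolding span2_iff using K_simps by metis
  have "s = \<zero> \<oplus> s \<otimes> \<one> \<oplus> a \<otimes> \<zero>" using s by simp
  then show "s \<in> span2 s a" unfolding span2_iff using K_simps by metis
  have "a = \<zero> \<oplus> s \<otimes> \<zero> \<oplus> a \<otimes> \<one>" using s by simp
  then show "a \<in> span2 s a" unfolding span2_iff using K_simps by metis
  obtain d where d: "d \<in> reg" "d \<otimes> s \<in> K" "d \<otimes> a \<in> K" using common_denominator[OF s] by auto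
  show "regular_fractional (span2 s a)" unfolding regular_fractional_def
  proof (intro conjI bexI[OF _ d(1)] ballI)
    show "submod K (span2 s a)" unfolding span2_def
      by (intro submod_sum submod_multiples submod_K K_carrier s)
    show "span2 s a \<inter> Units Q \<noteq> {}" using one by blast
    fix f assume "f \<in> span2 s a"
    then obtain x y z where f: "x \<in> K" "y \<in> K" "z \<in> K" "f = x \<oplus> s \<otimes> y \<oplus> a \<otimes> z" unfolding span2_iff by auto
    have c: "x \<in> carrier Q" "y \<in> carrier Q" "z \<in> carrier Q" "d \<in> carrier Q" using f d K_closed by auto
    have "d \<otimes> f = d \<otimes> x \<oplus> (d \<otimes> s) \<otimes> y \<oplus> (d \<otimes> a) \<otimes> z" unfolding f(4) using c s by algebra
    then show "d \<otimes> f \<in> K" using f d K_simps by auto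
  qed
qed

text \<open>
  A Noetherian argument in place of a choice of generators of \<open>I\<close>: the submodules of those \<open>i\<close> for which
  \<open>y\<close> clears the denominator have a maximal element, and enlarging \<open>y\<close> reaches any given \<open>i\<close>.
\<close>

lemma clear_denominators:
  assumes I: "submod K I" "I \<subseteq> K" and u: "u \<in> K" and multiples: "\<And>i. i \<in> I \<Longrightarrow> \<exists>q\<in>carrier Q. i = u \<otimes> q"
  shows "\<exists>y\<in>reg. \<forall>i\<in>I. \<exists>k\<in>K. y \<otimes> i = u \<otimes> k"
proof -
  define L where "L y = {i \<in> I. y \<otimes> i \<in> (\<lambda>k. u \<otimes> k) ` K}" for y
  have uc: "u \<in> carrier Q" using u K_closed by auto
  have "\<exists>X\<in>L ` reg. \<forall>Y\<in>L ` reg. X \<subseteq> Y \<longrightarrow> Y = X"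
  proof (rule noetherian)
    show "L ` reg \<noteq> {}" using one_reg by blast
    fix X assume "X \<in> L ` reg"
    then obtain y where y: "y \<in> reg" "X = L y" by auto
    have "L y = I \<inter> {x \<in> carrier Q. y \<otimes> x \<in> (\<lambda>k. u \<otimes> k) ` K}"
      using submodD(2)[OF I(1)] by (auto simp: L_def)
    then have "submod K (L y)"
      using submod_inter[OF I(1) submod_vimage[OF submod_multiples[OF submod_K K_carrier uc] K_carrier]] y by auto
    then show "submod K X \<and> X \<subseteq> K" using y(2) I(2) by (auto simp: L_def)
  qed
  then obtain y where y: "y \<in> reg" and max: "\<forall>Y\<in>L ` reg. L y \<subseteq> Y \<longrightarrow> Y = L y" by auto
  have yc: "y \<in> carrier Q" using y by auto
  have "i \<in> L y" if i: "i \<in> I" for i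
  proof -
    obtain q where q: "q \<in> carrier Q" "i = u \<otimes> q" using multiples[OF i] by auto
    obtain s where s: "s \<in> reg" "s \<otimes> q \<in> K" using denominator[OF q(1)] by auto
    have sc: "s \<in> carrier Q" using s by auto
    have "L y \<subseteq> L (y \<otimes> s)"
    proof
      fix j assume j: "j \<in> L y"
      then obtain k where k: "k \<in> K" "y \<otimes> j = u \<otimes> k" by (auto simp: L_def)
      have jc: "j \<in> I" "j \<in> carrier Q" using j submodD(2)[OF I(1)] by (auto simp: L_def)
      have "(y \<otimes> s) \<otimes> j = s \<otimes> (y \<otimes> j)" using yc sc jc by (simp add: m_ac)
      also have "\<dots> = u \<otimes> (s \<otimes> k)" unfolding k(2) using sc uc K_closed[OF k(1)] by (simp add: m_ac)
      finally show "j \<in> L (y \<otimes> s)" using jc k s K_simps by (auto simp: L_def)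
    qed
    then have "L (y \<otimes> s) = L y" using max reg_mult[OF y s(1)] by blast
    moreover have "(y \<otimes> s) \<otimes> i = u \<otimes> (y \<otimes> (s \<otimes> q))" unfolding q(2) using yc sc uc q by (simp add: m_ac)
    then have "i \<in> L (y \<otimes> s)" using i y s K_simps by (auto simp: L_def)
    ultimately show ?thesis by simp
  qed
  then have "\<forall>i\<in>I. \<exists>k\<in>K. y \<otimes> i = u \<otimes> k" by (auto simp: L_def)
  then show ?thesis using y by blast
qed

end

context anti_stable_fractions
begin

text \<open>
  Let \<open>F = K + K s + K a\<close>, \<open>A = F : F\<close> and \<open>1 = \<Sum> f y\<close> with \<open>f \<in> F\<close>, \<open>y \<in> A : F\<close>. The assumptions make \<open>F\<close>
  act on \<open>s a\<close> through \<open>K\<close>. Inserting the expression for \<open>1\<close> twice therefore writes \<open>s a\<close> as a combination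
  of products \<open>(s y) (a y')\<close>, which lie in \<open>A\<close>; and \<open>A \<subseteq> F\<close> because \<open>1 \<in> F\<close>.
\<close>

lemma product_in_span2:
  assumes s: "s \<in> carrier Q" "a \<in> carrier Q" and zero: "s \<otimes> (s \<otimes> a) = \<zero>" "a \<otimes> (s \<otimes> a) = \<zero>"
  shows "s \<otimes> a \<in> span2 s a"
proof -
  let ?F = "span2 s a" let ?p = "s \<otimes> a"
  let ?A = "colon Q ?F ?F" let ?Y = "colon Q ?A ?F"
  note F = regular_fractional_span2[OF s]
  have Fs: "submod K ?F" using F(1) by (simp add: regular_fractional_def)
  have Fc: "?F \<subseteq> carrier Q" using submodD(1)[OF Fs] .
  have A: "subring ?A Q" "K \<subseteq> ?A" using subring_colon_self[OF Fs subring_K] .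
  have Ac: "?A \<subseteq> carrier Q" and Yc: "?Y \<subseteq> carrier Q" by (auto simp: colon_def)
  have pc: "?p \<in> carrier Q" using s by simp
  have pf: "\<exists>x\<in>K. ?p \<otimes> f = x \<otimes> ?p" if f: "f \<in> ?F" for f
  proof -
    obtain x y z where h: "x \<in> K" "y \<in> K" "z \<in> K" "f = x \<oplus> s \<otimes> y \<oplus> a \<otimes> z" using f unfolding span2_iff by auto
    have c: "x \<in> carrier Q" "y \<in> carrier Q" "z \<in> carrier Q" using h K_closed by auto
    have "?p \<otimes> f = x \<otimes> ?p \<oplus> y \<otimes> (s \<otimes> ?p) \<oplus> z \<otimes> (a \<otimes> ?p)" unfolding h(4) using c s by algebra
    then show ?thesis unfolding zero using h c pc by auto
  qed
  have YA: "f \<otimes> y \<in> ?A" if "f \<in> ?F" "y \<in> ?Y" for f y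
    using colonD(2)[OF that(2,1)] that Fc Yc by (auto simp: m_comm subset_iff)
  have one: "\<one> \<in> ?F \<cdot> ?Y" using regular_fractional_stable_reflexive(1)[OF F(1)] .
  have py: "?p \<otimes> y \<in> ?A" if y: "y \<in> ?Y" for y
  proof (rule one_prod_elim[OF one Fc Yc])
    show "?p \<otimes> y \<in> carrier Q" using pc y Yc by auto
    fix f y' assume h: "f \<in> ?F" "y' \<in> ?Y"
    obtain x where x: "x \<in> K" "?p \<otimes> f = x \<otimes> ?p" using pf[OF h(1)] by auto
    have c: "y \<in> carrier Q" "y' \<in> carrier Q" "f \<in> carrier Q" "x \<in> carrier Q"
      using y h Yc Fc x K_closed by auto
    have "(?p \<otimes> y) \<otimes> (f \<otimes> y') = (?p \<otimes> f) \<otimes> (y \<otimes> y')" using c pc by (simp add: m_ac)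
    also have "\<dots> = x \<otimes> ((s \<otimes> y) \<otimes> (a \<otimes> y'))" unfolding x(2) using c s by (simp add: m_ac)
    also have "\<dots> \<in> ?A"
      using x(1) A(2) by (intro subringE(6)[OF A(1) _ subringE(6)[OF A(1) YA[OF F(3) y] YA[OF F(4) h(2)]]]) auto
    finally show "(?p \<otimes> y) \<otimes> (f \<otimes> y') \<in> ?A" .
  qed (use subringE(7)[OF A(1)] in auto)
  have "?p \<in> ?A"
  proof (rule one_prod_elim[OF one Fc Yc pc])
    fix f y assume h: "f \<in> ?F" "y \<in> ?Y"
    obtain x where x: "x \<in> K" "?p \<otimes> f = x \<otimes> ?p" using pf[OF h(1)] by auto
    have c: "y \<in> carrier Q" "f \<in> carrier Q" "x \<in> carrier Q"
      using h Yc Fc x K_closed by auto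
    have "?p \<otimes> (f \<otimes> y) = (?p \<otimes> f) \<otimes> y" using c pc by (simp add: m_ac)
    also have "\<dots> = x \<otimes> (?p \<otimes> y)" unfolding x(2) using c pc by (simp add: m_ac)
    also have "\<dots> \<in> ?A" using x(1) A(2) by (intro subringE(6)[OF A(1) _ py[OF h(2)]]) auto
    finally show "?p \<otimes> (f \<otimes> y) \<in> ?A" .
  qed (use subringE(7)[OF A(1)] in auto)
  from colonD(2)[OF this F(2)] show ?thesis using pc by simp
qed

text \<open>
  The hypotheses are homogeneous, so \<open>product_in_span2\<close> applies to \<open>s / z\<close> and \<open>a / z\<close> for every regular \<open>z\<close>.
  Clearing denominators puts a fixed multiple of \<open>s a\<close> into \<open>z K\<close> for all \<open>z\<close>.
\<close>

lemma product_zero: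
  assumes s: "s \<in> carrier Q" "a \<in> carrier Q" and zero: "s \<otimes> (s \<otimes> a) = \<zero>" "a \<otimes> (s \<otimes> a) = \<zero>"
  shows "s \<otimes> a = \<zero>"
proof -
  obtain d where d: "d \<in> reg" "d \<otimes> s \<in> K" "d \<otimes> a \<in> K" using common_denominator[OF s] by auto
  have dc: "d \<in> carrier Q" using d by auto
  have "d \<otimes> (s \<otimes> a) \<in> {\<zero>}"
  proof (rule ideal_closed_of_regular_approximation)
    show "submod (carrier Q) {\<zero>}" by (intro submodI) auto
    show "d \<otimes> (s \<otimes> a) \<in> carrier Q" using dc s by simp
    fix z assume z: "z \<in> reg"
    define i where "i = inv z"
    have zc: "z \<in> carrier Q" "i \<in> carrier Q" "z \<otimes> i = \<one>" using z by (auto simp: i_def)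
    have "(s \<otimes> i) \<otimes> (a \<otimes> i) \<in> span2 (s \<otimes> i) (a \<otimes> i)"
    proof (rule product_in_span2)
      have "(s \<otimes> i) \<otimes> ((s \<otimes> i) \<otimes> (a \<otimes> i)) = (s \<otimes> (s \<otimes> a)) \<otimes> (i \<otimes> (i \<otimes> i))" using s zc(1,2) by (simp add: m_ac)
      then show "(s \<otimes> i) \<otimes> ((s \<otimes> i) \<otimes> (a \<otimes> i)) = \<zero>" unfolding zero using zc by simp
      have "(a \<otimes> i) \<otimes> ((s \<otimes> i) \<otimes> (a \<otimes> i)) = (a \<otimes> (s \<otimes> a)) \<otimes> (i \<otimes> (i \<otimes> i))" using s zc(1,2) by (simp add: m_ac)
      then show "(a \<otimes> i) \<otimes> ((s \<otimes> i) \<otimes> (a \<otimes> i)) = \<zero>" unfolding zero using zc by simp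
    qed (use s zc in auto)
    then obtain x y t where h: "x \<in> K" "y \<in> K" "t \<in> K"
      "(s \<otimes> i) \<otimes> (a \<otimes> i) = x \<oplus> (s \<otimes> i) \<otimes> y \<oplus> (a \<otimes> i) \<otimes> t" unfolding span2_iff by auto
    have c: "x \<in> carrier Q" "y \<in> carrier Q" "t \<in> carrier Q" using h K_closed by auto
    have "s \<otimes> a = (z \<otimes> i) \<otimes> ((z \<otimes> i) \<otimes> (s \<otimes> a))" using zc s by simp
    also have "\<dots> = z \<otimes> (z \<otimes> ((s \<otimes> i) \<otimes> (a \<otimes> i)))" using s zc(1,2) by (simp add: m_ac)
    also have "\<dots> = z \<otimes> (z \<otimes> x \<oplus> s \<otimes> ((z \<otimes> i) \<otimes> y) \<oplus> a \<otimes> ((z \<otimes> i) \<otimes> t))"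
      unfolding h(4) using c s zc(1,2) by algebra
    also have "\<dots> = z \<otimes> (z \<otimes> x \<oplus> s \<otimes> y \<oplus> a \<otimes> t)" unfolding zc(3) using c by simp
    finally have "d \<otimes> (s \<otimes> a) = z \<otimes> (d \<otimes> (z \<otimes> x) \<oplus> (d \<otimes> s) \<otimes> y \<oplus> (d \<otimes> a) \<otimes> t)"
      using c s zc(1,2) dc by (simp add: m_ac r_distr)
    moreover have "d \<otimes> (z \<otimes> x) \<oplus> (d \<otimes> s) \<otimes> y \<oplus> (d \<otimes> a) \<otimes> t \<in> K"
      using d z h by (auto intro!: K_simps)
    moreover have "z \<otimes> k \<ominus> z \<otimes> k \<in> {\<zero>}" if "k \<in> K" for k using zc K_closed[OF that] by (simp add: a_minus_def r_neg)
    ultimately show "\<exists>k\<in>K. d \<otimes> (s \<otimes> a) \<ominus> z \<otimes> k \<in> {\<zero>}" by metis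
  qed
  then show ?thesis using reg_cancel[OF d(1)] s by simp
qed

lemma square_zero_product:
  assumes "s \<in> carrier Q" "a \<in> carrier Q" "s \<otimes> s = \<zero>" "a \<otimes> a = \<zero>"
  shows "s \<otimes> a = \<zero>"
proof (rule product_zero[OF assms(1,2)])
  have "s \<otimes> (s \<otimes> a) = (s \<otimes> s) \<otimes> a" "a \<otimes> (s \<otimes> a) = s \<otimes> (a \<otimes> a)" using assms(1,2) by (simp_all add: m_ac)
  then show "s \<otimes> (s \<otimes> a) = \<zero>" "a \<otimes> (s \<otimes> a) = \<zero>" using assms by simp_all
qed

text \<open>
  By \<open>pi_regular_K\<close>, \<open>u\<^sup>n (1 - u q) = 0\<close> for some \<open>n\<close>, and \<open>product_zero\<close> with factors \<open>u\<close> and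
  \<open>u\<^bsup>n - 2\<^esup> (1 - u q)\<close> lowers the exponent \<open>n\<close> as long as it exceeds \<open>2\<close>.
\<close>

lemma square_regular:
  assumes u: "u \<in> carrier Q"
  shows "\<exists>q\<in>carrier Q. u \<otimes> u = (u \<otimes> u) \<otimes> (u \<otimes> q)"
proof -
  obtain s where s: "s \<in> reg" "s \<otimes> u \<in> K" using denominator[OF u] by auto
  have sc: "s \<in> carrier Q" using s by auto
  obtain n :: nat and q where q: "q \<in> carrier Q" "(s \<otimes> u) [^] n = (s \<otimes> u) [^] n \<otimes> ((s \<otimes> u) \<otimes> q)"
    using pi_regular_K[OF s(2)] by auto
  define p where "p = s \<otimes> q"
  have p: "p \<in> carrier Q" using sc q by (simp add: p_def)
  let ?g = "\<one> \<ominus> u \<otimes> p"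
  have gc: "?g \<in> carrier Q" using u p by simp
  have sn: "s [^] n \<in> Units Q" using s by (simp add: Units_pow_closed)
  have "s [^] n \<otimes> (u [^] n \<otimes> ?g) = (s \<otimes> u) [^] n \<ominus> (s \<otimes> u) [^] n \<otimes> ((s \<otimes> u) \<otimes> q)"
    unfolding p_def nat_pow_distrib[OF sc u] using sc u q nat_pow_closed[OF sc, of n] nat_pow_closed[OF u, of n] by algebra
  also have "\<dots> = \<zero>" using q sc u by (simp add: a_minus_def r_neg)
  finally have un: "u [^] n \<otimes> ?g = \<zero>" using sn gc u by (metis Units_closed Units_l_cancel m_closed nat_pow_closed r_null zero_closed)
  have red: "(u \<otimes> u) \<otimes> ?g = \<zero>" if "u [^] (k + 2) \<otimes> ?g = \<zero>" for k :: nat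
    using that
  proof (induct k)
    case 0 then show ?case using u by (simp add: numeral_2_eq_2)
  next
    case (Suc k)
    let ?a = "u [^] Suc k \<otimes> ?g"
    have pk: "u [^] k \<in> carrier Q" using u by simp
    have z: "u \<otimes> (u \<otimes> ?a) = \<zero>" using Suc(2) u gc pk by (simp add: m_ac)
    have "u \<otimes> ?a = \<zero>"
    proof (rule product_zero[OF u _ z])
      have "?a \<otimes> (u \<otimes> ?a) = (u [^] k \<otimes> ?g) \<otimes> (u \<otimes> (u \<otimes> ?a))"
        using u gc pk by (simp add: m_ac)
      then show "?a \<otimes> (u \<otimes> ?a) = \<zero>" unfolding z using u gc by simp
    qed (use u gc in simp)
    then have "u [^] (k + 2) \<otimes> ?g = \<zero>" using u gc pk by (simp add: m_ac)
    then show ?case by (rule Suc(1))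
  qed
  have "u [^] (n + 2) \<otimes> ?g = (u \<otimes> u) \<otimes> (u [^] n \<otimes> ?g)" using u gc by (simp add: m_ac)
  also have "\<dots> = \<zero>" unfolding un using u by simp
  finally have "(u \<otimes> u) \<otimes> ?g = \<zero>" by (rule red)
  moreover have "(u \<otimes> u) = (u \<otimes> u) \<otimes> (u \<otimes> p) \<oplus> (u \<otimes> u) \<otimes> ?g" using u p by algebra
  ultimately have "u \<otimes> u = (u \<otimes> u) \<otimes> (u \<otimes> p)" using u p by simp
  then show ?thesis using p by blast
qed

text \<open>
  The idempotent \<open>e \<in> u Q\<close> splits \<open>Q\<close> into a factor in which \<open>u\<close> is a unit and one in which \<open>u\<close> has
  square zero.
\<close>

lemma support_idempotent:
  assumes u: "u \<in> carrier Q"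
  obtains e q where "e \<in> carrier Q" "q \<in> carrier Q" "e = u \<otimes> q" "e \<otimes> e = e" "(u \<otimes> u) \<otimes> e = u \<otimes> u"
proof -
  obtain q where q: "q \<in> carrier Q" "u \<otimes> u = (u \<otimes> u) \<otimes> (u \<otimes> q)" using square_regular[OF u] by auto
  let ?e = "u \<otimes> (u \<otimes> (q \<otimes> q))"
  have "(u \<otimes> u) \<otimes> ?e = ((u \<otimes> u) \<otimes> (u \<otimes> q)) \<otimes> (u \<otimes> q)" using u q(1) by (simp add: m_ac)
  also have "\<dots> = u \<otimes> u" using q(2) by simp
  finally have uu: "(u \<otimes> u) \<otimes> ?e = u \<otimes> u" .
  have "?e \<otimes> ?e = ((u \<otimes> u) \<otimes> ?e) \<otimes> (q \<otimes> q)" using u q(1) by (simp add: m_ac)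
  also have "\<dots> = ?e" unfolding uu using u q(1) by (simp add: m_ac)
  finally show thesis using that[of ?e "u \<otimes> (q \<otimes> q)"] uu u q(1) by simp
qed

text \<open>
  Let \<open>y\<close> be a regular element with \<open>y (u Q \<inter> K) \<subseteq> u K\<close>. For every regular \<open>z\<close>, the element \<open>y v / z\<close>
  lies in the double dual of \<open>K + K u / z\<close>: if \<open>x\<close> and \<open>x u / z\<close> belong to \<open>K\<close>, then \<open>y x u / z = u k\<close> with
  \<open>k \<in> K\<close>, and the hypothesis on annihilators allows to replace \<open>u\<close> by \<open>v\<close>. By reflexivity
  \<open>y v \<in> z K + u K\<close>, where \<open>y\<close> does not depend on \<open>z\<close>.
\<close>

lemma double_annihilator:
  assumes u: "u \<in> K" "v \<in> K" and ann: "\<And>r. \<lbrakk>r \<in> carrier Q; r \<otimes> u = \<zero>\<rbrakk> \<Longrightarrow> r \<otimes> v = \<zero>"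
  shows "\<exists>q\<in>carrier Q. v = u \<otimes> q"
proof -
  have uc: "u \<in> carrier Q" "v \<in> carrier Q" using u K_closed by auto
  let ?T = "(\<lambda>q. u \<otimes> q) ` carrier Q"
  have T: "submod (carrier Q) ?T" by (intro submod_multiples submod_self carrier_is_subring uc) auto
  have "\<exists>y\<in>reg. \<forall>i\<in>?T \<inter> K. \<exists>k\<in>K. y \<otimes> i = u \<otimes> k"
    by (rule clear_denominators[OF submod_inter[OF submod_mono[OF T K_carrier] submod_K] _ u(1)]) auto
  then obtain y where y: "y \<in> reg" and clear: "\<And>i. \<lbrakk>i \<in> ?T; i \<in> K\<rbrakk> \<Longrightarrow> \<exists>k\<in>K. y \<otimes> i = u \<otimes> k" by blast
  have yc: "y \<in> carrier Q" "inv y \<in> carrier Q" "inv y \<otimes> y = \<one>" using y by auto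
  have "y \<otimes> v \<in> ?T"
  proof (rule ideal_closed_of_regular_approximation[OF T])
    show "y \<otimes> v \<in> carrier Q" using yc uc by simp
    fix z assume z: "z \<in> reg"
    define i where "i = inv z"
    have zc: "z \<in> carrier Q" "i \<in> carrier Q" "z \<otimes> i = \<one>" using z by (auto simp: i_def)
    have uic: "u \<otimes> i \<in> carrier Q" using uc zc by simp
    note F = regular_fractional_span2[OF uic zero_closed]
    have "(y \<otimes> v) \<otimes> i \<in> span2 (u \<otimes> i) \<zero>"
    proof (rule regular_fractional_stable_reflexive(2)[OF F(1)])
      fix x assume x: "x \<in> colon Q K (span2 (u \<otimes> i) \<zero>)"
      have xc: "x \<in> carrier Q" using colonD(1)[OF x] .
      have t: "x \<otimes> (u \<otimes> i) \<in> K" using colonD(2)[OF x F(3)] .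
      have "x \<otimes> (u \<otimes> i) = u \<otimes> (x \<otimes> i)" using xc uc zc by (simp add: m_ac)
      then have "x \<otimes> (u \<otimes> i) \<in> ?T" using xc zc by blast
      then obtain k where k: "k \<in> K" "y \<otimes> (x \<otimes> (u \<otimes> i)) = u \<otimes> k" using clear t by blast
      have kc: "k \<in> carrier Q" using k K_closed by auto
      let ?r = "(y \<otimes> x) \<otimes> i \<ominus> k"
      have "?r \<otimes> u = y \<otimes> (x \<otimes> (u \<otimes> i)) \<ominus> u \<otimes> k" using yc(1) xc zc(1,2) kc uc by algebra
      also have "\<dots> = \<zero>" unfolding k(2) using uc kc by (simp add: a_minus_def r_neg)
      finally have "?r \<otimes> v = \<zero>" using ann yc xc zc kc by simp
      moreover have "((y \<otimes> v) \<otimes> i) \<otimes> x = ?r \<otimes> v \<oplus> k \<otimes> v" using yc(1) xc zc(1,2) kc uc by algebra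
      ultimately have "((y \<otimes> v) \<otimes> i) \<otimes> x = k \<otimes> v" using kc uc by simp
      then show "((y \<otimes> v) \<otimes> i) \<otimes> x \<in> K" using k u K_simps by simp
    qed (use yc uc zc in simp)
    then obtain r s t where h: "r \<in> K" "s \<in> K" "t \<in> K" "(y \<otimes> v) \<otimes> i = r \<oplus> (u \<otimes> i) \<otimes> s \<oplus> \<zero> \<otimes> t"
      unfolding span2_iff by auto
    have c: "r \<in> carrier Q" "s \<in> carrier Q" "t \<in> carrier Q" using h K_closed by auto
    have "y \<otimes> v = (z \<otimes> i) \<otimes> (y \<otimes> v)" unfolding zc(3) using yc uc by simp
    also have "\<dots> = z \<otimes> ((y \<otimes> v) \<otimes> i)" using zc(1,2) yc(1) uc by (simp add: m_ac)
    also have "\<dots> = z \<otimes> r \<oplus> u \<otimes> ((z \<otimes> i) \<otimes> s)" unfolding h(4) using c zc(1,2) uc by algebra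
    also have "\<dots> = z \<otimes> r \<oplus> u \<otimes> s" unfolding zc(3) using c by simp
    finally have "y \<otimes> v \<ominus> z \<otimes> r = u \<otimes> s" using c zc(1) uc by (simp, algebra)
    then show "\<exists>a\<in>K. y \<otimes> v \<ominus> z \<otimes> a \<in> ?T" using h(1) c by blast
  qed
  then obtain q where q: "q \<in> carrier Q" "y \<otimes> v = u \<otimes> q" by auto
  have "v = inv y \<otimes> (y \<otimes> v)" using yc uc by (simp add: m_assoc[symmetric])
  also have "\<dots> = u \<otimes> (inv y \<otimes> q)" unfolding q(2) using yc uc q by (simp add: m_ac)
  finally show ?thesis using yc q by blast
qed

text \<open>
  Choose \<open>w \<in> I\<close> such that \<open>w Q\<close> is maximal. If \<open>v \<in> I\<close> is not in \<open>w Q\<close>, then some \<open>r\<close> kills \<open>w\<close> but not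
  \<open>v\<close>. On the support of \<open>r\<close> the element \<open>w\<close> vanishes, so that \<open>v\<close> vanishes there too by maximality; hence
  \<open>r\<close> may be taken with square zero. Since square-zero elements multiply to zero, \<open>r\<close> acts nontrivially on
  the factor where \<open>v\<close> is a unit. There \<open>w\<close> must be a unit too, since otherwise it could be replaced by
  \<open>v\<close>, and this contradicts \<open>r w = 0\<close>.
\<close>

lemma generator_over_fractions:
  assumes I: "submod K I" "I \<subseteq> K"
  shows "\<exists>w\<in>I. \<forall>v\<in>I. \<exists>q\<in>carrier Q. v = w \<otimes> q"
proof -
  define P where "P w = (\<lambda>q. w \<otimes> q) ` carrier Q" for w
  have Psub: "submod (carrier Q) (P w)" if "w \<in> carrier Q" for w
    unfolding P_def using that by (intro submod_multiples submod_self carrier_is_subring) auto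
  have PI: "w \<otimes> q \<in> P w" if "q \<in> carrier Q" for w q using that by (auto simp: P_def)
  have Ic: "x \<in> carrier Q" if "x \<in> I" for x using submodD(2)[OF I(1) that] .
  have "\<exists>X\<in>(\<lambda>w. P w \<inter> K) ` I. \<forall>Y\<in>(\<lambda>w. P w \<inter> K) ` I. X \<subseteq> Y \<longrightarrow> Y = X"
  proof (rule noetherian)
    show "(\<lambda>w. P w \<inter> K) ` I \<noteq> {}" using submodD(3)[OF I(1)] by blast
    fix X assume "X \<in> (\<lambda>w. P w \<inter> K) ` I"
    then show "submod K X \<and> X \<subseteq> K"
      using submod_inter[OF submod_mono[OF Psub K_carrier] submod_K] Ic by auto
  qed
  then obtain w where w: "w \<in> I" and max: "\<And>w'. \<lbrakk>w' \<in> I; P w \<inter> K \<subseteq> P w' \<inter> K\<rbrakk> \<Longrightarrow> P w' \<inter> K = P w \<inter> K" by auto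
  have wc: "w \<in> carrier Q" using Ic w .
  have "v \<in> P w" if v: "v \<in> I" for v
  proof (rule ccontr)
    assume notin: "v \<notin> P w"
    have vc: "v \<in> carrier Q" using Ic v .
    \<comment> \<open>multiplying with a denominator, maximality extends from elements of \<open>I\<close> to elements of \<open>I Q\<close>\<close>
    have maxQ: "w' \<in> P w" if x: "x \<in> carrier Q" "y \<in> carrier Q" "w' = x \<otimes> w \<oplus> y \<otimes> v" "c \<in> carrier Q" "w = w' \<otimes> c" for w' x y c
    proof -
      obtain d where d: "d \<in> reg" "d \<otimes> x \<in> K" "d \<otimes> y \<in> K" using common_denominator[OF x(1,2)] by auto
      have dc: "d \<in> carrier Q" "inv d \<in> carrier Q" "inv d \<otimes> d = \<one>" using d by auto
      have w'c: "w' \<in> carrier Q" unfolding x(3) using x(1,2) wc vc by simp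
      have "d \<otimes> w' = (d \<otimes> x) \<otimes> w \<oplus> (d \<otimes> y) \<otimes> v" unfolding x(3) using dc(1) x(1,2) wc vc by algebra
      then have dw: "d \<otimes> w' \<in> I" using submodD(4,5)[OF I(1)] d(2,3) w v by simp
      have "P w \<subseteq> P (d \<otimes> w')"
      proof
        fix p assume "p \<in> P w"
        then obtain q where q: "q \<in> carrier Q" "p = w \<otimes> q" by (auto simp: P_def)
        have "w' \<otimes> c \<otimes> q = p" using q(2) x(5) by simp
        then have "p = (inv d \<otimes> d) \<otimes> (w' \<otimes> c \<otimes> q)" using dc(3) w'c x(4) q(1) by auto
        also have "\<dots> = (d \<otimes> w') \<otimes> (inv d \<otimes> (c \<otimes> q))" using dc(1,2) w'c x(4) q(1) by (simp add: m_ac)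
        finally show "p \<in> P (d \<otimes> w')" using dc(2) q(1) x(4) by (simp add: PI)
      qed
      then have "P (d \<otimes> w') \<inter> K = P w \<inter> K" using max[OF dw] by blast
      moreover have "d \<otimes> w' \<in> P (d \<otimes> w') \<inter> K" using PI[of \<one> "d \<otimes> w'"] dc w'c dw I(2) by auto
      ultimately have "d \<otimes> w' \<in> P w" by blast
      then have "inv d \<otimes> (d \<otimes> w') \<in> P w" by (rule submodD(5)[OF Psub[OF wc] dc(2)])
      then show ?thesis using dc w'c by (simp add: m_assoc[symmetric])
    qed
    obtain r where r: "r \<in> carrier Q" "r \<otimes> w = \<zero>" "r \<otimes> v \<noteq> \<zero>"
      using double_annihilator[of w v] w v I(2) notin unfolding P_def by blast
    obtain e q where e: "e \<in> carrier Q" "q \<in> carrier Q" "e = r \<otimes> q" "e \<otimes> e = e" "(r \<otimes> r) \<otimes> e = r \<otimes> r"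
      by (rule support_idempotent[OF r(1)])
    have "e \<otimes> w = q \<otimes> (r \<otimes> w)" unfolding e(3) using r(1) e(2) wc by (simp add: m_ac)
    then have ew: "e \<otimes> w = \<zero>" using r(2) e(2) by simp
    have "w \<oplus> e \<otimes> v \<in> P w"
    proof (rule maxQ[of \<one> e _ "\<one> \<ominus> e"])
      have "(w \<oplus> e \<otimes> v) \<otimes> (\<one> \<ominus> e) = w \<ominus> e \<otimes> w \<oplus> e \<otimes> v \<ominus> (e \<otimes> e) \<otimes> v"
        using wc vc e(1) by algebra
      also have "\<dots> = w" unfolding ew e(4) using wc vc e(1) by algebra
      finally show "w = (w \<oplus> e \<otimes> v) \<otimes> (\<one> \<ominus> e)" by simp
    qed (use e wc in auto)
    then obtain c where c: "c \<in> carrier Q" "w \<oplus> e \<otimes> v = w \<otimes> c" by (auto simp: P_def)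
    have "e \<otimes> v = e \<otimes> (w \<oplus> e \<otimes> v)" using wc vc e(1) ew by (simp add: r_distr m_assoc[symmetric] e(4))
    also have "\<dots> = (e \<otimes> w) \<otimes> c" unfolding c(2) using e(1) wc c by (simp add: m_assoc)
    also have "\<dots> = \<zero>" unfolding ew using c by simp
    finally have ev: "e \<otimes> v = \<zero>" .
    define r' where "r' = (\<one> \<ominus> e) \<otimes> r"
    have r'c: "r' \<in> carrier Q" using r e by (simp add: r'_def)
    have "r' \<otimes> w = (\<one> \<ominus> e) \<otimes> (r \<otimes> w)" unfolding r'_def using r(1) e(1) wc by (simp add: m_assoc)
    then have r'w: "r' \<otimes> w = \<zero>" using r(2) e(1) by simp
    have "r' \<otimes> v = r \<otimes> v \<ominus> r \<otimes> (e \<otimes> v)" unfolding r'_def using r(1) e(1) vc by algebra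
    then have r'v: "r' \<otimes> v \<noteq> \<zero>" using r(1,3) vc unfolding ev by (simp add: a_minus_def)
    have "r' \<otimes> r' = (\<one> \<ominus> e) \<otimes> (r \<otimes> r \<ominus> (r \<otimes> r) \<otimes> e)" unfolding r'_def using r(1) e(1) by algebra
    then have r'r': "r' \<otimes> r' = \<zero>" unfolding e(5) using r(1) e(1) by (simp add: a_minus_def r_neg)
    obtain f p where f: "f \<in> carrier Q" "p \<in> carrier Q" "f = v \<otimes> p" "f \<otimes> f = f" "(v \<otimes> v) \<otimes> f = v \<otimes> v"
      by (rule support_idempotent[OF vc])
    obtain h s where h: "h \<in> carrier Q" "s \<in> carrier Q" "h = w \<otimes> s" "h \<otimes> h = h" "(w \<otimes> w) \<otimes> h = w \<otimes> w"
      by (rule support_idempotent[OF wc])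
    define v' where "v' = (\<one> \<ominus> f) \<otimes> v"
    have v'c: "v' \<in> carrier Q" using vc f by (simp add: v'_def)
    have "v' \<otimes> v' = (\<one> \<ominus> f) \<otimes> (v \<otimes> v \<ominus> (v \<otimes> v) \<otimes> f)" unfolding v'_def using vc f(1) by algebra
    then have v'v': "v' \<otimes> v' = \<zero>" unfolding f(5) using vc f(1) by (simp add: a_minus_def r_neg)
    have "r' \<otimes> v' = \<zero>" by (rule square_zero_product[OF r'c v'c r'r' v'v'])
    moreover have "r' \<otimes> v = r' \<otimes> v' \<oplus> (r' \<otimes> f) \<otimes> v" unfolding v'_def using r'c vc f(1) by algebra
    ultimately have r'f: "r' \<otimes> f \<noteq> \<zero>" using r'v vc by auto
    \<comment> \<open>\<open>g\<close> cuts out the factor where \<open>v\<close> is a unit and \<open>w\<close> has square zero; there \<open>w\<close> is exchanged for \<open>v\<close>\<close>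
    define g where "g = f \<otimes> (\<one> \<ominus> h)"
    have gc: "g \<in> carrier Q" using f h by (simp add: g_def)
    have fg: "g = f \<otimes> g" unfolding g_def using f(1,4) h(1) by (simp add: m_assoc[symmetric])
    have "g \<otimes> g = (f \<otimes> f) \<otimes> (\<one> \<ominus> h \<ominus> h \<oplus> h \<otimes> h)" unfolding g_def using f(1) h(1) by algebra
    also have "\<dots> = g" unfolding g_def f(4) h(4) using f(1) h(1) by algebra
    finally have gg: "g \<otimes> g = g" .
    have gvp: "g \<otimes> (v \<otimes> p) = g" using fg f(3) gc f(1) by (simp add: m_comm)
    define n where "n = \<one> \<ominus> g"
    have nc: "n \<in> carrier Q" using gc by (simp add: n_def)
    have "n \<otimes> g = g \<ominus> g \<otimes> g" unfolding n_def using gc by algebra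
    then have ng: "n \<otimes> g = \<zero>" unfolding gg using gc by (simp add: a_minus_def r_neg)
    have "n \<otimes> n = n \<ominus> n \<otimes> g" unfolding n_def using gc by algebra
    then have nn: "n \<otimes> n = n" unfolding ng using nc by (simp add: a_minus_def)
    have n1: "n \<oplus> g = \<one>" unfolding n_def using gc by algebra
    let ?w = "n \<otimes> w \<oplus> g \<otimes> v"
    have "?w \<in> P w"
    proof (rule maxQ[of n g _ "n \<oplus> (g \<otimes> p) \<otimes> w"])
      have "?w \<otimes> (n \<oplus> (g \<otimes> p) \<otimes> w)
          = (n \<otimes> n) \<otimes> w \<oplus> (n \<otimes> g) \<otimes> (v \<oplus> (w \<otimes> p) \<otimes> w) \<oplus> (g \<otimes> (g \<otimes> (v \<otimes> p))) \<otimes> w"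
        using gc nc wc vc f(2) by (simp add: l_distr r_distr m_ac a_ac)
      also have "\<dots> = (n \<oplus> g) \<otimes> w" unfolding gg gvp nn ng using gc nc wc vc f(2) by (simp add: l_distr)
      also have "\<dots> = w" unfolding n1 using wc by simp
      finally show "w = ?w \<otimes> (n \<oplus> (g \<otimes> p) \<otimes> w)" by simp
    qed (use gc nc wc f in auto)
    then obtain b where b: "b \<in> carrier Q" "?w = w \<otimes> b" by (auto simp: P_def)
    have "g \<otimes> ?w = (n \<otimes> g) \<otimes> w \<oplus> (g \<otimes> g) \<otimes> v" using gc nc wc vc by (simp add: r_distr m_ac)
    also have "\<dots> = g \<otimes> v" unfolding gg ng using gc wc vc by simp
    finally have gv: "g \<otimes> v = (g \<otimes> w) \<otimes> b" unfolding b(2) using gc wc b(1) by (simp add: m_assoc)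
    have "g = (g \<otimes> v) \<otimes> p" using gvp gc vc f(2) by (simp add: m_assoc)
    also have "\<dots> = (g \<otimes> w) \<otimes> (b \<otimes> p)" unfolding gv using gc wc b f(2) by (simp add: m_assoc)
    finally have gw: "g = (g \<otimes> w) \<otimes> (b \<otimes> p)" .
    have "(g \<otimes> w) \<otimes> (g \<otimes> w) = (f \<otimes> g) \<otimes> (w \<otimes> w \<ominus> (w \<otimes> w) \<otimes> h)"
      unfolding g_def using f(1) h(1) wc by algebra
    then have gw0: "(g \<otimes> w) \<otimes> (g \<otimes> w) = \<zero>" unfolding h(5) using f(1) gc wc by (simp add: a_minus_def r_neg)
    have "g = g \<otimes> g" using gg by simp
    also have "\<dots> = ((g \<otimes> w) \<otimes> (b \<otimes> p)) \<otimes> ((g \<otimes> w) \<otimes> (b \<otimes> p))" using gw by simp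
    also have "\<dots> = ((g \<otimes> w) \<otimes> (g \<otimes> w)) \<otimes> ((b \<otimes> p) \<otimes> (b \<otimes> p))" using gc wc b f(2) by (simp add: m_ac)
    also have "\<dots> = \<zero>" unfolding gw0 using b f(2) by simp
    finally have g0: "g = \<zero>" .
    have "f = g \<oplus> f \<otimes> h" unfolding g_def using f(1) h(1) by algebra
    then have "f = f \<otimes> (w \<otimes> s)" unfolding g0 using f(1) h by simp
    then have "r' \<otimes> f = (r' \<otimes> w) \<otimes> (f \<otimes> s)" using r'c f(1) wc h(2) by (metis m_assoc m_comm m_closed)
    then show False using r'f r'w f(1) h(2) by simp
  qed
  then show ?thesis using w unfolding P_def by blast
qed

text \<open>
  The full preimage of \<open>I\<close> under multiplication by \<open>u\<close> contains the annihilator of \<open>u\<close> in \<open>Q\<close> and is in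
  general not a fractional ideal. Bounding denominators by an element \<open>y\<close> with \<open>y I \<subseteq> u K\<close> repairs this
  and keeps the image.
\<close>

lemma ideal_eq_multiple_of_regular_fractional:
  assumes I: "submod K I" "I \<subseteq> K"
  shows "\<exists>u\<in>I. \<exists>G. regular_fractional G \<and> I = (\<lambda>g. u \<otimes> g) ` G"
proof -
  obtain u where u: "u \<in> I" and gen: "\<And>v. v \<in> I \<Longrightarrow> \<exists>q\<in>carrier Q. v = u \<otimes> q"
    using generator_over_fractions[OF I] by auto
  have uK: "u \<in> K" and uc: "u \<in> carrier Q" using u I K_closed by auto
  obtain y where y: "y \<in> reg" and clear: "\<And>i. i \<in> I \<Longrightarrow> \<exists>k\<in>K. y \<otimes> i = u \<otimes> k"
    using clear_denominators[OF I uK gen] by auto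
  have yc: "y \<in> carrier Q" "inv y \<in> carrier Q" "inv y \<otimes> y = \<one>" "y \<otimes> inv y = \<one>" using y by auto
  let ?G = "{x \<in> carrier Q. y \<otimes> x \<in> K} \<inter> {x \<in> carrier Q. u \<otimes> x \<in> I}"
  have "regular_fractional ?G" unfolding regular_fractional_def
  proof (intro conjI bexI[OF _ y] ballI)
    show "submod K ?G" by (intro submod_inter submod_vimage submod_K I K_carrier uc yc)
    have "\<one> \<in> ?G" using y u yc uc by simp
    then show "?G \<inter> Units Q \<noteq> {}" by blast
  qed auto
  moreover have "I = (\<lambda>g. u \<otimes> g) ` ?G"
  proof
    show "I \<subseteq> (\<lambda>g. u \<otimes> g) ` ?G"
    proof
      fix i assume i: "i \<in> I"
      then obtain k where k: "k \<in> K" "y \<otimes> i = u \<otimes> k" using clear by auto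
      have kc: "k \<in> carrier Q" "i \<in> carrier Q" using k i I K_closed by auto
      have "i = inv y \<otimes> (y \<otimes> i)" using yc kc by (simp add: m_assoc[symmetric])
      also have "\<dots> = u \<otimes> (inv y \<otimes> k)" unfolding k(2) using uc yc kc by (simp add: m_lcomm)
      finally have eq: "i = u \<otimes> (inv y \<otimes> k)" .
      have "y \<otimes> (inv y \<otimes> k) = k" using yc kc by (simp add: m_assoc[symmetric])
      then have "inv y \<otimes> k \<in> ?G" using eq i k kc yc by simp
      then show "i \<in> (\<lambda>g. u \<otimes> g) ` ?G" using eq by blast
    qed
  qed auto
  ultimately show ?thesis using u by blast
qed

end

section \<open>Endomorphism rings of ideals and dual bases\<close>

locale ideal_endomorphisms = cring R + ideal I R for R (structure) and I
begin

abbreviation E where "E \<equiv> End_ring R (mult_module R I)"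
abbreviation M where "M \<equiv> End_module (mult_module R I)"

lemma E_iff: "f \<in> carrier E \<longleftrightarrow> f \<in> I \<rightarrow>\<^sub>E I \<and> (\<forall>x\<in>I. \<forall>y\<in>I. f (x \<oplus> y) = f x \<oplus> f y) \<and>
    (\<forall>a\<in>carrier R. \<forall>x\<in>I. f (a \<otimes> x) = a \<otimes> f x)"
  by (simp add: End_ring_def lin_maps_def mult_module_def)

lemma E_I:
  assumes "f \<in> extensional I" "\<And>x. x \<in> I \<Longrightarrow> f x \<in> I" "\<And>x y. \<lbrakk>x \<in> I; y \<in> I\<rbrakk> \<Longrightarrow> f (x \<oplus> y) = f x \<oplus> f y"
    "\<And>a x. \<lbrakk>a \<in> carrier R; x \<in> I\<rbrakk> \<Longrightarrow> f (a \<otimes> x) = a \<otimes> f x"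
  shows "f \<in> carrier E"
  using assms by (auto simp: E_iff PiE_def)

lemma E_D:
  assumes "f \<in> carrier E"
  shows "f \<in> extensional I" "x \<in> I \<Longrightarrow> f x \<in> I" "\<lbrakk>x \<in> I; y \<in> I\<rbrakk> \<Longrightarrow> f (x \<oplus> y) = f x \<oplus> f y"
    "\<lbrakk>a \<in> carrier R; x \<in> I\<rbrakk> \<Longrightarrow> f (a \<otimes> x) = a \<otimes> f x"
  using assms by (auto simp: E_iff PiE_def)

lemma E_eqI: "\<lbrakk>f \<in> carrier E; g \<in> carrier E; \<And>x. x \<in> I \<Longrightarrow> f x = g x\<rbrakk> \<Longrightarrow> f = g"
  using E_D(1) by (meson extensionalityI)

lemma E_ops:
  "mult E f g = (\<lambda>x\<in>I. f (g x))" "one E = (\<lambda>x\<in>I. x)" "zero E = (\<lambda>x\<in>I. \<zero>)" "add E f g = (\<lambda>x\<in>I. f x \<oplus> g x)"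
  by (simp_all add: End_ring_def mult_module_def compose_def)

lemma M_ops: "carrier M = I" "zero M = \<zero>" "add M = add R" "smult M f x = f x"
  by (simp_all add: End_module_def mult_module_def)

lemma I_simps: "\<zero> \<in> I" "\<lbrakk>x \<in> I; y \<in> I\<rbrakk> \<Longrightarrow> x \<oplus> y \<in> I" "\<lbrakk>a \<in> carrier R; x \<in> I\<rbrakk> \<Longrightarrow> a \<otimes> x \<in> I"
  "x \<in> I \<Longrightarrow> x \<in> carrier R" "x \<in> I \<Longrightarrow> \<ominus> x \<in> I"
  using additive_subgroup.zero_closed[OF is_additive_subgroup] a_closed I_l_closed Icarr a_inv_closed by auto

lemma E_closed:
  "\<lbrakk>f \<in> carrier E; g \<in> carrier E\<rbrakk> \<Longrightarrow> f \<otimes>\<^bsub>E\<^esub> g \<in> carrier E"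
  "\<one>\<^bsub>E\<^esub> \<in> carrier E" "\<zero>\<^bsub>E\<^esub> \<in> carrier E"
  "\<lbrakk>f \<in> carrier E; g \<in> carrier E\<rbrakk> \<Longrightarrow> f \<oplus>\<^bsub>E\<^esub> g \<in> carrier E"
  by (rule E_I; simp add: E_ops E_D I_simps r_distr a_ac)+

lemma ring_E: "ring E"
proof (rule ringI)
  show "abelian_group E"
  proof (rule abelian_groupI)
    fix f assume f: "f \<in> carrier E"
    let ?g = "\<lambda>x\<in>I. \<ominus> f x"
    have "?g \<in> carrier E"
      by (rule E_I) (use f in \<open>auto simp: E_D I_simps minus_add r_minus\<close>)
    moreover have "?g \<oplus>\<^bsub>E\<^esub> f = \<zero>\<^bsub>E\<^esub>"
      by (rule E_eqI[OF E_closed(4)[OF calculation f] E_closed(3)]) (use f in \<open>simp add: E_ops E_D I_simps l_neg\<close>)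
    ultimately show "\<exists>g\<in>carrier E. g \<oplus>\<^bsub>E\<^esub> f = \<zero>\<^bsub>E\<^esub>" by blast
    show "\<zero>\<^bsub>E\<^esub> \<oplus>\<^bsub>E\<^esub> f = f"
      by (rule E_eqI[OF E_closed(4)[OF E_closed(3) f] f]) (use f in \<open>simp add: E_ops E_D I_simps\<close>)
  next
    fix f g h assume f: "f \<in> carrier E" "g \<in> carrier E" "h \<in> carrier E"
    show "f \<oplus>\<^bsub>E\<^esub> g \<oplus>\<^bsub>E\<^esub> h = f \<oplus>\<^bsub>E\<^esub> (g \<oplus>\<^bsub>E\<^esub> h)"
      by (rule E_eqI) (use f in \<open>simp_all add: E_closed, simp add: E_ops E_D I_simps a_ac\<close>)
  next
    fix f g assume f: "f \<in> carrier E" "g \<in> carrier E"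
    show "f \<oplus>\<^bsub>E\<^esub> g = g \<oplus>\<^bsub>E\<^esub> f"
      by (rule E_eqI) (use f in \<open>simp_all add: E_closed, simp add: E_ops E_D I_simps a_ac\<close>)
  qed (use E_closed in auto)
  show "monoid E"
  proof (rule monoidI)
    fix f g h assume f: "f \<in> carrier E" "g \<in> carrier E" "h \<in> carrier E"
    show "f \<otimes>\<^bsub>E\<^esub> g \<otimes>\<^bsub>E\<^esub> h = f \<otimes>\<^bsub>E\<^esub> (g \<otimes>\<^bsub>E\<^esub> h)"
      by (rule E_eqI) (use f in \<open>simp_all add: E_closed, simp add: E_ops E_D I_simps\<close>)
  next
    fix f assume f: "f \<in> carrier E"
    show "\<one>\<^bsub>E\<^esub> \<otimes>\<^bsub>E\<^esub> f = f"
      by (rule E_eqI) (use f in \<open>simp_all add: E_closed, simp add: E_ops E_D I_simps\<close>)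
    show "f \<otimes>\<^bsub>E\<^esub> \<one>\<^bsub>E\<^esub> = f"
      by (rule E_eqI) (use f in \<open>simp_all add: E_closed, simp add: E_ops E_D I_simps\<close>)
  qed (use E_closed in auto)
next
  fix f g h assume f: "f \<in> carrier E" "g \<in> carrier E" "h \<in> carrier E"
  show "(f \<oplus>\<^bsub>E\<^esub> g) \<otimes>\<^bsub>E\<^esub> h = f \<otimes>\<^bsub>E\<^esub> h \<oplus>\<^bsub>E\<^esub> g \<otimes>\<^bsub>E\<^esub> h"
    by (rule E_eqI) (use f in \<open>simp_all add: E_closed, simp add: E_ops E_D I_simps\<close>)
  show "h \<otimes>\<^bsub>E\<^esub> (f \<oplus>\<^bsub>E\<^esub> g) = h \<otimes>\<^bsub>E\<^esub> f \<oplus>\<^bsub>E\<^esub> h \<otimes>\<^bsub>E\<^esub> g"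
    by (rule E_eqI) (use f in \<open>simp_all add: E_closed, simp add: E_ops E_D I_simps\<close>)
qed

lemma left_module_M: "left_module E M"
proof -
  have "abelian_group M"
  proof (rule abelian_groupI)
    fix x assume "x \<in> carrier M"
    then have x: "x \<in> I" by (simp add: M_ops)
    show "\<exists>y\<in>carrier M. y \<oplus>\<^bsub>M\<^esub> x = \<zero>\<^bsub>M\<^esub>"
      unfolding M_ops using I_simps(4,5)[OF x] by (intro bexI[of _ "\<ominus> x"]) (auto simp: l_neg)
  qed (auto simp: M_ops I_simps a_ac)
  then show ?thesis
    unfolding left_module_def left_module_axioms_def
    using ring_E by (simp add: M_ops E_D E_ops)
qed

text \<open>
  The left linear maps from \<open>I\<close> to its endomorphism ring. Values outside \<open>I\<close> are left open, so these maps
  can be added without restricting them.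
\<close>

definition Dual :: "('a \<Rightarrow> 'a \<Rightarrow> 'a) set" where
  "Dual = {h. (\<forall>x\<in>I. h x \<in> carrier E) \<and> (\<forall>x\<in>I. \<forall>y\<in>I. h (x \<oplus> y) = h x \<oplus>\<^bsub>E\<^esub> h y) \<and>
     (\<forall>\<phi>\<in>carrier E. \<forall>x\<in>I. h (\<phi> x) = \<phi> \<otimes>\<^bsub>E\<^esub> h x)}"

lemma DualD:
  assumes "h \<in> Dual"
  shows "x \<in> I \<Longrightarrow> h x \<in> carrier E" "\<lbrakk>x \<in> I; y \<in> I\<rbrakk> \<Longrightarrow> h (x \<oplus> y) = h x \<oplus>\<^bsub>E\<^esub> h y"
    "\<lbrakk>\<phi> \<in> carrier E; x \<in> I\<rbrakk> \<Longrightarrow> h (\<phi> x) = \<phi> \<otimes>\<^bsub>E\<^esub> h x"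
  using assms by (auto simp: Dual_def)

lemma Dual_eval: "\<lbrakk>h \<in> Dual; x \<in> I; b \<in> I\<rbrakk> \<Longrightarrow> h x b \<in> I"
  using DualD(1) E_D(2) by blast

lemma Dual_zero: "(\<lambda>x. \<zero>\<^bsub>E\<^esub>) \<in> Dual"
proof -
  interpret E: ring E by (rule ring_E)
  show ?thesis using E.r_null by (simp add: Dual_def)
qed

lemma Dual_add:
  assumes "h \<in> Dual" "k \<in> Dual"
  shows "(\<lambda>x. h x \<oplus>\<^bsub>E\<^esub> k x) \<in> Dual"
proof -
  interpret E: ring E by (rule ring_E)
  show ?thesis using DualD[OF assms(1)] DualD[OF assms(2)] unfolding Dual_def
    by (auto simp: E.r_distr E.a_ac)
qed

text \<open>
  The endomorphisms \<open>x \<mapsto> \<Sum> h\<^sub>b(x)(b)\<close>, with \<open>h\<^sub>b\<close> left linear from \<open>I\<close> to its endomorphism ring and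
  \<open>b\<close> in a finite subset of \<open>I\<close>. The identity is of this form if and only if \<open>I\<close> has a dual basis. The sums are
  indexed by elements of \<open>I\<close>, because the free modules in the definition of projectivity have subsets of
  the module as bases.
\<close>

definition dual_trace :: "('a \<Rightarrow> 'a) \<Rightarrow> bool" where
  "dual_trace g \<longleftrightarrow> (\<exists>B h. finite B \<and> B \<subseteq> I \<and> (\<forall>b\<in>B. h b \<in> Dual) \<and> (\<forall>x\<in>I. g x = (\<Oplus>b\<in>B. h b x b)))"

lemma dual_trace_single:
  assumes "b \<in> I" "h \<in> Dual" "\<And>x. x \<in> I \<Longrightarrow> g x = h x b"
  shows "dual_trace g"
  unfolding dual_trace_def
proof (intro exI conjI ballI)
  show "g x = (\<Oplus>b\<in>{b}. (\<lambda>_. h) b x b)" if "x \<in> I" for x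
    using assms that Dual_eval I_simps by simp
qed (use assms in auto)

lemma dual_trace_add:
  assumes "dual_trace g" "dual_trace k" "\<And>x. x \<in> I \<Longrightarrow> f x = g x \<oplus> k x"
  shows "dual_trace f"
proof -
  obtain B h where B: "finite B" "B \<subseteq> I" "\<And>b. b \<in> B \<Longrightarrow> h b \<in> Dual" "\<And>x. x \<in> I \<Longrightarrow> g x = (\<Oplus>b\<in>B. h b x b)"
    using assms(1) unfolding dual_trace_def by blast
  obtain C l where C: "finite C" "C \<subseteq> I" "\<And>b. b \<in> C \<Longrightarrow> l b \<in> Dual" "\<And>x. x \<in> I \<Longrightarrow> k x = (\<Oplus>b\<in>C. l b x b)"
    using assms(2) unfolding dual_trace_def by blast
  define h' where "h' b = (if b \<in> B then h b else (\<lambda>x. \<zero>\<^bsub>E\<^esub>))" for b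
  define l' where "l' b = (if b \<in> C then l b else (\<lambda>x. \<zero>\<^bsub>E\<^esub>))" for b
  have h': "h' b \<in> Dual" and l': "l' b \<in> Dual" for b using B C Dual_zero by (auto simp: h'_def l'_def)
  let ?D = "B \<union> C"
  show ?thesis unfolding dual_trace_def
  proof (intro exI conjI ballI)
    show "finite ?D" "?D \<subseteq> I" using B C by auto
    show "(\<lambda>x. h' b x \<oplus>\<^bsub>E\<^esub> l' b x) \<in> Dual" for b using Dual_add h' l' by blast
    fix x assume x: "x \<in> I"
    have ev: "(h' b x \<oplus>\<^bsub>E\<^esub> l' b x) b = h' b x b \<oplus> l' b x b" if "b \<in> ?D" for b
      using that B C by (auto simp: E_ops)
    have c: "h' b x b \<in> carrier R" "l' b x b \<in> carrier R" if "b \<in> ?D" for b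
    proof -
      have "b \<in> I" using that B(2) C(2) by auto
      then show "h' b x b \<in> carrier R" "l' b x b \<in> carrier R"
        using Dual_eval[OF h' x] Dual_eval[OF l' x] I_simps(4) by auto
    qed
    have "(\<Oplus>b\<in>?D. (h' b x \<oplus>\<^bsub>E\<^esub> l' b x) b) = (\<Oplus>b\<in>?D. h' b x b \<oplus> l' b x b)"
      by (rule finsum_cong') (use ev c in auto)
    also have "\<dots> = (\<Oplus>b\<in>?D. h' b x b) \<oplus> (\<Oplus>b\<in>?D. l' b x b)"
      by (rule finsum_addf) (use c in auto)
    also have "(\<Oplus>b\<in>?D. h' b x b) = (\<Oplus>b\<in>B. h b x b)"
    proof (rule add.finprod_mono_neutral_cong_right)
      show "h' i x i = \<zero>" if "i \<in> ?D - B" for i using that C by (auto simp: h'_def E_ops)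
      show "(\<lambda>b. h' b x b) \<in> ?D \<rightarrow> carrier R" using c by blast
    qed (use B C c in \<open>auto simp: h'_def\<close>)
    also have "(\<Oplus>b\<in>?D. l' b x b) = (\<Oplus>b\<in>C. l b x b)"
    proof (rule add.finprod_mono_neutral_cong_right)
      show "l' i x i = \<zero>" if "i \<in> ?D - C" for i using that B by (auto simp: l'_def E_ops)
      show "(\<lambda>b. l' b x b) \<in> ?D \<rightarrow> carrier R" using c by blast
    qed (use B C c in \<open>auto simp: l'_def\<close>)
    finally show "f x = (\<Oplus>b\<in>?D. (h' b x \<oplus>\<^bsub>E\<^esub> l' b x) b)" using assms(3)[OF x] B(4)[OF x] C(4)[OF x] by simp
  qed
qed

lemma finsum_endo:
  assumes "finite B" "\<phi> \<in> carrier E" "\<And>b. b \<in> B \<Longrightarrow> v b \<in> I"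
  shows "(\<Oplus>b\<in>B. v b) \<in> I \<and> \<phi> (\<Oplus>b\<in>B. v b) = (\<Oplus>b\<in>B. \<phi> (v b))"
  using assms(1,3)
proof (induct B)
  case empty
  have "\<phi> (\<zero> \<otimes> \<zero>) = \<zero> \<otimes> \<phi> \<zero>" using E_D(4)[OF assms(2)] I_simps by blast
  then show ?case using I_simps E_D(2)[OF assms(2) I_simps(1)] by simp
next
  case (insert b B)
  have c: "v \<in> B \<rightarrow> carrier R" "v b \<in> carrier R" "(\<lambda>b. \<phi> (v b)) \<in> B \<rightarrow> carrier R" "\<phi> (v b) \<in> carrier R"
    using insert(4) E_D(2)[OF assms(2)] I_simps(4) by auto
  show ?case using insert E_D(3)[OF assms(2)] c I_simps by simp
qed

lemma projective_of_dual_trace: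
  assumes "dual_trace (\<lambda>x. x)"
  shows "projective_module E M"
proof -
  interpret E: ring E by (rule ring_E)
  obtain B h where B: "finite B" "B \<subseteq> I" "\<And>b. b \<in> B \<Longrightarrow> h b \<in> Dual" "\<And>x. x \<in> I \<Longrightarrow> x = (\<Oplus>b\<in>B. h b x b)"
    using assms unfolding dual_trace_def by blast
  let ?F = "free_module E B"
  have F: "carrier ?F = (B \<rightarrow>\<^sub>E carrier E)" using B(1) by (auto simp: free_module_def)
  define i where "i = (\<lambda>x\<in>I. \<lambda>b\<in>B. h b x)"
  define p where "p = (\<lambda>v\<in>carrier ?F. \<Oplus>b\<in>B. v b b)"
  have ev: "v b b \<in> I" if "v \<in> carrier ?F" "b \<in> B" for v b
    using that E_D(2) B(2) unfolding F by blast
  have pI: "p v \<in> I" if v: "v \<in> carrier ?F" for v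
    using finsum_endo[OF B(1) E_closed(2), of "\<lambda>b. v b b"] ev[OF v] v by (simp add: p_def)
  have "i \<in> lin_maps E M ?F"
    unfolding lin_maps_def mem_Collect_eq
  proof (intro conjI ballI)
    show "i \<in> carrier M \<rightarrow>\<^sub>E carrier ?F"
      unfolding F M_ops using DualD(1)[OF B(3)] by (auto simp: i_def)
    fix x assume x: "x \<in> carrier M"
    show "i (x \<oplus>\<^bsub>M\<^esub> y) = i x \<oplus>\<^bsub>?F\<^esub> i y" if "y \<in> carrier M" for y
      using x that DualD(2)[OF B(3)] I_simps(2) by (auto simp: i_def free_module_def M_ops intro!: restrict_ext)
    show "i (a \<odot>\<^bsub>M\<^esub> x) = a \<odot>\<^bsub>?F\<^esub> i x" if "a \<in> carrier E" for a
      using x that DualD(3)[OF B(3)] E_D(2)[OF that] by (auto simp: i_def free_module_def M_ops intro!: restrict_ext)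
  qed
  moreover have "p \<in> lin_maps E ?F M"
    unfolding lin_maps_def mem_Collect_eq
  proof (intro conjI ballI)
    show "p \<in> carrier ?F \<rightarrow>\<^sub>E carrier M" unfolding M_ops using pI by (auto simp: p_def)
    fix v assume v: "v \<in> carrier ?F"
    show "p (v \<oplus>\<^bsub>?F\<^esub> w) = p v \<oplus>\<^bsub>M\<^esub> p w" if w: "w \<in> carrier ?F" for w
    proof -
      have vw: "v \<oplus>\<^bsub>?F\<^esub> w \<in> carrier ?F" using v w E_closed(4) unfolding F by (auto simp: free_module_def)
      have "(\<Oplus>b\<in>B. (v \<oplus>\<^bsub>?F\<^esub> w) b b) = (\<Oplus>b\<in>B. v b b \<oplus> w b b)"
        by (rule finsum_cong') (use ev[OF v] ev[OF w] B(2) I_simps(4) in \<open>auto simp: free_module_def E_ops\<close>)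
      also have "\<dots> = (\<Oplus>b\<in>B. v b b) \<oplus> (\<Oplus>b\<in>B. w b b)"
        by (rule finsum_addf) (use ev[OF v] ev[OF w] I_simps(4) in auto)
      finally show ?thesis using v w vw by (simp add: p_def M_ops)
    qed
    show "p (a \<odot>\<^bsub>?F\<^esub> v) = a \<odot>\<^bsub>M\<^esub> p v" if a: "a \<in> carrier E" for a
    proof -
      have av: "a \<odot>\<^bsub>?F\<^esub> v \<in> carrier ?F" using v a E_closed(1) unfolding F by (auto simp: free_module_def)
      have "(\<Oplus>b\<in>B. (a \<odot>\<^bsub>?F\<^esub> v) b b) = (\<Oplus>b\<in>B. a (v b b))"
        by (rule finsum_cong') (use ev[OF v] E_D(2)[OF a] B(2) I_simps(4) in \<open>auto simp: free_module_def E_ops\<close>)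
      also have "\<dots> = a (\<Oplus>b\<in>B. v b b)" using finsum_endo[OF B(1) a, of "\<lambda>b. v b b"] ev[OF v] by simp
      finally show ?thesis using v av by (simp add: p_def M_ops)
    qed
  qed
  moreover have "p (i x) = x" if x: "x \<in> carrier M" for x
  proof -
    have xI: "x \<in> I" using x by (simp add: M_ops)
    have "i x \<in> carrier ?F" unfolding F using DualD(1)[OF B(3) xI] xI by (auto simp: i_def)
    moreover have "(\<Oplus>b\<in>B. i x b b) = (\<Oplus>b\<in>B. h b x b)"
      by (rule finsum_cong') (use Dual_eval[OF B(3) xI] B(2) I_simps(4) xI in \<open>auto simp: i_def\<close>)
    ultimately show ?thesis using B(4)[OF xI] by (simp add: p_def)
  qed
  moreover have "B \<subseteq> carrier M" using B(2) by (simp add: M_ops)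
  ultimately show ?thesis
    unfolding projective_module_def using left_module_M by blast
qed

end

text \<open>
  A ring of fractions of \<open>R\<close> in which \<open>R\<close> embeds. The ideals of \<open>R\<close> and the subsets of \<open>Q\<close> stay in their
  own types here, since endomorphism rings refer to the ideals of \<open>R\<close>.
\<close>

locale fraction_embedding = R: cring R + Q: cring Q
  for R :: "('a, 'm) ring_scheme" (structure) and Q :: "('q, 'n) ring_scheme" +
  fixes \<iota> :: "'a \<Rightarrow> 'q"
  assumes hom: "\<iota> \<in> ring_hom R Q"
    and inj: "inj_on \<iota> (carrier R)"
    and denom: "q \<in> carrier Q \<Longrightarrow> \<exists>s\<in>carrier R. \<iota> s \<in> Units Q \<and> \<iota> s \<otimes>\<^bsub>Q\<^esub> q \<in> \<iota> ` carrier R"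
begin

abbreviation K where "K \<equiv> \<iota> ` carrier R"

lemma \<iota>_simps:
  "a \<in> carrier R \<Longrightarrow> \<iota> a \<in> carrier Q"
  "\<lbrakk>a \<in> carrier R; b \<in> carrier R\<rbrakk> \<Longrightarrow> \<iota> (a \<oplus> b) = \<iota> a \<oplus>\<^bsub>Q\<^esub> \<iota> b"
  "\<lbrakk>a \<in> carrier R; b \<in> carrier R\<rbrakk> \<Longrightarrow> \<iota> (a \<otimes> b) = \<iota> a \<otimes>\<^bsub>Q\<^esub> \<iota> b"
  "\<iota> \<one> = \<one>\<^bsub>Q\<^esub>" "\<iota> \<zero> = \<zero>\<^bsub>Q\<^esub>"
  "a \<in> carrier R \<Longrightarrow> \<iota> (\<ominus> a) = \<ominus>\<^bsub>Q\<^esub> \<iota> a"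
proof -
  interpret h: ring_hom_ring R Q \<iota>
    using hom by unfold_locales (auto simp: ring_hom_def)
  show "a \<in> carrier R \<Longrightarrow> \<iota> a \<in> carrier Q"
  "\<lbrakk>a \<in> carrier R; b \<in> carrier R\<rbrakk> \<Longrightarrow> \<iota> (a \<oplus> b) = \<iota> a \<oplus>\<^bsub>Q\<^esub> \<iota> b"
  "\<lbrakk>a \<in> carrier R; b \<in> carrier R\<rbrakk> \<Longrightarrow> \<iota> (a \<otimes> b) = \<iota> a \<otimes>\<^bsub>Q\<^esub> \<iota> b"
  "\<iota> \<one> = \<one>\<^bsub>Q\<^esub>" "\<iota> \<zero> = \<zero>\<^bsub>Q\<^esub>"
  "a \<in> carrier R \<Longrightarrow> \<iota> (\<ominus> a) = \<ominus>\<^bsub>Q\<^esub> \<iota> a" by simp_all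
qed

lemma \<iota>_eq: "\<lbrakk>a \<in> carrier R; b \<in> carrier R\<rbrakk> \<Longrightarrow> \<iota> a = \<iota> b \<longleftrightarrow> a = b"
  using inj by (auto simp: inj_on_def)

text \<open>
  Endomorphisms are linear over \<open>R\<close>, and denominators can be cancelled in \<open>Q\<close>.
\<close>

lemma endomorphism_commutes_with_fractions:
  assumes I: "ideal I R" and f: "f \<in> carrier (End_ring R (mult_module R I))"
    and q: "q \<in> carrier Q" and x: "x \<in> I" and w: "w \<in> I" "\<iota> w = q \<otimes>\<^bsub>Q\<^esub> \<iota> x"
  shows "\<iota> (f w) = q \<otimes>\<^bsub>Q\<^esub> \<iota> (f x)"
proof -
  interpret ideal_endomorphisms R I using I R.cring_axioms by (simp add: ideal_endomorphisms_def)
  obtain s r where s: "s \<in> carrier R" "\<iota> s \<in> Units Q" "r \<in> carrier R" "\<iota> s \<otimes>\<^bsub>Q\<^esub> q = \<iota> r"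
    using denom[OF q] by auto
  have c: "w \<in> carrier R" "x \<in> carrier R" "f w \<in> carrier R" "f x \<in> carrier R"
    using w x E_D(2)[OF f] I_simps(4) by auto
  have "\<iota> (s \<otimes> w) = \<iota> (r \<otimes> x)"
    using s c q by (simp add: \<iota>_simps w(2) s(4)[symmetric] Q.m_assoc)
  then have "s \<otimes> w = r \<otimes> x" using \<iota>_eq s c by simp
  then have "s \<otimes> f w = r \<otimes> f x" using E_D(4)[OF f] s w x by metis
  then have "\<iota> s \<otimes>\<^bsub>Q\<^esub> \<iota> (f w) = \<iota> r \<otimes>\<^bsub>Q\<^esub> \<iota> (f x)" using s c \<iota>_simps(3) by metis
  also have "\<dots> = \<iota> s \<otimes>\<^bsub>Q\<^esub> (q \<otimes>\<^bsub>Q\<^esub> \<iota> (f x))" unfolding s(4)[symmetric] using s(1) c q \<iota>_simps(1) by (simp add: Q.m_assoc)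
  finally show ?thesis using s(1,2) c q \<iota>_simps(1) by (simp add: Q.Units_l_cancel)
qed

text \<open>
  For \<open>y \<in> (G : G) : G\<close> the pairing \<open>(u g, u h) \<mapsto> u y g h\<close> has values in \<open>u G = I\<close>. It is multiplication
  of \<open>u h\<close> by the fraction \<open>y g\<close> and, symmetrically, of \<open>u g\<close> by the fraction \<open>y h\<close>. The first description
  makes it an endomorphism in the second variable, the second one makes it linear over the endomorphism ring
  in the first. Evaluating at \<open>u g\<^sub>j\<close> multiplies by \<open>g\<^sub>j y\<^sub>j\<close>, and these products add up to \<open>1\<close>.
\<close>

lemma projective_of_fractional_factor:
  assumes I: "ideal I R" and u: "u \<in> carrier Q" and G: "Q.submod K G" and IG: "\<iota> ` I = (\<lambda>g. u \<otimes>\<^bsub>Q\<^esub> g) ` G"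
    and one: "\<one>\<^bsub>Q\<^esub> \<in> G \<cdot>\<^bsub>Q\<^esub> colon Q (colon Q G G) G"
  shows "projective_module (End_ring R (mult_module R I)) (End_module (mult_module R I))"
proof -
  interpret ideal_endomorphisms R I using I R.cring_axioms by (simp add: ideal_endomorphisms_def)
  let ?A = "colon Q G G" let ?Y = "colon Q ?A G"
  define \<psi> where "\<psi> = inv_into I \<iota>"
  have injI: "inj_on \<iota> I" using inj I_simps(4) by (meson inj_on_subset subsetI)
  have \<psi>: "\<psi> q \<in> I" "\<iota> (\<psi> q) = q" if "q \<in> \<iota> ` I" for q
    using that by (auto simp: \<psi>_def inv_into_into f_inv_into_f)
  have \<psi>\<iota>: "\<psi> (\<iota> x) = x" if "x \<in> I" for x using that injI by (simp add: \<psi>_def)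
  have eqI: "x = y" if "x \<in> I" "y \<in> I" "\<iota> x = \<iota> y" for x y using injI that by (simp add: inj_on_def)
  have Gc: "g \<in> carrier Q" if "g \<in> G" for g using Q.submodD(2)[OF G that] .
  have Ac: "a \<in> carrier Q" if "a \<in> ?A" for a using that by (rule Q.colonD(1))
  have Yc: "y \<in> carrier Q" if "y \<in> ?Y" for y using that by (rule Q.colonD(1))
  have Ic: "\<iota> x \<in> carrier Q" if "x \<in> I" for x using \<iota>_simps(1)[OF I_simps(4)[OF that]] .
  define h where "h x = (SOME g. g \<in> G \<and> \<iota> x = u \<otimes>\<^bsub>Q\<^esub> g)" for x
  have h: "h x \<in> G \<and> \<iota> x = u \<otimes>\<^bsub>Q\<^esub> h x" if "x \<in> I" for x
    unfolding h_def by (rule someI_ex) (use that IG in blast)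
  have hc: "h x \<in> carrier Q" if "x \<in> I" for x using h[OF that] Gc by blast
  have AI: "a \<otimes>\<^bsub>Q\<^esub> \<iota> x \<in> \<iota> ` I" if "a \<in> ?A" "x \<in> I" for a x
  proof -
    have "a \<otimes>\<^bsub>Q\<^esub> \<iota> x = u \<otimes>\<^bsub>Q\<^esub> (a \<otimes>\<^bsub>Q\<^esub> h x)"
      using h[OF that(2)] hc[OF that(2)] u Ac[OF that(1)] by (simp add: Q.m_lcomm)
    moreover have "a \<otimes>\<^bsub>Q\<^esub> h x \<in> G" using Q.colonD(2)[OF that(1)] h[OF that(2)] by blast
    ultimately show ?thesis using IG by blast
  qed
  have sym: "(y \<otimes>\<^bsub>Q\<^esub> h x) \<otimes>\<^bsub>Q\<^esub> \<iota> z = (y \<otimes>\<^bsub>Q\<^esub> h z) \<otimes>\<^bsub>Q\<^esub> \<iota> x" if "y \<in> carrier Q" "x \<in> I" "z \<in> I" for x y z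
    using h[OF that(2)] h[OF that(3)] hc[OF that(2)] hc[OF that(3)] that(1) u by (simp add: Q.m_ac)
  have yh: "y \<otimes>\<^bsub>Q\<^esub> h x \<in> ?A" if "y \<in> ?Y" "x \<in> I" for x y
    using Q.colonD(2)[OF that(1)] h[OF that(2)] by blast
  define \<beta> where "\<beta> y x = (\<lambda>z\<in>I. \<psi> ((y \<otimes>\<^bsub>Q\<^esub> h x) \<otimes>\<^bsub>Q\<^esub> \<iota> z))" for y x
  have \<beta>: "\<beta> y x z \<in> I" "\<iota> (\<beta> y x z) = (y \<otimes>\<^bsub>Q\<^esub> h x) \<otimes>\<^bsub>Q\<^esub> \<iota> z" if "y \<in> ?Y" "x \<in> I" "z \<in> I" for x y z
    using \<psi>[OF AI[OF yh[OF that(1,2)] that(3)]] that(3) by (simp_all add: \<beta>_def)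
  have \<beta>': "\<iota> (\<beta> y x z) = (y \<otimes>\<^bsub>Q\<^esub> h z) \<otimes>\<^bsub>Q\<^esub> \<iota> x" if "y \<in> ?Y" "x \<in> I" "z \<in> I" for x y z
    using \<beta>(2)[OF that] sym[OF Yc that(2,3)] that(1) by simp
  have \<beta>E: "\<beta> y x \<in> carrier E" if y: "y \<in> ?Y" and x: "x \<in> I" for x y
  proof (rule E_I)
    show "\<beta> y x \<in> extensional I" by (simp add: \<beta>_def)
    show "\<beta> y x z \<in> I" if "z \<in> I" for z using \<beta>(1)[OF y x that] .
    have c: "y \<otimes>\<^bsub>Q\<^esub> h x \<in> carrier Q" using Ac[OF yh[OF y x]] .
    show "\<beta> y x (z \<oplus> w) = \<beta> y x z \<oplus> \<beta> y x w" if zw: "z \<in> I" "w \<in> I" for z w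
      by (rule eqI) (use zw c in \<open>auto simp: I_simps \<iota>_simps \<beta>[OF y x] Q.r_distr\<close>)
    show "\<beta> y x (a \<otimes> z) = a \<otimes> \<beta> y x z" if zw: "a \<in> carrier R" "z \<in> I" for a z
      by (rule eqI) (use zw c in \<open>auto simp: I_simps \<iota>_simps \<beta>[OF y x] Q.m_lcomm\<close>)
  qed
  have \<beta>D: "\<beta> y \<in> Dual" if y: "y \<in> ?Y" for y
    unfolding Dual_def mem_Collect_eq
  proof (intro conjI ballI)
    fix x assume x: "x \<in> I"
    show "\<beta> y x \<in> carrier E" using \<beta>E[OF y x] .
    show "\<beta> y (x \<oplus> w) = \<beta> y x \<oplus>\<^bsub>E\<^esub> \<beta> y w" if w: "w \<in> I" for w
    proof (rule E_eqI[OF \<beta>E[OF y I_simps(2)[OF x w]] E_closed(4)[OF \<beta>E[OF y x] \<beta>E[OF y w]]])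
      fix z assume z: "z \<in> I"
      have c: "y \<otimes>\<^bsub>Q\<^esub> h z \<in> carrier Q" using Ac[OF yh[OF y z]] .
      show "\<beta> y (x \<oplus> w) z = (\<beta> y x \<oplus>\<^bsub>E\<^esub> \<beta> y w) z"
        by (rule eqI) (use x w z c in \<open>auto simp: E_ops I_simps \<iota>_simps \<beta>(1)[OF y] \<beta>'[OF y] Q.r_distr\<close>)
    qed
  next
    fix f x assume f: "f \<in> carrier E" and x: "x \<in> I"
    note fx = E_D(2)[OF f x]
    show "\<beta> y (f x) = f \<otimes>\<^bsub>E\<^esub> \<beta> y x"
    proof (rule E_eqI[OF \<beta>E[OF y fx] E_closed(1)[OF f \<beta>E[OF y x]]])
      fix z assume z: "z \<in> I"
      have c: "y \<otimes>\<^bsub>Q\<^esub> h z \<in> carrier Q" using Ac[OF yh[OF y z]] .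
      have "\<iota> (f (\<beta> y x z)) = (y \<otimes>\<^bsub>Q\<^esub> h z) \<otimes>\<^bsub>Q\<^esub> \<iota> (f x)"
        by (rule endomorphism_commutes_with_fractions[OF I f c x \<beta>(1)[OF y x z] \<beta>'[OF y x z]])
      then show "\<beta> y (f x) z = (f \<otimes>\<^bsub>E\<^esub> \<beta> y x) z"
        using z by (intro eqI) (auto simp: E_ops \<beta>(1)[OF y fx] \<beta>'[OF y fx] E_D(2)[OF f] \<beta>(1)[OF y x])
    qed
  qed
  have "p \<in> carrier Q \<and> (\<forall>x\<in>I. p \<otimes>\<^bsub>Q\<^esub> \<iota> x \<in> \<iota> ` I) \<and> dual_trace (\<lambda>x. \<psi> (p \<otimes>\<^bsub>Q\<^esub> \<iota> x))" if "p \<in> G \<cdot>\<^bsub>Q\<^esub> ?Y" for p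
    using that
  proof induct
    case (prod g y)
    have gy: "g \<otimes>\<^bsub>Q\<^esub> y \<in> ?A" using Q.colonD(2)[OF prod(2,1)] Gc[OF prod(1)] Yc[OF prod(2)] by (simp add: Q.m_comm)
    obtain b where b: "b \<in> I" "\<iota> b = u \<otimes>\<^bsub>Q\<^esub> g" using IG prod(1) by (metis (no_types, lifting) imageE imageI)
    have "dual_trace (\<lambda>x. \<psi> ((g \<otimes>\<^bsub>Q\<^esub> y) \<otimes>\<^bsub>Q\<^esub> \<iota> x))"
    proof (rule dual_trace_single[OF b(1) \<beta>D[OF prod(2)]])
      fix x assume x: "x \<in> I"
      have "(y \<otimes>\<^bsub>Q\<^esub> h x) \<otimes>\<^bsub>Q\<^esub> \<iota> b = (g \<otimes>\<^bsub>Q\<^esub> y) \<otimes>\<^bsub>Q\<^esub> \<iota> x"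
        using h[OF x] hc[OF x] b(2) Gc[OF prod(1)] Yc[OF prod(2)] u by (simp add: Q.m_ac)
      then show "\<psi> ((g \<otimes>\<^bsub>Q\<^esub> y) \<otimes>\<^bsub>Q\<^esub> \<iota> x) = \<beta> y x b" using b(1) by (simp add: \<beta>_def)
    qed
    then show ?case using AI[OF gy] Ac[OF gy] by blast
  next
    case (sum p q)
    have pq: "(p \<oplus>\<^bsub>Q\<^esub> q) \<otimes>\<^bsub>Q\<^esub> \<iota> x = \<iota> (\<psi> (p \<otimes>\<^bsub>Q\<^esub> \<iota> x) \<oplus> \<psi> (q \<otimes>\<^bsub>Q\<^esub> \<iota> x)) \<and>
        \<psi> (p \<otimes>\<^bsub>Q\<^esub> \<iota> x) \<oplus> \<psi> (q \<otimes>\<^bsub>Q\<^esub> \<iota> x) \<in> I" if x: "x \<in> I" for x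
    proof -
      have m: "p \<otimes>\<^bsub>Q\<^esub> \<iota> x \<in> \<iota> ` I" "q \<otimes>\<^bsub>Q\<^esub> \<iota> x \<in> \<iota> ` I" using sum x by auto
      show ?thesis using \<psi>[OF m(1)] \<psi>[OF m(2)] sum Ic[OF x] by (simp add: I_simps \<iota>_simps Q.l_distr)
    qed
    have "dual_trace (\<lambda>x. \<psi> ((p \<oplus>\<^bsub>Q\<^esub> q) \<otimes>\<^bsub>Q\<^esub> \<iota> x))"
      by (rule dual_trace_add[of "\<lambda>x. \<psi> (p \<otimes>\<^bsub>Q\<^esub> \<iota> x)" "\<lambda>x. \<psi> (q \<otimes>\<^bsub>Q\<^esub> \<iota> x)"]) (use sum pq \<psi>\<iota> in auto)
    then show ?case using sum pq by auto
  qed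
  from this[OF one] have "dual_trace (\<lambda>x. \<psi> (\<one>\<^bsub>Q\<^esub> \<otimes>\<^bsub>Q\<^esub> \<iota> x))" by blast
  then have "dual_trace (\<lambda>x. x)" unfolding dual_trace_def using Ic \<psi>\<iota> by simp
  then show ?thesis by (rule projective_of_dual_trace)
qed

end

section \<open>Zero divisors in Noetherian rings\<close>

context cring
begin

lemma ideal_iff_submod: "ideal I R \<longleftrightarrow> submod (carrier R) I"
proof
  assume "ideal I R"
  then interpret ideal I R .
  show "submod (carrier R) I"
    by (intro submodI) (auto simp: a_subset additive_subgroup.zero_closed[OF is_additive_subgroup] I_l_closed)
next
  assume I: "submod (carrier R) I"
  note D = submodD[OF I]
  show "ideal I R"
  proof (rule idealI)
    show "ring R" by (rule ring_axioms)
    show "subgroup I (add_monoid R)"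
      by (rule add.subgroupI)
        (use D submod_minus[OF carrier_is_subring I] in \<open>auto simp: a_inv_def[symmetric]\<close>)
    show "x \<otimes> a \<in> I" if "a \<in> I" "x \<in> carrier R" for a x using D(5) that by blast
    show "a \<otimes> x \<in> I" if "a \<in> I" "x \<in> carrier R" for a x using D(2,5) that m_comm by metis
  qed
qed

lemma primeideal_iff_is_prime: "primeideal P R \<longleftrightarrow> is_prime (carrier R) P"
proof
  assume "primeideal P R"
  then interpret P: primeideal P R .
  show "is_prime (carrier R) P"
    unfolding is_prime_def ideal_iff_submod[symmetric]
    using P.is_ideal P.I_notcarr P.I_prime P.one_imp_carrier P.a_subset by auto
next
  assume P: "is_prime (carrier R) P"
  show "primeideal P R"
    by (rule primeidealI) (use P is_cring in \<open>auto simp: is_prime_def ideal_iff_submod\<close>)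
qed

definition annihilator :: "'a \<Rightarrow> 'a set" where
  "annihilator z = {r \<in> carrier R. r \<otimes> z = \<zero>}"

lemma ideal_annihilator: "z \<in> carrier R \<Longrightarrow> ideal (annihilator z) R"
  unfolding ideal_iff_submod by (rule submodI) (auto simp: annihilator_def l_distr m_assoc)

lemma annihilator_mult: "\<lbrakk>b \<in> carrier R; z \<in> carrier R\<rbrakk> \<Longrightarrow> annihilator z \<subseteq> annihilator (b \<otimes> z)"
  by (auto simp: annihilator_def m_lcomm[of _ b z])

lemma element_outside_prime_in_all:
  assumes P: "is_prime (carrier R) P" and S: "finite \<S>" "\<And>P'. P' \<in> \<S> \<Longrightarrow> ideal P' R \<and> \<not> P' \<subseteq> P"
    and I: "ideal I R" "\<not> I \<subseteq> P"
  shows "\<exists>b\<in>I. b \<notin> P \<and> (\<forall>P'\<in>\<S>. b \<in> P')"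
  using S
proof induct
  case empty then show ?case using I by auto
next
  case (insert P' \<S>)
  then obtain b where b: "b \<in> I" "b \<notin> P" "\<forall>P'\<in>\<S>. b \<in> P'" by auto
  obtain c where c: "c \<in> P'" "c \<notin> P" using insert by auto
  have id: "\<And>J. J \<in> insert P' \<S> \<Longrightarrow> submod (carrier R) J" "submod (carrier R) I"
    using insert(4) I by (auto simp: ideal_iff_submod)
  have bc: "b \<in> carrier R" "c \<in> carrier R" using b c submodD(2)[OF id(2)] submodD(2)[OF id(1)] by auto
  have "b \<otimes> c \<notin> P" using P b c bc unfolding is_prime_def by blast
  moreover have "c \<otimes> b \<in> J" if "submod (carrier R) J" "b \<in> J" for J using submodD(5)[OF that(1) bc(2) that(2)] .
  moreover have "b \<otimes> c \<in> P'" using submodD(5)[OF id(1) bc(1) c(1)] by blast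
  ultimately have "b \<otimes> c \<in> I \<and> b \<otimes> c \<notin> P \<and> (\<forall>J\<in>insert P' \<S>. b \<otimes> c \<in> J)"
    using b bc id m_comm[OF bc] by auto
  then show ?case by blast
qed

text \<open>
  The induction enlarges an element \<open>a\<close> that avoids \<open>\<S>\<close> but lies in \<open>P\<close> by an element \<open>b \<notin> P\<close> of all
  members of \<open>\<S>\<close>; incomparability of the primes provides \<open>b\<close>.
\<close>

lemma prime_avoidance:
  assumes S: "finite \<S>" "\<And>P. P \<in> \<S> \<Longrightarrow> is_prime (carrier R) P"
    and antichain: "\<And>P P'. \<lbrakk>P \<in> \<S>; P' \<in> \<S>; P \<subseteq> P'\<rbrakk> \<Longrightarrow> P = P'"
    and I: "ideal I R" "\<And>P. P \<in> \<S> \<Longrightarrow> \<not> I \<subseteq> P"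
  shows "\<exists>a\<in>I. \<forall>P\<in>\<S>. a \<notin> P"
  using S antichain I(2)
proof induct
  case empty then show ?case using I(1) additive_subgroup.zero_closed ideal.axioms(1) by blast
next
  case (insert P \<S>)
  have Pp: "is_prime (carrier R) P" and Sp: "\<And>P'. P' \<in> \<S> \<Longrightarrow> is_prime (carrier R) P'" using insert by auto
  have anti: "\<And>P1 P2. \<lbrakk>P1 \<in> \<S>; P2 \<in> \<S>; P1 \<subseteq> P2\<rbrakk> \<Longrightarrow> P1 = P2" using insert(5) by auto
  obtain a where a: "a \<in> I" "\<forall>P'\<in>\<S>. a \<notin> P'" using insert(3)[OF Sp anti insert(6)] by auto
  have "\<exists>b\<in>I. b \<notin> P \<and> (\<forall>P'\<in>\<S>. b \<in> P')"
  proof (rule element_outside_prime_in_all[OF Pp insert(1) _ I(1)])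
    fix P' assume P': "P' \<in> \<S>"
    have "\<not> P' \<subseteq> P" using insert(5)[of P' P] P' insert(2) by auto
    then show "ideal P' R \<and> \<not> P' \<subseteq> P" using Sp[OF P'] by (simp add: is_prime_def ideal_iff_submod)
  qed (use insert(6) in auto)
  then obtain b where b: "b \<in> I" "b \<notin> P" "\<forall>P'\<in>\<S>. b \<in> P'" by auto
  have Is: "submod (carrier R) I" using I(1) by (simp add: ideal_iff_submod)
  have c: "a \<in> carrier R" "b \<in> carrier R" using a b submodD(2)[OF Is] by auto
  show ?case
  proof (cases "a \<in> P")
    case False then show ?thesis using a by auto
  next
    case True
    have "a \<oplus> b \<notin> P'" if P': "P' \<in> insert P \<S>" for P'
    proof
      assume ab: "a \<oplus> b \<in> P'"
      have sm: "submod (carrier R) P'" using P' Pp Sp by (auto simp: is_prime_def)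
      have "(a \<oplus> b) \<ominus> a = b" "(a \<oplus> b) \<ominus> b = a" using c by algebra+
      then have "a \<in> P' \<longleftrightarrow> b \<in> P'" using submod_minus(2)[OF carrier_is_subring sm ab] by metis
      then show False using P' a b True by auto
    qed
    then show ?thesis using submodD(4)[OF Is a(1) b(1)] by blast
  qed
qed

end

locale noetherian_cring = cring R + noetherian_ring R for R (structure)
begin

lemma maximal_in_family:
  assumes "\<F> \<noteq> {}" "\<And>I. I \<in> \<F> \<Longrightarrow> ideal I R"
  shows "\<exists>I\<in>\<F>. \<forall>J\<in>\<F>. I \<subseteq> J \<longrightarrow> J = I"
proof (rule subset_Zorn_nonempty[OF assms(1)])
  fix C assume C: "C \<noteq> {}" "subset.chain \<F> C"
  then have "subset.chain {I. ideal I R} C" using assms(2) by (auto simp: pred_on.chain_def)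
  then have "\<Union>C \<in> C" using ideal_chain_is_trivial C(1) by blast
  then show "\<Union>C \<in> \<F>" using C(2) by (auto simp: pred_on.chain_def)
qed

lemma in_maximal_ideal:
  assumes I: "ideal I R" "\<one> \<notin> I"
  obtains M where "maximalideal M R" "I \<subseteq> M"
proof -
  have "\<exists>M\<in>{J. ideal J R \<and> I \<subseteq> J \<and> \<one> \<notin> J}. \<forall>J\<in>{J. ideal J R \<and> I \<subseteq> J \<and> \<one> \<notin> J}. M \<subseteq> J \<longrightarrow> J = M"
    by (rule maximal_in_family) (use I in auto)
  then obtain M where M: "ideal M R" "I \<subseteq> M" "\<one> \<notin> M"
    and max: "\<forall>J\<in>{J. ideal J R \<and> I \<subseteq> J \<and> \<one> \<notin> J}. M \<subseteq> J \<longrightarrow> J = M" by auto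
  have "maximalideal M R"
  proof (rule maximalidealI[OF M(1)])
    show "carrier R \<noteq> M" using M(3) by auto
    fix J assume J: "ideal J R" "M \<subseteq> J" "J \<subseteq> carrier R"
    show "J = M \<or> J = carrier R"
    proof (cases "\<one> \<in> J")
      case True then show ?thesis using ideal.one_imp_carrier[OF J(1)] by simp
    next
      case False
      then have "J \<in> {J. ideal J R \<and> I \<subseteq> J \<and> \<one> \<notin> J}" using J M(2) by auto
      then show ?thesis using max J(2) by blast
    qed
  qed
  then show thesis using that M(2) by blast
qed

text \<open>
  The maximal annihilators of nonzero elements, which are the maximal associated primes of the ring.
\<close>

definition assoc_maximal :: "'a set set" where
  "assoc_maximal = {annihilator z | z. z \<in> carrier R \<and> z \<noteq> \<zero> \<and>
     (\<forall>y\<in>carrier R. y \<noteq> \<zero> \<longrightarrow> annihilator z \<subseteq> annihilator y \<longrightarrow> annihilator y = annihilator z)}"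

lemma assoc_maximal_prime:
  assumes "P \<in> assoc_maximal"
  shows "is_prime (carrier R) P"
proof -
  obtain z where z: "z \<in> carrier R" "z \<noteq> \<zero>" "P = annihilator z"
    and max: "\<And>y. \<lbrakk>y \<in> carrier R; y \<noteq> \<zero>; annihilator z \<subseteq> annihilator y\<rbrakk> \<Longrightarrow> annihilator y = annihilator z"
    using assms unfolding assoc_maximal_def by blast
  show ?thesis unfolding is_prime_def
  proof (intro conjI ballI impI)
    show "submod (carrier R) P" using ideal_annihilator[OF z(1)] z(3) by (simp add: ideal_iff_submod)
    show "P \<subseteq> carrier R" "\<one> \<notin> P" using z by (auto simp: annihilator_def)
    fix a b assume ab: "a \<in> carrier R" "b \<in> carrier R" "a \<otimes> b \<in> P"
    show "a \<in> P \<or> b \<in> P"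
    proof (cases "b \<otimes> z = \<zero>")
      case True then show ?thesis using ab z(3) by (simp add: annihilator_def)
    next
      case False
      then have "annihilator (b \<otimes> z) = P" using max[of "b \<otimes> z"] annihilator_mult ab z by simp
      moreover have "a \<in> annihilator (b \<otimes> z)" using ab z by (simp add: annihilator_def m_assoc)
      ultimately show ?thesis by simp
    qed
  qed
qed

lemma zerodivisor_in_assoc_maximal:
  assumes "a \<in> carrier R" "z \<in> carrier R" "z \<noteq> \<zero>" "a \<otimes> z = \<zero>"
  shows "\<exists>P\<in>assoc_maximal. a \<in> P"
proof -
  let ?F = "{annihilator y | y. y \<in> carrier R \<and> y \<noteq> \<zero> \<and> annihilator z \<subseteq> annihilator y}"
  have "\<exists>I\<in>?F. \<forall>J\<in>?F. I \<subseteq> J \<longrightarrow> J = I"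
    by (rule maximal_in_family) (use assms ideal_annihilator in auto)
  then obtain y where y: "y \<in> carrier R" "y \<noteq> \<zero>" "annihilator z \<subseteq> annihilator y"
    and max: "\<forall>J\<in>?F. annihilator y \<subseteq> J \<longrightarrow> J = annihilator y" by auto
  have "annihilator y \<in> assoc_maximal"
    unfolding assoc_maximal_def mem_Collect_eq
  proof (intro exI conjI ballI impI)
    fix x assume x: "x \<in> carrier R" "x \<noteq> \<zero>" "annihilator y \<subseteq> annihilator x"
    then have "annihilator x \<in> ?F" using y(3) by blast
    then show "annihilator x = annihilator y" using max x(3) by blast
  qed (use y in auto)
  moreover have "a \<in> annihilator y" using assms y(3) by (auto simp: annihilator_def)
  ultimately show ?thesis by blast
qed

lemma assoc_maximal_antichain: "\<lbrakk>P \<in> assoc_maximal; P' \<in> assoc_maximal; P \<subseteq> P'\<rbrakk> \<Longrightarrow> P = P'"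
  unfolding assoc_maximal_def mem_Collect_eq by (elim exE conjE) simp

text \<open>
  The annihilators of the finite intersections \<open>\<Inter>\<S>\<close> of such primes form an increasing family of ideals. If
  the one of \<open>\<S>\<close> is maximal, it contains \<open>z\<close> for each further \<open>P = annihilator z\<close>; then \<open>\<Inter>\<S> \<subseteq> P\<close>, and
  \<open>P\<close> contains a member of \<open>\<S>\<close>.
\<close>

lemma finite_assoc_maximal: "finite assoc_maximal"
proof -
  define ann where "ann \<S> = {z \<in> carrier R. \<forall>b\<in>carrier R. (\<forall>P\<in>\<S>. b \<in> P) \<longrightarrow> b \<otimes> z = \<zero>}" for \<S>
  let ?F = "ann ` {\<S>. finite \<S> \<and> \<S> \<subseteq> assoc_maximal}"
  have "\<exists>I\<in>?F. \<forall>J\<in>?F. I \<subseteq> J \<longrightarrow> J = I"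
  proof (rule maximal_in_family)
    show "?F \<noteq> {}" by blast
    fix I assume "I \<in> ?F"
    then obtain \<S> where "I = ann \<S>" by auto
    then show "ideal I R" unfolding ideal_iff_submod ann_def
      by (intro submodI) (auto simp: r_distr m_lcomm)
  qed
  then obtain I where "I \<in> ?F" and maxI: "\<forall>J\<in>?F. I \<subseteq> J \<longrightarrow> J = I" by (rule bexE)
  then obtain \<S> where S: "finite \<S>" "\<S> \<subseteq> assoc_maximal" and I: "I = ann \<S>" by auto
  note max = maxI[unfolded I]
  have "P \<in> \<S>" if P: "P \<in> assoc_maximal" for P
  proof (rule ccontr)
    assume notin: "P \<notin> \<S>"
    obtain z where z: "z \<in> carrier R" "P = annihilator z" using P by (auto simp: assoc_maximal_def)
    have "ann (insert P \<S>) \<in> ?F" using S P by blast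
    moreover have "ann \<S> \<subseteq> ann (insert P \<S>)" by (auto simp: ann_def)
    ultimately have eq: "ann (insert P \<S>) = ann \<S>" using max by blast
    have "z \<in> ann (insert P \<S>)" using z by (auto simp: ann_def annihilator_def)
    then have zann: "z \<in> ann \<S>" using eq by simp
    have Pp: "is_prime (carrier R) P" using assoc_maximal_prime[OF P] .
    have "\<exists>b\<in>carrier R. b \<notin> P \<and> (\<forall>P'\<in>\<S>. b \<in> P')"
    proof (rule element_outside_prime_in_all[OF Pp S(1) _ oneideal])
      fix P' assume P': "P' \<in> \<S>"
      then have "\<not> P' \<subseteq> P" using assoc_maximal_antichain[of P' P] S(2) P notin by blast
      then show "ideal P' R \<and> \<not> P' \<subseteq> P"
        using assoc_maximal_prime[of P'] P' S(2) by (auto simp: is_prime_def ideal_iff_submod)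
    qed (use Pp in \<open>auto simp: is_prime_def\<close>)
    then obtain b where b: "b \<in> carrier R" "b \<notin> P" "\<forall>P'\<in>\<S>. b \<in> P'" by auto
    then have "b \<otimes> z = \<zero>" using zann by (auto simp: ann_def)
    then show False using b z by (auto simp: annihilator_def)
  qed
  then show ?thesis by (intro finite_subset[OF _ S(1)] subsetI)
qed

lemma ideal_of_zerodivisors_annihilated:
  assumes I: "ideal I R" "I \<inter> nonzerodivisors R = {}"
  shows "\<exists>z\<in>carrier R. z \<noteq> \<zero> \<and> (\<forall>a\<in>I. a \<otimes> z = \<zero>)"
proof -
  have "\<exists>P\<in>assoc_maximal. I \<subseteq> P"
  proof (rule ccontr)
    assume no: "\<not> ?thesis"
    have "\<exists>a\<in>I. \<forall>P\<in>assoc_maximal. a \<notin> P"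
    proof (rule prime_avoidance[OF finite_assoc_maximal assoc_maximal_prime assoc_maximal_antichain I(1)])
      show "\<not> I \<subseteq> P" if "P \<in> assoc_maximal" for P using no that by blast
    qed
    then obtain a where a: "a \<in> I" "\<forall>P\<in>assoc_maximal. a \<notin> P" by (rule bexE)
    have ac: "a \<in> carrier R" using ideal.Icarr[OF I(1) a(1)] .
    have "a \<notin> nonzerodivisors R" using a(1) I(2) by auto
    then obtain z where "z \<in> carrier R" "a \<otimes> z = \<zero>" "z \<noteq> \<zero>"
      using ac unfolding nonzerodivisors_def by auto
    then show False using zerodivisor_in_assoc_maximal[OF ac] a(2) by auto
  qed
  then show ?thesis by (auto simp: assoc_maximal_def annihilator_def)
qed

end

section \<open>Localizations\<close>

text \<open>
  The set-theoretic operations on fractions are unions over all representatives. Once they are computed on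
  representatives (\<open>L_add\<close>, \<open>L_mult\<close>), only these formulas and the criterion for equality are used.
\<close>

locale localization = cring R for R (structure) +
  fixes S assumes S_subset: "S \<subseteq> carrier R" and S_one: "\<one> \<in> S" and S_mult: "\<lbrakk>s \<in> S; t \<in> S\<rbrakk> \<Longrightarrow> s \<otimes> t \<in> S"
begin

abbreviation fr :: "'a \<Rightarrow> 'a \<Rightarrow> ('a \<times> 'a) set" where
  "fr a s \<equiv> loc_frac (mult_module R (carrier R)) S a s"

abbreviation L where "L \<equiv> loc_ring R S"

lemma S_closed: "s \<in> S \<Longrightarrow> s \<in> carrier R" using S_subset by auto

lemma fr_iff: "(n, t) \<in> fr a s \<longleftrightarrow> n \<in> carrier R \<and> t \<in> S \<and> (\<exists>u\<in>S. u \<otimes> (t \<otimes> a) = u \<otimes> (s \<otimes> n))"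
  by (simp add: loc_frac_def mult_module_def)

lemma fr_self: "\<lbrakk>a \<in> carrier R; s \<in> S\<rbrakk> \<Longrightarrow> (a, s) \<in> fr a s"
  using S_one by (auto simp: fr_iff)

lemma fr_eqI:
  assumes "a \<in> carrier R" "b \<in> carrier R" "s \<in> S" "t \<in> S" "u \<in> S" "u \<otimes> (t \<otimes> a) = u \<otimes> (s \<otimes> b)"
  shows "fr a s = fr b t"
proof -
  have sub: "fr a s \<subseteq> fr b t"
    if h: "a \<in> carrier R" "b \<in> carrier R" "s \<in> S" "t \<in> S" "u \<in> S" "u \<otimes> (t \<otimes> a) = u \<otimes> (s \<otimes> b)" for a b s t u
  proof (rule subrelI)
    fix n r assume "(n, r) \<in> fr a s"
    then obtain v where v: "n \<in> carrier R" "r \<in> S" "v \<in> S" "v \<otimes> (r \<otimes> a) = v \<otimes> (s \<otimes> n)" by (auto simp: fr_iff)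
    note c = h(1,2) v(1) S_closed[OF h(3)] S_closed[OF h(4)] S_closed[OF h(5)] S_closed[OF v(2)] S_closed[OF v(3)]
    have "(u \<otimes> v \<otimes> s) \<otimes> (r \<otimes> b) = (v \<otimes> r) \<otimes> (u \<otimes> (s \<otimes> b))" using c by (simp add: m_ac)
    also have "\<dots> = (u \<otimes> t) \<otimes> (v \<otimes> (r \<otimes> a))" unfolding h(6)[symmetric] using c by (simp add: m_ac)
    also have "\<dots> = (u \<otimes> v \<otimes> s) \<otimes> (t \<otimes> n)" unfolding v(4) using c by (simp add: m_ac)
    finally show "(n, r) \<in> fr b t" using v h S_mult by (auto simp: fr_iff)
  qed
  show ?thesis using sub[OF assms] sub[OF assms(2,1,4,3,5)] assms(6) by simp
qed

lemma fr_eqD: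
  assumes "fr a s = fr b t" "a \<in> carrier R" "b \<in> carrier R" "s \<in> S" "t \<in> S"
  shows "\<exists>u\<in>S. u \<otimes> (t \<otimes> a) = u \<otimes> (s \<otimes> b)"
proof -
  have "(b, t) \<in> fr a s" using fr_self[OF assms(3,5)] assms(1) by simp
  then show ?thesis by (auto simp: fr_iff)
qed

lemma UN_representatives:
  assumes "a \<in> carrier R" "b \<in> carrier R" "s \<in> S" "t \<in> S"
    and "\<And>m s' n t'. \<lbrakk>(m, s') \<in> fr a s; (n, t') \<in> fr b t\<rbrakk> \<Longrightarrow> f m s' n t' = c"
  shows "(\<Union>(m, s')\<in>fr a s. \<Union>(n, t')\<in>fr b t. f m s' n t') = c"
  using fr_self[OF assms(1,3)] fr_self[OF assms(2,4)] assms(5) by (auto split: prod.splits) blast+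

lemma L_carrier: "carrier L = {fr a s | a s. a \<in> carrier R \<and> s \<in> S}"
  by (simp add: loc_ring_def loc_module_def Let_def mult_module_def)

lemma L_carrierI: "\<lbrakk>a \<in> carrier R; s \<in> S\<rbrakk> \<Longrightarrow> fr a s \<in> carrier L"
  by (auto simp: L_carrier)

lemma L_one: "\<one>\<^bsub>L\<^esub> = fr \<one> \<one>" and L_zero: "\<zero>\<^bsub>L\<^esub> = fr \<zero> \<one>"
  by (simp_all add: loc_ring_def loc_module_def Let_def mult_module_def)

lemma L_add:
  assumes "a \<in> carrier R" "b \<in> carrier R" "s \<in> S" "t \<in> S"
  shows "fr a s \<oplus>\<^bsub>L\<^esub> fr b t = fr (t \<otimes> a \<oplus> s \<otimes> b) (s \<otimes> t)"
proof -
  have key: "fr (t' \<otimes> m \<oplus> s' \<otimes> n) (s' \<otimes> t') = fr (t \<otimes> a \<oplus> s \<otimes> b) (s \<otimes> t)"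
    if mem: "(m, s') \<in> fr a s" "(n, t') \<in> fr b t" for m s' n t'
  proof -
    obtain v w where h: "m \<in> carrier R" "s' \<in> S" "v \<in> S" "v \<otimes> (s' \<otimes> a) = v \<otimes> (s \<otimes> m)"
      "n \<in> carrier R" "t' \<in> S" "w \<in> S" "w \<otimes> (t' \<otimes> b) = w \<otimes> (t \<otimes> n)"
      using mem by (auto simp: fr_iff)
    note c = assms(1,2) h(1,5) S_closed[OF assms(3)] S_closed[OF assms(4)] S_closed[OF h(2)] S_closed[OF h(3)]
      S_closed[OF h(6)] S_closed[OF h(7)]
    show ?thesis
    proof (rule fr_eqI[of _ _ _ _ "v \<otimes> w"])
      have "(v \<otimes> w) \<otimes> ((s \<otimes> t) \<otimes> (t' \<otimes> m \<oplus> s' \<otimes> n))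
          = (w \<otimes> t \<otimes> t') \<otimes> (v \<otimes> (s \<otimes> m)) \<oplus> (v \<otimes> s \<otimes> s') \<otimes> (w \<otimes> (t \<otimes> n))"
        using c by (simp add: r_distr m_ac)
      also have "\<dots> = (v \<otimes> w) \<otimes> ((s' \<otimes> t') \<otimes> (t \<otimes> a \<oplus> s \<otimes> b))"
        unfolding h(4)[symmetric] h(8)[symmetric] using c by (simp add: r_distr m_ac)
      finally show "(v \<otimes> w) \<otimes> ((s \<otimes> t) \<otimes> (t' \<otimes> m \<oplus> s' \<otimes> n)) = (v \<otimes> w) \<otimes> ((s' \<otimes> t') \<otimes> (t \<otimes> a \<oplus> s \<otimes> b))" .
    qed (use c h assms S_mult in auto)
  qed
  have "fr a s \<oplus>\<^bsub>L\<^esub> fr b t = (\<Union>(m, s')\<in>fr a s. \<Union>(n, t')\<in>fr b t. fr (t' \<otimes> m \<oplus> s' \<otimes> n) (s' \<otimes> t'))"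
    by (simp add: loc_ring_def loc_module_def Let_def mult_module_def)
  also have "\<dots> = fr (t \<otimes> a \<oplus> s \<otimes> b) (s \<otimes> t)"
    by (rule UN_representatives[OF assms key])
  finally show ?thesis .
qed

lemma L_mult:
  assumes "a \<in> carrier R" "b \<in> carrier R" "s \<in> S" "t \<in> S"
  shows "fr a s \<otimes>\<^bsub>L\<^esub> fr b t = fr (a \<otimes> b) (s \<otimes> t)"
proof -
  have key: "fr (m \<otimes> n) (s' \<otimes> t') = fr (a \<otimes> b) (s \<otimes> t)"
    if mem: "(m, s') \<in> fr a s" "(n, t') \<in> fr b t" for m s' n t'
  proof -
    obtain v w where h: "m \<in> carrier R" "s' \<in> S" "v \<in> S" "v \<otimes> (s' \<otimes> a) = v \<otimes> (s \<otimes> m)"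
      "n \<in> carrier R" "t' \<in> S" "w \<in> S" "w \<otimes> (t' \<otimes> b) = w \<otimes> (t \<otimes> n)"
      using mem by (auto simp: fr_iff)
    note c = assms(1,2) h(1,5) S_closed[OF assms(3)] S_closed[OF assms(4)] S_closed[OF h(2)] S_closed[OF h(3)]
      S_closed[OF h(6)] S_closed[OF h(7)]
    show ?thesis
    proof (rule fr_eqI[of _ _ _ _ "v \<otimes> w"])
      have "(v \<otimes> w) \<otimes> ((s \<otimes> t) \<otimes> (m \<otimes> n)) = (v \<otimes> (s \<otimes> m)) \<otimes> (w \<otimes> (t \<otimes> n))"
        using c by (simp add: m_ac)
      also have "\<dots> = (v \<otimes> w) \<otimes> ((s' \<otimes> t') \<otimes> (a \<otimes> b))"
        unfolding h(4)[symmetric] h(8)[symmetric] using c by (simp add: m_ac)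
      finally show "(v \<otimes> w) \<otimes> ((s \<otimes> t) \<otimes> (m \<otimes> n)) = (v \<otimes> w) \<otimes> ((s' \<otimes> t') \<otimes> (a \<otimes> b))" .
    qed (use c h assms S_mult in auto)
  qed
  have "fr a s \<otimes>\<^bsub>L\<^esub> fr b t = (\<Union>(m, s')\<in>fr a s. \<Union>(n, t')\<in>fr b t. fr (m \<otimes> n) (s' \<otimes> t'))"
    by (simp add: loc_ring_def loc_module_def Let_def mult_module_def)
  also have "\<dots> = fr (a \<otimes> b) (s \<otimes> t)"
    by (rule UN_representatives[OF assms key])
  finally show ?thesis .
qed

lemma fr_cancel:
  assumes "a \<in> carrier R" "s \<in> S" "t \<in> S"
  shows "fr (t \<otimes> a) (t \<otimes> s) = fr a s" "fr (t \<otimes> a) (s \<otimes> t) = fr a s"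
proof -
  note c = assms(1) S_closed[OF assms(2)] S_closed[OF assms(3)]
  show "fr (t \<otimes> a) (t \<otimes> s) = fr a s"
    by (rule fr_eqI[of _ _ _ _ \<one>]) (use c assms S_mult S_one in \<open>auto simp: m_ac\<close>)
  then show "fr (t \<otimes> a) (s \<otimes> t) = fr a s" using c by (simp add: m_comm)
qed

lemma cring_L: "cring L"
proof (rule cringI)
  show "abelian_group L"
  proof (rule abelian_groupI)
    fix x y assume "x \<in> carrier L" "y \<in> carrier L"
    then obtain a s b t where h: "a \<in> carrier R" "s \<in> S" "b \<in> carrier R" "t \<in> S" "x = fr a s" "y = fr b t"
      by (auto simp: L_carrier)
    note c = h(1,3) S_closed[OF h(2)] S_closed[OF h(4)]
    show "x \<oplus>\<^bsub>L\<^esub> y \<in> carrier L" using h c S_mult by (simp add: L_add L_carrierI)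
    show "x \<oplus>\<^bsub>L\<^esub> y = y \<oplus>\<^bsub>L\<^esub> x" using h c by (simp add: L_add m_comm a_comm)
    fix z assume "z \<in> carrier L"
    then obtain d r where h': "d \<in> carrier R" "r \<in> S" "z = fr d r" by (auto simp: L_carrier)
    have "r \<otimes> (t \<otimes> a \<oplus> s \<otimes> b) \<oplus> s \<otimes> t \<otimes> d = t \<otimes> r \<otimes> a \<oplus> s \<otimes> (r \<otimes> b \<oplus> t \<otimes> d)"
      using c h'(1) S_closed[OF h'(2)] by (simp add: r_distr m_ac a_ac)
    then show "x \<oplus>\<^bsub>L\<^esub> y \<oplus>\<^bsub>L\<^esub> z = x \<oplus>\<^bsub>L\<^esub> (y \<oplus>\<^bsub>L\<^esub> z)"
      using h h' c S_mult S_closed[OF h'(2)] by (simp add: L_add m_assoc)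
  next
    show "\<zero>\<^bsub>L\<^esub> \<in> carrier L" using S_one by (simp add: L_zero L_carrierI)
    fix x assume "x \<in> carrier L"
    then obtain a s where h: "a \<in> carrier R" "s \<in> S" "x = fr a s" by (auto simp: L_carrier)
    note c = h(1) S_closed[OF h(2)]
    show "\<zero>\<^bsub>L\<^esub> \<oplus>\<^bsub>L\<^esub> x = x" using h c S_one by (simp add: L_zero L_add)
    have "fr (\<ominus> a) s \<oplus>\<^bsub>L\<^esub> x = fr (s \<otimes> \<ominus> a \<oplus> s \<otimes> a) (s \<otimes> s)" using h c by (simp add: L_add)
    also have "s \<otimes> \<ominus> a \<oplus> s \<otimes> a = (s \<otimes> s) \<otimes> \<zero>" using c by (simp add: r_minus l_neg)
    also have "fr \<dots> (s \<otimes> s) = \<zero>\<^bsub>L\<^esub>"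
      using fr_cancel(1)[OF zero_closed S_one S_mult[OF h(2) h(2)]] c by (simp add: L_zero)
    finally show "\<exists>y\<in>carrier L. y \<oplus>\<^bsub>L\<^esub> x = \<zero>\<^bsub>L\<^esub>" using L_carrierI[of "\<ominus> a" s] h by auto
  qed
  show "Group.comm_monoid L"
  proof (rule comm_monoidI)
    show "\<one>\<^bsub>L\<^esub> \<in> carrier L" using S_one by (simp add: L_one L_carrierI)
    fix x y assume "x \<in> carrier L" "y \<in> carrier L"
    then obtain a s b t where h: "a \<in> carrier R" "s \<in> S" "b \<in> carrier R" "t \<in> S" "x = fr a s" "y = fr b t"
      by (auto simp: L_carrier)
    note c = h(1,3) S_closed[OF h(2)] S_closed[OF h(4)]
    show "x \<otimes>\<^bsub>L\<^esub> y \<in> carrier L" using h c S_mult by (simp add: L_mult L_carrierI)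
    show "x \<otimes>\<^bsub>L\<^esub> y = y \<otimes>\<^bsub>L\<^esub> x" using h c by (simp add: L_mult m_comm)
    show "\<one>\<^bsub>L\<^esub> \<otimes>\<^bsub>L\<^esub> x = x" using h c S_one by (simp add: L_one L_mult)
    fix z assume "z \<in> carrier L"
    then obtain d r where h': "d \<in> carrier R" "r \<in> S" "z = fr d r" by (auto simp: L_carrier)
    show "x \<otimes>\<^bsub>L\<^esub> y \<otimes>\<^bsub>L\<^esub> z = x \<otimes>\<^bsub>L\<^esub> (y \<otimes>\<^bsub>L\<^esub> z)"
      using h h' c S_mult S_closed[OF h'(2)] by (simp add: L_mult m_assoc)
  qed
next
  fix x y z assume "x \<in> carrier L" "y \<in> carrier L" "z \<in> carrier L"
  then obtain a s b t d r where h: "a \<in> carrier R" "s \<in> S" "b \<in> carrier R" "t \<in> S" "d \<in> carrier R" "r \<in> S"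
    "x = fr a s" "y = fr b t" "z = fr d r"
    by (auto simp: L_carrier)
  note c = h(1,3,5) S_closed[OF h(2)] S_closed[OF h(4)] S_closed[OF h(6)]
  have "x \<otimes>\<^bsub>L\<^esub> z \<oplus>\<^bsub>L\<^esub> y \<otimes>\<^bsub>L\<^esub> z = fr (t \<otimes> r \<otimes> (a \<otimes> d) \<oplus> s \<otimes> r \<otimes> (b \<otimes> d)) (s \<otimes> r \<otimes> (t \<otimes> r))"
    using h c S_mult by (simp add: L_mult L_add)
  also have "t \<otimes> r \<otimes> (a \<otimes> d) \<oplus> s \<otimes> r \<otimes> (b \<otimes> d) = r \<otimes> ((t \<otimes> a \<oplus> s \<otimes> b) \<otimes> d)"
    using c by (simp add: l_distr r_distr m_ac)
  also have "s \<otimes> r \<otimes> (t \<otimes> r) = r \<otimes> (s \<otimes> t \<otimes> r)" using c by (simp add: m_ac)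
  also have "fr (r \<otimes> ((t \<otimes> a \<oplus> s \<otimes> b) \<otimes> d)) (r \<otimes> (s \<otimes> t \<otimes> r)) = fr ((t \<otimes> a \<oplus> s \<otimes> b) \<otimes> d) (s \<otimes> t \<otimes> r)"
    by (rule fr_cancel(1)) (use c h S_mult in auto)
  also have "\<dots> = (x \<oplus>\<^bsub>L\<^esub> y) \<otimes>\<^bsub>L\<^esub> z" using h c S_mult by (simp add: L_mult L_add)
  finally show "(x \<oplus>\<^bsub>L\<^esub> y) \<otimes>\<^bsub>L\<^esub> z = x \<otimes>\<^bsub>L\<^esub> z \<oplus>\<^bsub>L\<^esub> y \<otimes>\<^bsub>L\<^esub> z" by simp
qed

end

context localization
begin

text \<open>
  Common denominators make this set of single fractions an ideal when \<open>P\<close> is one.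
\<close>

definition extension :: "'a set \<Rightarrow> ('a \<times> 'a) set set" where
  "extension P = {fr a s | a s. a \<in> P \<and> s \<in> S}"

lemma extension_iff:
  assumes P: "is_prime (carrier R) P" "P \<inter> S = {}" and a: "a \<in> carrier R" "s \<in> S"
  shows "fr a s \<in> extension P \<longleftrightarrow> a \<in> P"
proof
  assume "fr a s \<in> extension P"
  then obtain b t where b: "b \<in> P" "t \<in> S" "fr a s = fr b t" by (auto simp: extension_def)
  have Ps: "submod (carrier R) P" using P by (simp add: is_prime_def)
  have bc: "b \<in> carrier R" using submodD(2)[OF Ps b(1)] .
  obtain u where u: "u \<in> S" "u \<otimes> (t \<otimes> a) = u \<otimes> (s \<otimes> b)" using fr_eqD[OF b(3) a(1) bc a(2) b(2)] by auto
  note c = S_closed[OF u(1)] S_closed[OF b(2)] S_closed[OF a(2)]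
  have "u \<otimes> (s \<otimes> b) \<in> P" using submodD(5)[OF Ps c(1) submodD(5)[OF Ps c(3) b(1)]] .
  then have "u \<otimes> (t \<otimes> a) \<in> P" using u(2) by simp
  then have "t \<otimes> a \<in> P" using P u(1) c a(1) unfolding is_prime_def by blast
  then show "a \<in> P" using P b(2) c a(1) unfolding is_prime_def by blast
qed (use a in \<open>auto simp: extension_def\<close>)

lemma primeideal_extension:
  assumes P: "primeideal P R" "P \<inter> S = {}"
  shows "primeideal (extension P) L"
proof -
  have Pp: "is_prime (carrier R) P" using P(1) by (simp add: primeideal_iff_is_prime)
  have Ps: "submod (carrier R) P" and Pprime: "\<And>a b. \<lbrakk>a \<in> carrier R; b \<in> carrier R; a \<otimes> b \<in> P\<rbrakk> \<Longrightarrow> a \<in> P \<or> b \<in> P"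
    using Pp by (auto simp: is_prime_def)
  note D = submodD[OF Ps]
  interpret L: cring L by (rule cring_L)
  note iff = extension_iff[OF Pp P(2)]
  show ?thesis
    unfolding L.primeideal_iff_is_prime L.submod_def is_prime_def
  proof -
    have "L.submod (carrier L) (extension P)"
    proof (rule L.submodI)
      show sub: "extension P \<subseteq> carrier L" using D(2) L_carrierI by (auto simp: extension_def)
      show "\<zero>\<^bsub>L\<^esub> \<in> extension P" using iff S_one D(3) by (simp add: L_zero)
      fix x y assume "x \<in> extension P" "y \<in> extension P"
      then obtain a s b t where h: "a \<in> P" "s \<in> S" "b \<in> P" "t \<in> S" "x = fr a s" "y = fr b t"
        by (auto simp: extension_def)
      then have "t \<otimes> a \<oplus> s \<otimes> b \<in> P" using D(4,5) S_closed by blast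
      moreover have "x \<oplus>\<^bsub>L\<^esub> y = fr (t \<otimes> a \<oplus> s \<otimes> b) (s \<otimes> t)" using h D(2) by (simp add: L_add)
      ultimately show "x \<oplus>\<^bsub>L\<^esub> y \<in> extension P" using S_mult[OF h(2,4)] unfolding extension_def by blast
    next
      fix x y assume "x \<in> carrier L" "y \<in> extension P"
      then obtain a s b t where h: "a \<in> carrier R" "s \<in> S" "b \<in> P" "t \<in> S" "x = fr a s" "y = fr b t"
        by (auto simp: extension_def L_carrier)
      then have "a \<otimes> b \<in> P" using D(5) by blast
      moreover have "x \<otimes>\<^bsub>L\<^esub> y = fr (a \<otimes> b) (s \<otimes> t)" using h D(2) by (simp add: L_mult)
      ultimately show "x \<otimes>\<^bsub>L\<^esub> y \<in> extension P" using S_mult[OF h(2,4)] unfolding extension_def by blast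
    qed
    moreover have "\<one>\<^bsub>L\<^esub> \<notin> extension P" using iff S_one P(2) by (auto simp: L_one)
    moreover have "x \<in> extension P \<or> y \<in> extension P" if "x \<in> carrier L" "y \<in> carrier L" "x \<otimes>\<^bsub>L\<^esub> y \<in> extension P" for x y
    proof -
      obtain a s b t where h: "a \<in> carrier R" "s \<in> S" "b \<in> carrier R" "t \<in> S" "x = fr a s" "y = fr b t"
        using \<open>x \<in> carrier L\<close> \<open>y \<in> carrier L\<close> by (auto simp: L_carrier)
      have "a \<otimes> b \<in> P" using that(3) h iff[of "a \<otimes> b" "s \<otimes> t"] S_mult by (simp add: L_mult)
      then show ?thesis using Pprime h iff by blast
    qed
    ultimately show "L.is_prime (carrier L) (extension P)"
      unfolding L.is_prime_def using L.submodD(1) by blast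
  qed
qed

lemma extension_strict_mono:
  assumes P: "primeideal P R" "P \<subset> P'"
    and P': "primeideal P' R" "P' \<inter> S = {}"
  shows "extension P \<subset> extension P'"
proof -
  have p: "is_prime (carrier R) P" "is_prime (carrier R) P'" "P \<inter> S = {}"
    using P P' by (auto simp: primeideal_iff_is_prime)
  obtain a where a: "a \<in> P'" "a \<notin> P" using P(2) by auto
  then have "a \<in> carrier R" using p(2) by (auto simp: is_prime_def)
  then have "fr a \<one> \<in> extension P'" "fr a \<one> \<notin> extension P"
    using extension_iff[OF p(2) P'(2)] extension_iff[OF p(1,3)] a S_one by auto
  moreover have "extension P \<subseteq> extension P'" using P(2) by (auto simp: extension_def)
  ultimately show ?thesis by auto
qed

end

lemma localization_at_prime:
  assumes "cring R" "primeideal M R"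
  shows "localization R (carrier R - M)"
proof -
  interpret M: primeideal M R by fact
  show ?thesis
    by unfold_locales (use M.I_prime M.I_notcarr M.one_imp_carrier in auto)
qed

text \<open>
  Extended to the localization, such a chain together with the maximal ideal would show that the dimension
  is at least \<open>2\<close>.
\<close>

lemma (in cring) no_chain_below_maximal:
  assumes M: "maximalideal M R" and dim: "krull_dim (loc_ring_at R M) = 1"
    and P: "primeideal P R" "primeideal P' R" "P \<subset> P'" "P' \<subset> M"
  shows False
proof -
  have Mp: "primeideal M R" using maximalideal_prime[OF M] .
  interpret localization R "carrier R - M" using localization_at_prime[OF is_cring Mp] .
  define C where "C i = (if i = 0 then extension P else if i = 1 then extension P' else extension M)" for i :: nat
  have PM: "P \<subset> M" using P by auto
  have "(\<forall>i\<le>2. primeideal (C i) L) \<and> (\<forall>i<2. C i \<subset> C (Suc i))"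
  proof (intro conjI allI impI)
    fix i :: nat
    show "primeideal (C i) L"
      using primeideal_extension[OF P(1)] primeideal_extension[OF P(2)] primeideal_extension[OF Mp] P(4) PM by (auto simp: C_def)
    assume i: "i < 2"
    have "extension P \<subset> extension P'" using extension_strict_mono[OF P(1,3,2)] P(4) by auto
    moreover have "extension P' \<subset> extension M" using extension_strict_mono[OF P(2,4) Mp] by auto
    ultimately show "C i \<subset> C (Suc i)" using i by (auto simp: C_def less_2_cases_iff)
  qed
  then have "enat 2 \<in> {enat n | n. \<exists>P :: nat \<Rightarrow> _. (\<forall>i\<le>n. primeideal (P i) L) \<and> (\<forall>i<n. P i \<subset> P (Suc i))}" by blast
  then have "enat 2 \<le> krull_dim L" unfolding krull_dim_def by (rule Sup_upper)
  then show False using dim by (simp add: one_enat_def)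
qed

text \<open>
  Since the local ring has depth \<open>1\<close>, some \<open>a \<in> M\<close> is a nonzerodivisor in it. If \<open>M\<close> consisted of zero
  divisors, it would be contained in, hence equal to, the annihilator of some \<open>z \<noteq> 0\<close>. From \<open>a z = 0\<close> it
  follows that \<open>z\<close> vanishes in the localization, so an element outside \<open>M\<close> kills \<open>z\<close>.
\<close>

lemma (in noetherian_cring) maximal_contains_nonzerodivisor:
  assumes M: "maximalideal M R" and cm: "cohen_macaulay_local (loc_ring_at R M)"
    and dim: "krull_dim (loc_ring_at R M) = 1"
  shows "M \<inter> nonzerodivisors R \<noteq> {}"
proof
  assume none: "M \<inter> nonzerodivisors R = {}"
  interpret M: maximalideal M R by fact
  interpret localization R "carrier R - M" using localization_at_prime[OF is_cring maximalideal_prime[OF M]] .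
  interpret L: cring L by (rule cring_L)
  obtain m where m: "maximalideal m L" "ideal_depth L m = 1"
    using cm dim unfolding cohen_macaulay_local_def by auto
  have "0 < Sup {enat (length xs) | xs. regular_sequence L xs \<and> set xs \<subseteq> m}"
    using m(2) unfolding ideal_depth_def by simp
  then obtain xs where xs: "regular_sequence L xs" "set xs \<subseteq> m" "0 < length xs"
    by (auto simp: less_Sup_iff zero_enat_def)
  define x where "x = xs ! 0"
  have xm: "x \<in> m" using xs by (auto simp: x_def)
  have xc: "x \<in> carrier L" using xm m(1) by (meson ideal.Icarr maximalideal.axioms(1))
  have reg: "a = \<zero>\<^bsub>L\<^esub>" if "a \<in> carrier L" "x \<otimes>\<^bsub>L\<^esub> a = \<zero>\<^bsub>L\<^esub>" for a
  proof -
    have idl: "Idl\<^bsub>L\<^esub> {} = {\<zero>\<^bsub>L\<^esub>}"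
      using L.genideal_minimal[OF L.zeroideal, of "{}"] additive_subgroup.zero_closed[OF ideal.axioms(1)[OF L.genideal_ideal[of "{}"]]] by auto
    have "\<forall>a\<in>carrier L. xs ! 0 \<otimes>\<^bsub>L\<^esub> a \<in> Idl\<^bsub>L\<^esub> (set (take 0 xs)) \<longrightarrow> a \<in> Idl\<^bsub>L\<^esub> (set (take 0 xs))"
      using xs(1,3) unfolding regular_sequence_def by blast
    then show ?thesis using that unfolding x_def[symmetric] by (simp add: idl)
  qed
  obtain a s where a: "a \<in> carrier R" "s \<in> carrier R - M" "x = fr a s" using xc by (auto simp: L_carrier)
  have sc: "s \<in> carrier R" using a(2) by auto
  have "a \<in> M"
  proof (rule ccontr)
    assume "a \<notin> M"
    then have aS: "a \<in> carrier R - M" using a by auto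
    have "x \<otimes>\<^bsub>L\<^esub> fr s a = fr ((a \<otimes> s) \<otimes> \<one>) ((a \<otimes> s) \<otimes> \<one>)"
      unfolding a(3) using L_mult[OF a(1) sc a(2) aS] a(1) sc by (simp add: m_comm)
    also have "\<dots> = \<one>\<^bsub>L\<^esub>" using fr_cancel(1)[OF one_closed S_one S_mult[OF aS a(2)]] by (simp add: L_one)
    finally have "\<one>\<^bsub>L\<^esub> \<in> m"
      using ideal.I_r_closed[OF maximalideal.axioms(1)[OF m(1)] xm L_carrierI[OF sc aS]] by simp
    then show False
      using ideal.one_imp_carrier[OF maximalideal.axioms(1)[OF m(1)]] maximalideal.I_notcarr[OF m(1)] by simp
  qed
  obtain z where z: "z \<in> carrier R" "z \<noteq> \<zero>" "\<forall>a\<in>M. a \<otimes> z = \<zero>"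
    using ideal_of_zerodivisors_annihilated[OF M.is_ideal none] by auto
  have "x \<otimes>\<^bsub>L\<^esub> fr z \<one> = fr (s \<otimes> \<zero>) (s \<otimes> \<one>)"
    unfolding a(3) using L_mult[OF a(1) z(1) a(2) S_one] z(3) \<open>a \<in> M\<close> sc by simp
  also have "\<dots> = \<zero>\<^bsub>L\<^esub>" using fr_cancel(1)[OF zero_closed S_one a(2)] by (simp add: L_zero)
  finally have "fr z \<one> = fr \<zero> \<one>" using reg L_carrierI[OF z(1) S_one] by (simp add: L_zero)
  from fr_eqD[OF this z(1) zero_closed S_one S_one]
  obtain u where u: "u \<in> carrier R - M" "u \<otimes> (\<one> \<otimes> z) = u \<otimes> (\<one> \<otimes> \<zero>)" by (rule bexE)
  then have uz: "u \<in> annihilator z" using z(1) by (auto simp: annihilator_def)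
  have "M \<subseteq> annihilator z" using z(3) M.a_subset by (auto simp: annihilator_def)
  moreover have "annihilator z \<subseteq> carrier R" by (auto simp: annihilator_def)
  ultimately have "annihilator z = M \<or> annihilator z = carrier R"
    using M.I_maximal[OF ideal_annihilator[OF z(1)]] by blast
  then have "\<one> \<in> annihilator z" using uz u(1) by auto
  then show False using z by (simp add: annihilator_def)
qed

section \<open>The total ring of fractions\<close>

context cring
begin

abbreviation to_total_frac :: "'a \<Rightarrow> ('a \<times> 'a) set" where
  "to_total_frac a \<equiv> loc_frac (mult_module R (carrier R)) (nonzerodivisors R) a \<one>"

lemma localization_nonzerodivisors: "localization R (nonzerodivisors R)"
proof unfold_locales
  show "nonzerodivisors R \<subseteq> carrier R" "\<one> \<in> nonzerodivisors R" by (auto simp: nonzerodivisors_def)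
  show "s \<otimes> t \<in> nonzerodivisors R" if "s \<in> nonzerodivisors R" "t \<in> nonzerodivisors R" for s t
    unfolding nonzerodivisors_def mem_Collect_eq
  proof (intro conjI ballI impI)
    have c: "s \<in> carrier R" "t \<in> carrier R" using that by (auto simp: nonzerodivisors_def)
    then show "s \<otimes> t \<in> carrier R" by simp
    fix a assume a: "a \<in> carrier R" "s \<otimes> t \<otimes> a = \<zero>"
    then have "s \<otimes> (t \<otimes> a) = \<zero>" using c by (simp add: m_assoc)
    then have "t \<otimes> a = \<zero>" using that(1) a(1) c unfolding nonzerodivisors_def by blast
    then show "a = \<zero>" using that(2) a(1) unfolding nonzerodivisors_def by blast
  qed
qed

lemma nonzerodivisor_unit_total_frac:
  assumes "s \<in> nonzerodivisors R"
  shows "to_total_frac s \<in> Units (total_frac R)"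
proof -
  interpret localization R "nonzerodivisors R" by (rule localization_nonzerodivisors)
  have Q: "total_frac R = L" by (simp add: total_frac_def)
  interpret L: cring L by (rule cring_L)
  have sc: "s \<in> carrier R" using S_closed[OF assms] .
  have inv: "to_total_frac s \<otimes>\<^bsub>L\<^esub> fr \<one> s = \<one>\<^bsub>L\<^esub>"
    using L_mult[OF sc one_closed S_one assms] fr_cancel(1)[OF one_closed S_one assms] sc by (simp add: L_one)
  show ?thesis unfolding Q
    by (rule L.unit_factor[of _ "fr \<one> s"]) (use inv assms sc in \<open>auto simp: L_carrierI S_one\<close>)
qed

lemma fraction_embedding_total_frac: "fraction_embedding R (total_frac R) to_total_frac"
proof -
  interpret localization R "nonzerodivisors R" by (rule localization_nonzerodivisors)
  have Q: "total_frac R = L" by (simp add: total_frac_def)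
  interpret L: cring L by (rule cring_L)
  show ?thesis unfolding Q
  proof unfold_locales
    show "to_total_frac \<in> ring_hom R L"
      by (rule ring_hom_memI) (auto simp: L_carrierI S_one L_mult L_add L_one)
    show "inj_on to_total_frac (carrier R)"
    proof (rule inj_onI)
      fix a b assume h: "a \<in> carrier R" "b \<in> carrier R" "to_total_frac a = to_total_frac b"
      obtain u where u: "u \<in> nonzerodivisors R" "u \<otimes> (\<one> \<otimes> a) = u \<otimes> (\<one> \<otimes> b)"
        using fr_eqD[OF h(3,1,2) S_one S_one] by auto
      have uc: "u \<in> carrier R" using S_closed[OF u(1)] .
      have "u \<otimes> (a \<ominus> b) = u \<otimes> a \<ominus> u \<otimes> b" using uc h(1,2) by algebra
      also have "\<dots> = \<zero>" using u(2) uc h(1,2) by (simp add: a_minus_def r_neg)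
      finally have "a \<ominus> b = \<zero>" using u(1) h(1,2) by (auto simp: nonzerodivisors_def)
      then show "a = b" using h(1,2) by simp
    qed
    fix q assume "q \<in> carrier L"
    then obtain a s where a: "a \<in> carrier R" "s \<in> nonzerodivisors R" "q = fr a s" by (auto simp: L_carrier)
    have sc: "s \<in> carrier R" using S_closed[OF a(2)] .
    have "to_total_frac s \<in> Units L" using nonzerodivisor_unit_total_frac[OF a(2)] by (simp add: Q)
    moreover have "to_total_frac s \<otimes>\<^bsub>L\<^esub> q = to_total_frac a"
      unfolding a(3) using L_mult[OF sc a(1) S_one a(2)] fr_cancel(1)[OF a(1) S_one a(2)] sc by simp
    ultimately show "\<exists>s\<in>carrier R. to_total_frac s \<in> Units L \<and> to_total_frac s \<otimes>\<^bsub>L\<^esub> q \<in> to_total_frac ` carrier R"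
      using sc a(1) by (intro bexI[of _ s]) auto
  qed
qed

end

section \<open>Transfer between a ring and its image among the fractions\<close>

context fraction_embedding
begin

lemma unit_imp_nonzerodivisor:
  assumes "s \<in> carrier R" "\<iota> s \<in> Units Q"
  shows "s \<in> nonzerodivisors R"
  unfolding nonzerodivisors_def mem_Collect_eq
proof (intro conjI ballI impI)
  fix a assume a: "a \<in> carrier R" "s \<otimes> a = \<zero>"
  then have "\<iota> s \<otimes>\<^bsub>Q\<^esub> \<iota> a = \<iota> s \<otimes>\<^bsub>Q\<^esub> \<zero>\<^bsub>Q\<^esub>"
    using assms \<iota>_simps by (metis Q.Units_closed Q.r_null)
  then have "\<iota> a = \<iota> \<zero>" using assms(2) a(1) \<iota>_simps by (simp add: Q.Units_l_cancel)
  then show "a = \<zero>" using a(1) \<iota>_eq by simp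
qed (rule assms)

lemma subring_image: "subring K Q"
proof (rule Q.subringI)
  show "\<one>\<^bsub>Q\<^esub> \<in> K" using \<iota>_simps(4) by (metis R.one_closed imageI)
  show "\<ominus>\<^bsub>Q\<^esub> h \<in> K" if "h \<in> K" for h using that \<iota>_simps(6) by (auto intro: rev_image_eqI)
  show "h1 \<otimes>\<^bsub>Q\<^esub> h2 \<in> K" if "h1 \<in> K" "h2 \<in> K" for h1 h2
    using that \<iota>_simps(3)[symmetric] by auto
  show "h1 \<oplus>\<^bsub>Q\<^esub> h2 \<in> K" if "h1 \<in> K" "h2 \<in> K" for h1 h2
    using that \<iota>_simps(2)[symmetric] by auto
qed (use \<iota>_simps in auto)

definition contraction :: "'q set \<Rightarrow> 'a set" where
  "contraction X = {r \<in> carrier R. \<iota> r \<in> X}"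

lemma image_contraction: "X \<subseteq> K \<Longrightarrow> \<iota> ` contraction X = X"
  by (auto simp: contraction_def)

lemma ideal_contraction:
  assumes X: "Q.submod K X"
  shows "ideal (contraction X) R"
  unfolding R.ideal_iff_submod
  by (rule R.submodI) (use Q.submodD[OF X] in \<open>auto simp: contraction_def \<iota>_simps\<close>)

lemma submod_image:
  assumes I: "ideal I R"
  shows "Q.submod K (\<iota> ` I)"
proof -
  have Is: "R.submod (carrier R) I" using I by (simp add: R.ideal_iff_submod)
  note D = R.submodD[OF Is]
  show ?thesis
  proof (rule Q.submodI)
    show "\<iota> ` I \<subseteq> carrier Q" using D(2) \<iota>_simps(1) by auto
    show "\<zero>\<^bsub>Q\<^esub> \<in> \<iota> ` I" using D(3) \<iota>_simps(5) by (metis imageI)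
    show "x \<oplus>\<^bsub>Q\<^esub> y \<in> \<iota> ` I" if "x \<in> \<iota> ` I" "y \<in> \<iota> ` I" for x y
      using that D(2,4) \<iota>_simps(2)[symmetric] by auto
    show "x \<otimes>\<^bsub>Q\<^esub> y \<in> \<iota> ` I" if "x \<in> K" "y \<in> \<iota> ` I" for x y
      using that D(2,5) \<iota>_simps(3)[symmetric] by auto
  qed
qed

lemma primeideal_contraction:
  assumes P: "Q.is_prime K P"
  shows "primeideal (contraction P) R"
proof (rule primeidealI)
  have Ps: "Q.submod K P" using P by (simp add: Q.is_prime_def)
  show "ideal (contraction P) R" using ideal_contraction[OF Ps] .
  have "\<one> \<notin> contraction P" using P \<iota>_simps(4) by (simp add: Q.is_prime_def contraction_def)
  then show "carrier R \<noteq> contraction P" using R.one_closed by blast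
  show "a \<in> contraction P \<or> b \<in> contraction P" if "a \<in> carrier R" "b \<in> carrier R" "a \<otimes> b \<in> contraction P" for a b
    using that P \<iota>_simps(3) by (auto simp: Q.is_prime_def contraction_def)
qed (rule R.is_cring)

text \<open>
  Ideals and prime ideals of the image \<open>K\<close> contract to those of \<open>R\<close>, so everything is translated from \<open>R\<close>.
  For \<open>prime_chain\<close>: if \<open>r \<notin> p'\<close> were not invertible modulo \<open>p'\<close>, then \<open>p'\<close> and \<open>r\<close> would lie in a common
  maximal ideal, strictly above \<open>p'\<close>.
\<close>

lemma one_dim_fractions_image:
  assumes noeth: "noetherian_ring R"
    and M_reg: "\<And>M. maximalideal M R \<Longrightarrow> M \<inter> nonzerodivisors R \<noteq> {}"
    and units: "\<And>s. s \<in> nonzerodivisors R \<Longrightarrow> \<iota> s \<in> Units Q"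
    and chain: "\<And>M P P'. \<lbrakk>maximalideal M R; primeideal P R; primeideal P' R; P \<subset> P'; P' \<subset> M\<rbrakk> \<Longrightarrow> False"
  shows "one_dim_fractions Q K"
proof -
  interpret noetherian_ring R by fact
  interpret N: noetherian_cring R by unfold_locales
  show ?thesis
  proof (rule one_dim_fractions.intro[OF Q.is_cring one_dim_fractions_axioms.intro])
    show "subring K Q" by (rule subring_image)
    show "\<exists>s\<in>K \<inter> Units Q. s \<otimes>\<^bsub>Q\<^esub> q \<in> K" if "q \<in> carrier Q" for q
      using denom[OF that] by blast
  next
    fix \<F> :: "'q set set" assume F: "\<F> \<noteq> {}" "\<And>I. I \<in> \<F> \<Longrightarrow> Q.submod K I \<and> I \<subseteq> K"
    have "\<exists>I\<in>contraction ` \<F>. \<forall>J\<in>contraction ` \<F>. I \<subseteq> J \<longrightarrow> J = I"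
      by (rule N.maximal_in_family) (use F ideal_contraction in auto)
    then obtain X where X: "X \<in> \<F>" "\<And>Y. \<lbrakk>Y \<in> \<F>; contraction X \<subseteq> contraction Y\<rbrakk> \<Longrightarrow> contraction Y = contraction X" by auto
    have "Y = X" if "Y \<in> \<F>" "X \<subseteq> Y" for Y
    proof -
      have "contraction X \<subseteq> contraction Y" using that(2) by (auto simp: contraction_def)
      then have "\<iota> ` contraction Y = \<iota> ` contraction X" using X(2)[OF that(1)] by simp
      then show ?thesis using image_contraction F(2) X(1) that(1) by simp
    qed
    then show "\<exists>I\<in>\<F>. \<forall>J\<in>\<F>. I \<subseteq> J \<longrightarrow> J = I" using X(1) by blast
  next
    fix D assume D: "Q.submod K D" "D \<subseteq> K"
      "\<And>x. x \<in> K \<inter> Units Q \<Longrightarrow> \<exists>r\<in>K. \<one>\<^bsub>Q\<^esub> \<ominus>\<^bsub>Q\<^esub> x \<otimes>\<^bsub>Q\<^esub> r \<in> D"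
    show "\<one>\<^bsub>Q\<^esub> \<in> D"
    proof (rule ccontr)
      assume "\<one>\<^bsub>Q\<^esub> \<notin> D"
      then have "\<one> \<notin> contraction D" by (simp add: contraction_def \<iota>_simps)
      then obtain M where M: "maximalideal M R" "contraction D \<subseteq> M" using N.in_maximal_ideal[OF ideal_contraction[OF D(1)]] by blast
      have Mi: "ideal M R" using maximalideal.axioms(1)[OF M(1)] .
      then have Ms: "R.submod (carrier R) M" by (simp add: R.ideal_iff_submod)
      obtain x where x: "x \<in> M" "x \<in> nonzerodivisors R" using M_reg[OF M(1)] by auto
      have xc: "x \<in> carrier R" using R.submodD(2)[OF Ms x(1)] .
      obtain r where r: "r \<in> carrier R" "\<one>\<^bsub>Q\<^esub> \<ominus>\<^bsub>Q\<^esub> \<iota> x \<otimes>\<^bsub>Q\<^esub> \<iota> r \<in> D" using D(3)[of "\<iota> x"] units[OF x(2)] xc by auto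
      have "\<iota> (\<one> \<ominus> x \<otimes> r) \<in> D" using r xc by (simp add: a_minus_def \<iota>_simps)
      then have "\<one> \<ominus> x \<otimes> r \<in> M" using r(1) xc M(2) by (auto simp: contraction_def)
      then have "(\<one> \<ominus> x \<otimes> r) \<oplus> r \<otimes> x \<in> M" using R.submodD(4,5)[OF Ms] x(1) r(1) by blast
      moreover have "(\<one> \<ominus> x \<otimes> r) \<oplus> r \<otimes> x = \<one>" using r(1) xc by algebra
      ultimately show False
        using ideal.one_imp_carrier[OF Mi] maximalideal.I_notcarr[OF M(1)] by simp
    qed
  next
    fix p p' r assume p: "Q.is_prime K p" "Q.is_prime K p'" "p \<subset> p'" "r \<in> K" "r \<notin> p'"
    have pK: "p \<subseteq> K" "p' \<subseteq> K" "Q.submod K p'" using p by (auto simp: Q.is_prime_def)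
    obtain a where a: "a \<in> carrier R" "r = \<iota> a" using p(4) by auto
    let ?P = "contraction p'"
    have Ps: "R.submod (carrier R) ?P" using ideal_contraction[OF pK(3)] by (simp add: R.ideal_iff_submod)
    let ?J = "{x \<oplus> y | x y. x \<in> ?P \<and> y \<in> (\<lambda>r. a \<otimes> r) ` carrier R}"
    have Jm: "R.submod (carrier R) ?J"
      by (intro R.submod_sum R.submod_multiples R.submod_self R.carrier_is_subring Ps a) auto
    have "\<one> \<in> ?J"
    proof (rule ccontr)
      assume notin: "\<one> \<notin> ?J"
      have "ideal ?J R" using Jm by (simp only: R.ideal_iff_submod)
      then obtain M where M: "maximalideal M R" "?J \<subseteq> M"
        by (rule N.in_maximal_ideal[OF _ notin])
      have "x \<in> ?J" if "x \<in> ?P" for x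
      proof -
        have "x = x \<oplus> a \<otimes> \<zero>" using a R.submodD(2)[OF Ps that] by simp
        then show ?thesis using that by blast
      qed
      moreover have "a \<in> ?J"
      proof -
        have "a = \<zero> \<oplus> a \<otimes> \<one>" using a by simp
        then show ?thesis using R.submodD(3)[OF Ps] by blast
      qed
      moreover have "a \<notin> ?P" using p(5) a by (simp add: contraction_def)
      ultimately have "?P \<subset> M" using M(2) by blast
      moreover have "contraction p \<subset> ?P"
      proof -
        have "contraction p \<subseteq> ?P" using p(3) by (auto simp: contraction_def)
        moreover have "\<iota> ` contraction p \<noteq> \<iota> ` ?P" unfolding image_contraction[OF pK(1)] image_contraction[OF pK(2)] using p(3) by blast
        ultimately show ?thesis by blast
      qed
      ultimately show False using chain[OF M(1) primeideal_contraction[OF p(1)] primeideal_contraction[OF p(2)]] by blast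
    qed
    then obtain x b where x: "x \<in> ?P" "b \<in> carrier R" "\<one> = x \<oplus> a \<otimes> b" by auto
    have xc: "x \<in> carrier R" using R.submodD(2)[OF Ps x(1)] .
    have "(x \<oplus> a \<otimes> b) \<ominus> a \<otimes> b = x" using xc a(1) x(2) by algebra
    then have "\<one> \<ominus> a \<otimes> b = x" unfolding x(3)[symmetric] .
    then have "\<iota> (\<one> \<ominus> a \<otimes> b) \<in> p'" using x(1) by (simp add: contraction_def)
    then have "\<one>\<^bsub>Q\<^esub> \<ominus>\<^bsub>Q\<^esub> r \<otimes>\<^bsub>Q\<^esub> \<iota> b \<in> p'" using a x(2) by (simp add: a_minus_def \<iota>_simps)
    then show "\<exists>s\<in>K. \<one>\<^bsub>Q\<^esub> \<ominus>\<^bsub>Q\<^esub> r \<otimes>\<^bsub>Q\<^esub> s \<in> p'" using x(2) by blast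
  qed
qed

end

context one_dim_fractions
begin

text \<open>
  The dual basis lemma for submodules of \<open>Q\<close> that contain \<open>1\<close>. Linear maps between such modules are
  multiplications by elements of \<open>Q\<close>, so the coordinates of \<open>x\<close> are \<open>x v\<^sub>b\<close>, where \<open>v\<close> are the coordinates of
  \<open>1\<close>. Only finitely many \<open>v\<^sub>b\<close> are nonzero, and \<open>1\<close> is the sum of the products of \<open>v\<^sub>b \<in> A : X\<close> with the
  images of the basis vectors.
\<close>

lemma one_in_prod_of_projective:
  assumes A: "subring A Q" "K \<subseteq> A" and X: "submod A X" "\<one> \<in> X"
    and proj: "projective_module (Q\<lparr>carrier := A\<rparr>) (mult_module Q X)"
  shows "\<one> \<in> X \<cdot> colon Q A X"
proof -
  let ?A = "Q\<lparr>carrier := A\<rparr>" let ?M = "mult_module Q X" let ?Y = "colon Q A X"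
  obtain B i p where B: "B \<subseteq> X" and i: "i \<in> lin_maps ?A ?M (free_module ?A B)"
    and p: "p \<in> lin_maps ?A (free_module ?A B) ?M" and pi: "\<And>x. x \<in> X \<Longrightarrow> p (i x) = x"
    using proj unfolding projective_module_def by (auto simp: mult_module_def)
  let ?F = "free_module ?A B"
  have Fc: "carrier ?F = {v \<in> B \<rightarrow>\<^sub>E A. finite {b \<in> B. v b \<noteq> \<zero>}}" by (simp add: free_module_def)
  have Ac: "a \<in> A \<Longrightarrow> a \<in> carrier Q" for a using subringE(1)[OF A(1)] by auto
  have Xc: "x \<in> X \<Longrightarrow> x \<in> carrier Q" for x using submodD(2)[OF X(1)] .
  have i1: "i x \<in> carrier ?F" if "x \<in> X" for x using i that by (auto simp: lin_maps_def mult_module_def)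
  have i2: "i (a \<otimes> x) b = a \<otimes> i x b" if "a \<in> A" "x \<in> X" "b \<in> B" for a x b
    using i that by (auto simp: lin_maps_def mult_module_def free_module_def)
  have p1: "p v \<in> X" if "v \<in> carrier ?F" for v using p that by (auto simp: lin_maps_def mult_module_def)
  have p2: "p (v \<oplus>\<^bsub>?F\<^esub> w) = p v \<oplus> p w" if "v \<in> carrier ?F" "w \<in> carrier ?F" for v w
    using p that by (auto simp: lin_maps_def mult_module_def)
  have p3: "p (a \<odot>\<^bsub>?F\<^esub> v) = a \<otimes> p v" if "a \<in> A" "v \<in> carrier ?F" for a v
    using p that by (auto simp: lin_maps_def mult_module_def)
  define v where "v = i \<one>"
  have v: "v \<in> carrier ?F" unfolding v_def using i1[OF X(2)] .
  have vA: "v b \<in> A" if "b \<in> B" for b using v that unfolding Fc by blast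
  have ix: "i x b = x \<otimes> v b" if x: "x \<in> X" and b: "b \<in> B" for x b
  proof -
    obtain d where d: "d \<in> reg" "d \<otimes> x \<in> K" using denominator[OF Xc[OF x]] by auto
    have dc: "d \<in> carrier Q" using d by auto
    have c: "i x b \<in> A" using i1[OF x] b unfolding Fc by blast
    have "d \<otimes> i x b = i (d \<otimes> x) b" using i2[OF _ x b, of d] d A(2) by auto
    also have "\<dots> = i ((d \<otimes> x) \<otimes> \<one>) b" using dc Xc[OF x] by simp
    also have "\<dots> = (d \<otimes> x) \<otimes> v b" unfolding v_def using i2[OF _ X(2) b, of "d \<otimes> x"] d A(2) by auto
    also have "\<dots> = d \<otimes> (x \<otimes> v b)" using dc Xc[OF x] Ac[OF vA[OF b]] by (simp add: m_assoc)
    finally show ?thesis using d Xc[OF x] Ac[OF vA[OF b]] Ac[OF c] by (simp add: Units_l_cancel)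
  qed
  have vY: "v b \<in> ?Y" if b: "b \<in> B" for b
  proof (rule colonI)
    show "v b \<in> carrier Q" using Ac[OF vA[OF b]] .
    fix x assume x: "x \<in> X"
    have "i x b \<in> A" using i1[OF x] b unfolding Fc by blast
    then show "v b \<otimes> x \<in> A" using ix[OF x b] Xc[OF x] Ac[OF vA[OF b]] by (simp add: m_comm)
  qed
  have A01: "\<zero> \<in> A" "\<one> \<in> A" using subringE(2,3)[OF A(1)] by auto
  have span: "p w \<in> X \<cdot> ?Y"
    if "finite S" "S \<subseteq> B" "w \<in> carrier ?F" "\<And>b. b \<in> B \<Longrightarrow> b \<notin> S \<Longrightarrow> w b = \<zero>" "\<And>b. b \<in> B \<Longrightarrow> w b \<in> ?Y" for S w
    using that
  proof (induct S arbitrary: w)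
    case empty
    have wc: "w b = undefined" if "b \<notin> B" for b using empty(2) that unfolding Fc by (auto simp: PiE_def extensional_def)
    have eq: "\<zero> \<odot>\<^bsub>?F\<^esub> w = w"
      using empty wc by (auto simp: free_module_def fun_eq_iff restrict_def)
    have "p w = \<zero> \<otimes> p w" using p3[OF A01(1) empty(2)] unfolding eq .
    also have "\<dots> = \<zero>" using Xc[OF p1[OF empty(2)]] by simp
    finally have "p w = \<zero>" .
    moreover have "\<zero> \<otimes> \<zero> \<in> X \<cdot> ?Y"
      by (rule ideal_prod.prod) (use submodD(3)[OF X(1)] Xc A01 in \<open>auto intro!: colonI\<close>)
    ultimately show ?case by simp
  next
    case (insert b S)
    have b: "b \<in> B" using insert by auto
    have wA: "w c \<in> A" if "c \<in> B" for c using insert(5) that unfolding Fc by blast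
    have wext: "w c = undefined" if "c \<notin> B" for c using insert(5) that unfolding Fc by (auto simp: PiE_def extensional_def)
    define e where "e = (\<lambda>c\<in>B. if c = b then \<one> else \<zero>)"
    define w' where "w' = (\<lambda>c\<in>B. if c = b then \<zero> else w c)"
    have e: "e \<in> carrier ?F" unfolding Fc
    proof -
      have "{c \<in> B. e c \<noteq> \<zero>} \<subseteq> {b}" by (auto simp: e_def)
      then have "finite {c \<in> B. e c \<noteq> \<zero>}" using finite_subset by blast
      then show "e \<in> {v \<in> B \<rightarrow>\<^sub>E A. finite {b \<in> B. v b \<noteq> \<zero>}}" using A01 by (auto simp: e_def)
    qed
    have w': "w' \<in> carrier ?F" unfolding Fc
    proof -
      have "{c \<in> B. w' c \<noteq> \<zero>} \<subseteq> S" using insert(6) by (auto simp: w'_def)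
      then have "finite {c \<in> B. w' c \<noteq> \<zero>}" using finite_subset insert(1) by blast
      then show "w' \<in> {v \<in> B \<rightarrow>\<^sub>E A. finite {b \<in> B. v b \<noteq> \<zero>}}" using A01 wA by (auto simp: w'_def)
    qed
    have we: "w b \<odot>\<^bsub>?F\<^esub> e \<in> carrier ?F" unfolding Fc
    proof -
      have "{c \<in> B. (w b \<odot>\<^bsub>?F\<^esub> e) c \<noteq> \<zero>} \<subseteq> {b}" using Ac[OF wA[OF b]] by (auto simp: e_def free_module_def)
      then have "finite {c \<in> B. (w b \<odot>\<^bsub>?F\<^esub> e) c \<noteq> \<zero>}" using finite_subset by blast
      then show "(w b \<odot>\<^bsub>?F\<^esub> e) \<in> {v \<in> B \<rightarrow>\<^sub>E A. finite {b \<in> B. v b \<noteq> \<zero>}}"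
        using A01 wA[OF b] Ac[OF wA[OF b]] by (auto simp: e_def free_module_def)
    qed
    have "w = w' \<oplus>\<^bsub>?F\<^esub> (w b \<odot>\<^bsub>?F\<^esub> e)"
      using wext Ac[OF wA] b by (auto simp: free_module_def fun_eq_iff restrict_def w'_def e_def)
    then have "p w = p w' \<oplus> w b \<otimes> p e" using p2[OF w' we] p3[OF wA[OF b] e] by simp
    moreover have "p w' \<in> X \<cdot> ?Y"
    proof (rule insert(3)[OF _ w'])
      show "S \<subseteq> B" using insert by auto
      show "w' c = \<zero>" if "c \<in> B" "c \<notin> S" for c using that insert(6) by (auto simp: w'_def)
      have "\<zero> \<in> ?Y" using Xc A01 by (auto intro!: colonI)
      then show "w' c \<in> ?Y" if "c \<in> B" for c using that insert(7) by (auto simp: w'_def)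
    qed
    moreover have "w b \<otimes> p e \<in> X \<cdot> ?Y"
      using ideal_prod.prod[OF p1[OF e] insert(7)[OF b], of Q] Xc[OF p1[OF e]] Ac[OF wA[OF b]] by (simp add: m_comm)
    ultimately show ?case using ideal_prod.sum by metis
  qed
  have "p v \<in> X \<cdot> ?Y"
    by (rule span[of "{b \<in> B. v b \<noteq> \<zero>}"]) (use v vY in \<open>auto simp: Fc\<close>)
  then show ?thesis using pi[OF X(2)] unfolding v_def by simp
qed

end

section \<open>Anti-stable rings are stable\<close>

theorem theorem1p4:
  fixes R :: "('a, 'm) ring_scheme"
  assumes "cohen_macaulay R"
    and "\<And>M. maximalideal M R \<Longrightarrow> krull_dim (loc_ring_at R M) = 1"
    and "anti_stable_ring R"
  shows "stable_ring R"
proof -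
  have R: "cring R" "noetherian_ring R" using assms(1) by (auto simp: cohen_macaulay_def)
  interpret cring R by fact
  interpret noetherian_ring R by fact
  interpret noetherian_cring R by unfold_locales
  let ?Q = "total_frac R"
  interpret fraction_embedding R ?Q to_total_frac by (rule fraction_embedding_total_frac)
  have one_dim: "one_dim_fractions ?Q K"
  proof (rule one_dim_fractions_image[OF R(2)])
    show "M \<inter> nonzerodivisors R \<noteq> {}" if "maximalideal M R" for M
      using maximal_contains_nonzerodivisor[OF that] assms(1,2) that by (auto simp: cohen_macaulay_def)
    show False if "maximalideal M R" "primeideal P R" "primeideal P' R" "P \<subset> P'" "P' \<subset> M" for M P P'
      using no_chain_below_maximal[OF that(1) assms(2)[OF that(1)] that(2-)] .
  qed (rule nonzerodivisor_unit_total_frac)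
  interpret F: one_dim_fractions ?Q K by (rule one_dim)
  interpret F: anti_stable_fractions ?Q K
  proof
    fix I assume I: "Q.submod K I" "I \<subseteq> K" "I \<inter> Units ?Q \<noteq> {}"
    obtain s where s: "s \<in> carrier R" "to_total_frac s \<in> I" "to_total_frac s \<in> Units ?Q"
      using I(2,3) by blast
    have "s \<in> contraction I \<inter> nonzerodivisors R"
      using s unit_imp_nonzerodivisor[OF s(1,3)] by (simp add: contraction_def)
    then have "regular_ideal R (contraction I)" using ideal_contraction[OF I(1)] by (auto simp: regular_ideal_def)
    then have "projective_module (colon_ring R (contraction I)) (colon_module R (contraction I))"
      using assms(3) by (simp add: anti_stable_ring_def invertible_module_def)
    moreover have "in_total_frac R (contraction I) = I" using image_contraction[OF I(2)] by (simp add: in_total_frac_def)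
    moreover have "in_total_frac R (carrier R) = K" by (simp add: in_total_frac_def)
    ultimately have proj: "projective_module (?Q\<lparr>carrier := colon ?Q I I\<rparr>) (mult_module ?Q (colon ?Q K I))"
      by (simp add: colon_ring_def colon_module_def)
    have A: "subring (colon ?Q I I) ?Q" "K \<subseteq> colon ?Q I I" using Q.subring_colon_self[OF I(1) F.subring_K] .
    show "\<one>\<^bsub>?Q\<^esub> \<in> colon ?Q K I \<cdot>\<^bsub>?Q\<^esub> colon ?Q (colon ?Q I I) (colon ?Q K I)"
    proof (rule F.one_in_prod_of_projective[OF A _ _ proj])
      show "Q.submod (colon ?Q I I) (colon ?Q K I)"
        using Q.submod_colon_over_multipliers[OF F.submod_K Q.submodD(1)[OF I(1)]] .
      show "\<one>\<^bsub>?Q\<^esub> \<in> colon ?Q K I" using I(2) Q.submodD(2)[OF I(1)] by (auto intro!: Q.colonI)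
    qed
  qed
  have "projective_module (End_ring R (mult_module R I)) (End_module (mult_module R I))" if I: "ideal I R" for I
  proof -
    have I': "Q.submod K (to_total_frac ` I)" "to_total_frac ` I \<subseteq> K"
      using submod_image[OF I] ideal.Icarr[OF I] by auto
    obtain u where u: "u \<in> to_total_frac ` I" "\<exists>G. F.regular_fractional G \<and> to_total_frac ` I = (\<lambda>g. u \<otimes>\<^bsub>?Q\<^esub> g) ` G"
      using F.ideal_eq_multiple_of_regular_fractional[OF I'] by (rule bexE)
    from u(2) obtain G where G: "F.regular_fractional G" "to_total_frac ` I = (\<lambda>g. u \<otimes>\<^bsub>?Q\<^esub> g) ` G"
      by (elim exE conjE)
    have uc: "u \<in> carrier ?Q" using Q.submodD(2)[OF I'(1) u(1)] .
    have Gs: "Q.submod K G" using G(1) by (simp add: F.regular_fractional_def)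
    show ?thesis
      by (rule projective_of_fractional_factor[OF I uc Gs G(2) F.regular_fractional_stable_reflexive(1)[OF G(1)]])
  qed
  then show ?thesis using R(1) by (simp add: stable_ring_def)
qed

end
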